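(* Let $\mathfrak{A}$ and $\mathfrak{B}$ be $\mathbf{Gray}$-categories, let $F,G:\mathfrak{A}\to\mathfrak{B}$ be $\mathbf{Gray}$-functors, and let $(F,G):\mathfrak{A}\to\mathfrak{B}\times\mathfrak{B}$ be the induced $\mathbf{Gray}$-functor. Consider the $3$-globular $\mathbf{Gray}$-category of path objects $$[\mathfrak{P}_3,\mathfrak{B}]\rightrightarrows[\mathfrak{P}_2,\mathfrak{B}]\rightrightarrows[\mathfrak{P}_1,\mathfrak{B}]\rightrightarrows\mathfrak{B}$$ with source and target $\mathbf{Gray}$-functors $(s_2,t_2)$, $(s_1,t_1)$, $(s_0,t_0)$. It classifies the cells of the hom-$2$-category $\mathbf{Tricat}_s(\mathfrak{A},\mathfrak{B})(F,G)$ via $3$-pseudofunctors, in the following sense. (0) There is a bijection $p\mapsto p'$ between trinatural transformations $p:F\to G$ and $3$-pseudofunctors $p':\mathfrak{A}\rightsquigarrow[\mathfrak{P}_1,\mathfrak{B}]$ such that $s_0p'=F$ and $t_0p'=G$. (1) For all trinatural transformations $p,q:F\to G$ there is a bijection $\sigma\mapsto\sigma'$ between trimodifications $\sigma:p\Rightarrow q$ and $3$-pseudofunctors $\sigma':\mathfrak{A}\rightsquigarrow[\mathfrak{P}_2,\mathfrak{B}]$ such that $s_1\sigma'=p'$ and $t_1\sigma'=q'$. (2) For all trimodifications $\sigma,\tau:p\Rightarrow q$ there is a bijection between perturbations $\Omega:\sigma\Rrightarrow\tau$ and $3$-pseudofunctors $\Omega':\mathfrak{A}\rightsquigarrow[\mathfrak{P}_3,\mathfrak{B}]$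 such that $s_2\Omega'=\sigma'$ and $t_2\Omega'=\tau'$.
   Context: CONVENTIONS. A $\mathbf{Gray}$-category is a category enriched in $2$-categories with the (pseudo) Gray tensor product $\otimes$. We write $.$ (or juxtaposition) for composition and whiskering along objects, $\circ$ for composition of $2$-cells in hom-$2$-categories, $\cdot$ for vertical composition of $3$-cells; whiskering of a $3$-cell $\Gamma$ with a $2$-cell $\phi$ is written $\Gamma\circ\phi$ or $\phi\circ\Gamma$, and the name of a cell also denotes its identity. For $\alpha:f\Rightarrow f':X\to Y$ and $\beta:g\Rightarrow g':Y\to Z$ the interchanger is the invertible $3$-cell $\beta_\alpha:(g'.\alpha)\circ(\beta.f)\Rrightarrow(\beta.f')\circ(g.\alpha)$. TRINATURAL TRANSFORMATIONS. A trinatural transformation $p:F\to G$ between $\mathbf{Gray}$-functors $F,G:\mathfrak{A}\to\mathfrak{B}$ consists of: $1$-cells $p_X:FX\to GX$; for each $f:X\to Y$ an adjoint equivalence $p_f\dashv p_f^*$ in $\mathfrak{B}(FX,GY)$ with $p_f:p_Y.Ff\Rightarrow Gf.p_X$; for each $\phi:f\Rightarrow g:X\to Y$ an invertible $3$-cell $p_\phi:p_g\circ(p_Y.F\phi)\Rrightarrow(G\phi.p_X)\circ p_f$; unitors: invertible $3$-cells $p^X:1_{p_X}\Rrightarrow p_{1_X}$; compositors: for $X\xrightarrow{f}Y\xrightarrow{g}Z$ invertible $3$-cells $p_{g,f}:(Gg.p_f)\circ(p_g.Ff)\Rrightarrow p_{gf}$. Axioms: local pseudonaturality: $p_{1_f}=1_{p_f}$;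 $p_{\psi\phi}=((G\psi.p_X)\circ p_\phi)\cdot(p_\psi\circ(p_Y.F\phi))$; $((G\Omega.p_X)\circ p_f)\cdot p_\phi=p_{\phi'}\cdot(p_g\circ(p_Y.F\Omega))$ for $\Omega:\phi\Rrightarrow\phi'$; right whiskering law for $\phi:f\Rightarrow f'$: $p_{g\phi}\cdot(p_{g,f'}\circ(p_Z.Fg.F\phi))=((Gg.G\phi.p_X)\circ p_{g,f})\cdot((Gg.p_\phi)\circ(p_g.Ff))\cdot((Gg.p_{f'})\circ(p_g)_{F\phi}^{-1})$; left whiskering law for $\psi:g\Rightarrow g'$: $p_{\psi f}\cdot(p_{g',f}\circ(p_Z.F\psi.Ff))=((G\psi.Gf.p_X)\circ p_{g,f})\cdot((G\psi)_{p_f}\circ(p_g.Ff))\cdot((Gg'.p_f)\circ(p_\psi.Ff))$; associativity: $p_{g,fe}\cdot((Gg.p_{f,e})\circ(p_g.Ff.Fe))=p_{gf,e}\cdot((Gg.Gf.p_e)\circ(p_{g,f}.Fe))$; unit laws: $p_{f,1_X}\cdot((Gf.p^X)\circ p_f)=1_{p_f}=p_{1_Y,f}\cdot(p_f\circ(p^Y.Ff))$. TRIMODIFICATIONS. A trimodification $\sigma:p\Rightarrow q$ consists of $2$-cells $\sigma_X:p_X\Rightarrow q_X$ and invertible $3$-cells $\sigma_f:(Gf.\sigma_X)\circ p_f\Rrightarrow q_f\circ(\sigma_Y.Ff)$ such that: (local modification condition, $\phi:f\Rightarrow g$) $(q_\phi\circ(\sigma_Y.Ff))\cdot(q_g\circ(\sigma_Y)_{F\phi}^{-1})\cdot(\sigma_g\circ(p_Y.F\phi))=((G\phi.q_X)\circ\sigma_f)\cdot((G\phi)_{\sigma_X}\circ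 p_f)\cdot((Gg.\sigma_X)\circ p_\phi)$; (unit law) $\sigma_{1_X}\cdot(\sigma_X\circ p^X)=q^X\circ\sigma_X$; (composition law) $\sigma_{gf}\cdot((Gg.Gf.\sigma_X)\circ p_{g,f})=(q_{g,f}\circ(\sigma_Z.Fg.Ff))\cdot((Gg.q_f)\circ(\sigma_g.Ff))\cdot((Gg.\sigma_f)\circ(p_g.Ff))$. PERTURBATIONS. A perturbation $\Omega:\sigma\Rrightarrow\tau$ consists of $3$-cells $\Omega_X:\sigma_X\Rrightarrow\tau_X$ with $\tau_f\cdot((Gf.\Omega_X)\circ p_f)=(q_f\circ(\Omega_Y.Ff))\cdot\sigma_f$. $\mathbf{Tricat}_s(\mathfrak{A},\mathfrak{B})$ is the $\mathbf{Gray}$-category of $\mathbf{Gray}$-functors, trinatural transformations, trimodifications and perturbations; the $0$-, $1$-, $2$-cells of its hom-$2$-category from $F$ to $G$ are trinatural transformations, trimodifications, perturbations. $3$-PSEUDOFUNCTORS. A $3$-pseudofunctor $H:\mathfrak{A}\rightsquigarrow\mathfrak{C}$ between $\mathbf{Gray}$-categories is a trihomomorphism whose actions $H_{X,Y}$ on homs are $2$-functors, whose unitors $\iota_X:1_{HX}\Rightarrow H1_X$ and compositors $\chi_{g,f}:Hg.Hf\Rightarrow H(gf)$ are invertible $2$-natural transformations ($\chi$ being $2$-natural between $2$-functors $\mathfrak{A}(Y,Z)\otimes\mathfrak{A}(X,Y)\to\mathfrak{C}(HX,HZ)$), and whose modifications $\gamma,\delta,\omega$ are identities, i.e. $\chi_{1_Y,f}\circ(\iota_Y.Hf)=1$,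 $\chi_{f,1_X}\circ(Hf.\iota_X)=1$, $\chi_{hg,f}\circ(\chi_{h,g}.Hf)=\chi_{h,gf}\circ(Hh.\chi_{g,f})$. PATH OBJECTS. $\mathfrak{P}_m$ is the free-living $m$-cell. $[\mathfrak{P}_m,\mathfrak{B}]$ is the $\mathbf{Gray}$-category whose objects are $\mathbf{Gray}$-functors $\mathfrak{P}_m\to\mathfrak{B}$, morphisms are semi-strict trinatural transformations (those with identity unitors and compositors), $2$-cells are trimodifications, $3$-cells are perturbations, with structure as in $\mathbf{Tricat}_s(\mathfrak{P}_m,\mathfrak{B})$ and with the adjoint equivalences oriented as in the following explicit description. Explicitly: $[\mathfrak{P}_1,\mathfrak{B}]$: objects $(x,X_0,X_1)$ are $1$-cells $x:X_0\to X_1$; morphisms $(f\dashv f^*,f_0,f_1):(x,X_0,X_1)\to(y,Y_0,Y_1)$ consist of $f_i:X_i\to Y_i$ and an adjoint equivalence $f\dashv f^*$ with $f:y.f_0\Rightarrow f_1.x$; $2$-cells $(\phi,\phi_0,\phi_1)$ to $(g\dashv g^*,g_0,g_1)$ consist of $\phi_i:f_i\Rightarrow g_i$ and an invertible $3$-cell $\phi:g\circ(y.\phi_0)\Rrightarrow(\phi_1.x)\circ f$; $3$-cells $(\Gamma_0,\Gamma_1)$ to $(\psi,\psi_0,\psi_1)$ consist of $\Gamma_i:\phi_i\Rrightarrow\psi_i$ with $\psi\cdot(g\circ(y.\Gamma_0))=((\Gamma_1.x)\circ f)\cdot\phi$. The composite of $f$ with $f':(y,Y_0,Y_1)\to(z,Z_0,Z_1)$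 has left adjoint $(f_1'.f)\circ(f'.f_0)$ and the composite adjoint equivalence; other operations are given by pasting in $\mathfrak{B}$ (using interchangers of $\mathfrak{B}$ where needed) and componentwise. $s_0,t_0$ take the components with index $0$, $1$ respectively. $[\mathfrak{P}_2,\mathfrak{B}]$: objects are $2$-cells $\mathbf{X}:x_0\Rightarrow x_1:X_0\to X_1$; morphisms $\mathbf{X}\to\mathbf{Y}$ consist of $f_i:X_i\to Y_i$, adjoint equivalences $\bar f_i\dashv\bar f_i^*$ with $\bar f_i:y_i.f_0\Rightarrow f_1.x_i$ ($i=0,1$), and an invertible $3$-cell $\mathbf{f}:\bar f_1\circ(\mathbf{Y}.f_0)\Rrightarrow(f_1.\mathbf{X})\circ\bar f_0$; $2$-cells consist of $\phi_i:f_i\Rightarrow g_i$ and invertible $3$-cells $\Phi_i:\bar g_i\circ(y_i.\phi_0)\Rrightarrow(\phi_1.x_i)\circ\bar f_i$ with $((\phi_1)_{\mathbf{X}}\circ\bar f_0)\cdot((g_1.\mathbf{X})\circ\Phi_0)\cdot(\mathbf{g}\circ(y_0.\phi_0))=((\phi_1.x_1)\circ\mathbf{f})\cdot(\Phi_1\circ(\mathbf{Y}.f_0))\cdot(\bar g_1\circ\mathbf{Y}_{\phi_0}^{-1})$; $3$-cells are pairs $(\Gamma_0,\Gamma_1)$, $\Gamma_i:\phi_i\Rrightarrow\psi_i$, with $\Psi_i\cdot(\bar g_i\circ(y_i.\Gamma_0))=((\Gamma_1.x_i)\circ\bar f_i)\cdot\Phi_i$ for $i=0,1$. $s_1$ and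 $t_1$ send $\mathbf{X}$ to $x_0$, resp. $x_1$, a morphism to $(\bar f_i\dashv\bar f_i^*,f_0,f_1)$, a $2$-cell to $(\Phi_i,\phi_0,\phi_1)$, with $i=0$, resp. $i=1$, and are the identity on the data of $3$-cells. $[\mathfrak{P}_3,\mathfrak{B}]$: objects are $3$-cells $\mathfrak{x}:\mathbf{X}_0\Rrightarrow\mathbf{X}_1:x_0\Rightarrow x_1$, where $x_0,x_1:X_0\to X_1$; morphisms from $\mathfrak{x}$ to $\mathfrak{y}:\mathbf{Y}_0\Rrightarrow\mathbf{Y}_1:y_0\Rightarrow y_1$, where $y_0,y_1:Y_0\to Y_1$, consist of $1$-cells $f_i:X_i\to Y_i$ and adjoint equivalences $\bar f_i\dashv\bar f_i^*$ with $\bar f_i:y_i.f_0\Rightarrow f_1.x_i$ ($i=0,1$) and, for $j=0,1$, an invertible $3$-cell $\mathbf{f}_j:\bar f_1\circ(\mathbf{Y}_j.f_0)\Rrightarrow(f_1.\mathbf{X}_j)\circ\bar f_0$ making these data a morphism $\mathbf{X}_j\to\mathbf{Y}_j$ of $[\mathfrak{P}_2,\mathfrak{B}]$, with $\mathbf{f}_1\cdot(\bar f_1\circ(\mathfrak{y}.f_0))=((f_1.\mathfrak{x})\circ\bar f_0)\cdot\mathbf{f}_0$; $2$-cells are data $(\Phi_0,\Phi_1,\phi_0,\phi_1)$ that form a $2$-cell of $[\mathfrak{P}_2,\mathfrak{B}]$ for both $j=0$ and $j=1$; $3$-cells are pairs $(\Gamma_0,\Gamma_1)$ as for $[\mathfrak{P}_2,\mathfrak{B}]$.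 $s_2,t_2$ select $j=0$, $j=1$. *)

theory Defs
  imports Main "HOL-Library.FuncSet"
begin

section \<open>Strict 2-categories\<close>

text \<open>
  The 2-categories of interest are homs of Gray-categories. Their objects, arrows and 2-cells are
  therefore numbered as 1-, 2- and 3-cells. Operations are total functions, which are only
  meaningful on composable cells of the carriers.
\<close>

record ('f, 'a, 'g) two_cat =
  C1 :: "'f set"
  C2 :: "'a set"
  C3 :: "'g set"
  dom2 :: "'a \<Rightarrow> 'f"
  cod2 :: "'a \<Rightarrow> 'f"
  dom3 :: "'g \<Rightarrow> 'a"
  cod3 :: "'g \<Rightarrow> 'a"
  one2 :: "'f \<Rightarrow> 'a"
  one3 :: "'a \<Rightarrow> 'g"
  cmp2 :: "'a \<Rightarrow> 'a \<Rightarrow> 'a"  (infixr "\<odot>\<index>" 70)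
  hcmp3 :: "'g \<Rightarrow> 'g \<Rightarrow> 'g"  (infixr "\<star>\<index>" 70)
  vcmp3 :: "'g \<Rightarrow> 'g \<Rightarrow> 'g"  (infixr "\<cdot>\<index>" 65)

text \<open>Whiskering is horizontal composition with the identity of an arrow.\<close>

abbreviation lwhisk :: "('f, 'a, 'g, 'm) two_cat_scheme \<Rightarrow> 'a \<Rightarrow> 'g \<Rightarrow> 'g"  (infixr "\<odot>\<rhd>\<index>" 70)
  where "lwhisk C u \<Gamma> \<equiv> hcmp3 C (one3 C u) \<Gamma>"

abbreviation rwhisk :: "('f, 'a, 'g, 'm) two_cat_scheme \<Rightarrow> 'g \<Rightarrow> 'a \<Rightarrow> 'g"  (infixr "\<lhd>\<odot>\<index>" 70)
  where "rwhisk C \<Gamma> u \<equiv> hcmp3 C \<Gamma> (one3 C u)"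

definition is2 :: "('f, 'a, 'g, 'm) two_cat_scheme \<Rightarrow> 'a \<Rightarrow> 'f \<Rightarrow> 'f \<Rightarrow> bool" where
  "is2 C u f g \<longleftrightarrow> u \<in> C2 C \<and> dom2 C u = f \<and> cod2 C u = g"

definition is3 :: "('f, 'a, 'g, 'm) two_cat_scheme \<Rightarrow> 'g \<Rightarrow> 'a \<Rightarrow> 'a \<Rightarrow> bool" where
  "is3 C \<Gamma> u v \<longleftrightarrow> \<Gamma> \<in> C3 C \<and> dom3 C \<Gamma> = u \<and> cod3 C \<Gamma> = v"

locale two_category =
  fixes C :: "('f, 'a, 'g, 'm) two_cat_scheme" (structure)
  assumes arrow: "u \<in> C2 C \<Longrightarrow> dom2 C u \<in> C1 C \<and> cod2 C u \<in> C1 C"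
    and cell: "\<Gamma> \<in> C3 C \<Longrightarrow> dom3 C \<Gamma> \<in> C2 C \<and> cod3 C \<Gamma> \<in> C2 C"
    and globular: "\<Gamma> \<in> C3 C \<Longrightarrow>
      dom2 C (dom3 C \<Gamma>) = dom2 C (cod3 C \<Gamma>) \<and> cod2 C (dom3 C \<Gamma>) = cod2 C (cod3 C \<Gamma>)"
    and one2: "f \<in> C1 C \<Longrightarrow> is2 C (one2 C f) f f"
    and one3: "u \<in> C2 C \<Longrightarrow> is3 C (one3 C u) u u"
    and cmp2: "is2 C u f g \<Longrightarrow> is2 C v g h \<Longrightarrow> is2 C (v \<odot> u) f h"
    and vcmp3: "is3 C \<Gamma> u v \<Longrightarrow> is3 C \<Delta> v w \<Longrightarrow> is3 C (\<Delta> \<cdot> \<Gamma>) u w"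
    and hcmp3: "is3 C \<Gamma> u u' \<Longrightarrow> is3 C \<Delta> v v' \<Longrightarrow> cod2 C u = dom2 C v \<Longrightarrow>
      is3 C (\<Delta> \<star> \<Gamma>) (v \<odot> u) (v' \<odot> u')"
    and cmp2_assoc: "is2 C u e f \<Longrightarrow> is2 C v f g \<Longrightarrow> is2 C w g h \<Longrightarrow>
      (w \<odot> v) \<odot> u = w \<odot> (v \<odot> u)"
    and cmp2_one: "is2 C u f g \<Longrightarrow> u \<odot> one2 C f = u \<and> one2 C g \<odot> u = u"
    and vcmp3_assoc: "is3 C \<Gamma> t u \<Longrightarrow> is3 C \<Delta> u v \<Longrightarrow> is3 C \<Theta> v w \<Longrightarrow>
      (\<Theta> \<cdot> \<Delta>) \<cdot> \<Gamma> = \<Theta> \<cdot> (\<Delta> \<cdot> \<Gamma>)"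
    and vcmp3_one: "is3 C \<Gamma> u v \<Longrightarrow> \<Gamma> \<cdot> one3 C u = \<Gamma> \<and> one3 C v \<cdot> \<Gamma> = \<Gamma>"
    and hcmp3_assoc: "is3 C \<Gamma> u u' \<Longrightarrow> is3 C \<Delta> v v' \<Longrightarrow> is3 C \<Theta> w w' \<Longrightarrow>
      cod2 C u = dom2 C v \<Longrightarrow> cod2 C v = dom2 C w \<Longrightarrow>
      (\<Theta> \<star> \<Delta>) \<star> \<Gamma> = \<Theta> \<star> (\<Delta> \<star> \<Gamma>)"
    and hcmp3_one: "is3 C \<Gamma> u u' \<Longrightarrow> is2 C u f g \<Longrightarrow>
      \<Gamma> \<star> one3 C (one2 C f) = \<Gamma> \<and> one3 C (one2 C g) \<star> \<Gamma> = \<Gamma>"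
    and hcmp3_one3: "is2 C u f g \<Longrightarrow> is2 C v g h \<Longrightarrow> one3 C v \<star> one3 C u = one3 C (v \<odot> u)"
    and interchange: "is3 C \<Gamma> u u' \<Longrightarrow> is3 C \<Gamma>' u' u'' \<Longrightarrow> is3 C \<Delta> v v' \<Longrightarrow> is3 C \<Delta>' v' v'' \<Longrightarrow>
      cod2 C u = dom2 C v \<Longrightarrow>
      (\<Delta>' \<cdot> \<Delta>) \<star> (\<Gamma>' \<cdot> \<Gamma>) = (\<Delta>' \<star> \<Gamma>') \<cdot> (\<Delta> \<star> \<Gamma>)"

definition inverse3 :: "('f, 'a, 'g, 'm) two_cat_scheme \<Rightarrow> 'g \<Rightarrow> 'g \<Rightarrow> bool" where
  "inverse3 C \<Gamma> \<Delta> \<longleftrightarrow> \<Gamma> \<in> C3 C \<and> is3 C \<Delta> (cod3 C \<Gamma>) (dom3 C \<Gamma>) \<and>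
    vcmp3 C \<Delta> \<Gamma> = one3 C (dom3 C \<Gamma>) \<and> vcmp3 C \<Gamma> \<Delta> = one3 C (cod3 C \<Gamma>)"

definition inv3 :: "('f, 'a, 'g, 'm) two_cat_scheme \<Rightarrow> 'g \<Rightarrow> 'g" where
  "inv3 C \<Gamma> = (THE \<Delta>. inverse3 C \<Gamma> \<Delta>)"

definition iso3 :: "('f, 'a, 'g, 'm) two_cat_scheme \<Rightarrow> 'g \<Rightarrow> 'a \<Rightarrow> 'a \<Rightarrow> bool" where
  "iso3 C \<Gamma> u v \<longleftrightarrow> is3 C \<Gamma> u v \<and> (\<exists>\<Delta>. inverse3 C \<Gamma> \<Delta>)"

text \<open>Arrows which are invertible on the nose, not just equivalences.\<close>

definition iso2 :: "('f, 'a, 'g, 'm) two_cat_scheme \<Rightarrow> 'a \<Rightarrow> 'f \<Rightarrow> 'f \<Rightarrow> bool" where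
  "iso2 C u f g \<longleftrightarrow> is2 C u f g \<and>
    (\<exists>v. is2 C v g f \<and> cmp2 C v u = one2 C f \<and> cmp2 C u v = one2 C g)"

locale two_functor =
  fixes C :: "('f, 'a, 'g, 'm) two_cat_scheme"
    and D :: "('h, 'b, 'k, 'n) two_cat_scheme" (structure)
    and F1 :: "'f \<Rightarrow> 'h" and F2 :: "'a \<Rightarrow> 'b" and F3 :: "'g \<Rightarrow> 'k"
  assumes act1: "f \<in> C1 C \<Longrightarrow> F1 f \<in> C1 D"
    and act2: "is2 C u f g \<Longrightarrow> is2 D (F2 u) (F1 f) (F1 g)"
    and act3: "is3 C \<Gamma> u v \<Longrightarrow> is3 D (F3 \<Gamma>) (F2 u) (F2 v)"
    and map_one2: "f \<in> C1 C \<Longrightarrow> F2 (one2 C f) = one2 D (F1 f)"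
    and map_one3: "u \<in> C2 C \<Longrightarrow> F3 (one3 C u) = one3 D (F2 u)"
    and map_cmp2: "is2 C u f g \<Longrightarrow> is2 C v g h \<Longrightarrow> F2 (v \<odot>\<^bsub>C\<^esub> u) = F2 v \<odot> F2 u"
    and map_vcmp3: "is3 C \<Gamma> u v \<Longrightarrow> is3 C \<Delta> v w \<Longrightarrow> F3 (\<Delta> \<cdot>\<^bsub>C\<^esub> \<Gamma>) = F3 \<Delta> \<cdot> F3 \<Gamma>"
    and map_hcmp3: "is3 C \<Gamma> u u' \<Longrightarrow> is3 C \<Delta> v v' \<Longrightarrow> cod2 C u = dom2 C v \<Longrightarrow>
      F3 (\<Delta> \<star>\<^bsub>C\<^esub> \<Gamma>) = F3 \<Delta> \<star> F3 \<Gamma>"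


section \<open>2-functors out of a Gray tensor product\<close>

text \<open>
  The Gray tensor product of 2-categories \<open>C\<close> and \<open>D\<close> is presented by generators and relations:
  its objects are pairs, its arrows are generated by pairs of an arrow and an object (in either
  order), and its 2-cells are generated by pairs of a 2-cell and an object (in either order) and by
  invertible interchangers, one for each pair of arrows. A 2-functor from it to \<open>E\<close> is thus given by
  the following data on generators, subject to the defining relations.
\<close>

record ('c1, 'c2, 'c3, 'd1, 'd2, 'd3, 'e1, 'e2, 'e3) gray_bifun =
  bf1 :: "'c1 \<Rightarrow> 'd1 \<Rightarrow> 'e1"
  bf2l :: "'c2 \<Rightarrow> 'd1 \<Rightarrow> 'e2"
  bf2r :: "'c1 \<Rightarrow> 'd2 \<Rightarrow> 'e2"
  bf3l :: "'c3 \<Rightarrow> 'd1 \<Rightarrow> 'e3"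
  bf3r :: "'c1 \<Rightarrow> 'd3 \<Rightarrow> 'e3"
  bfich :: "'c2 \<Rightarrow> 'd2 \<Rightarrow> 'e3"

locale gray_bifunctor =
  fixes C :: "('c1, 'c2, 'c3, 'l) two_cat_scheme"
    and D :: "('d1, 'd2, 'd3, 'm) two_cat_scheme"
    and E :: "('e1, 'e2, 'e3, 'n) two_cat_scheme" (structure)
    and T :: "('c1, 'c2, 'c3, 'd1, 'd2, 'd3, 'e1, 'e2, 'e3) gray_bifun"
  assumes left: "d \<in> C1 D \<Longrightarrow>
      two_functor C E (\<lambda>c. bf1 T c d) (\<lambda>u. bf2l T u d) (\<lambda>\<Gamma>. bf3l T \<Gamma> d)"
    and right: "c \<in> C1 C \<Longrightarrow> two_functor D E (bf1 T c) (bf2r T c) (bf3r T c)"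
    and ich: "is2 C u c c' \<Longrightarrow> is2 D v d d' \<Longrightarrow>
      iso3 E (bfich T u v) (bf2r T c' v \<odot> bf2l T u d) (bf2l T u d' \<odot> bf2r T c v)"
    and ich_one_left: "c \<in> C1 C \<Longrightarrow> v \<in> C2 D \<Longrightarrow> bfich T (one2 C c) v = one3 E (bf2r T c v)"
    and ich_one_right: "u \<in> C2 C \<Longrightarrow> d \<in> C1 D \<Longrightarrow> bfich T u (one2 D d) = one3 E (bf2l T u d)"
    and ich_cmp_left: "is2 C u c c' \<Longrightarrow> is2 C u' c' c'' \<Longrightarrow> is2 D v d d' \<Longrightarrow>
      bfich T (u' \<odot>\<^bsub>C\<^esub> u) v
        = (bf2l T u' d' \<odot>\<rhd> bfich T u v) \<cdot> (bfich T u' v \<lhd>\<odot> bf2l T u d)"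
    and ich_cmp_right: "is2 C u c c' \<Longrightarrow> is2 D v d d' \<Longrightarrow> is2 D v' d' d'' \<Longrightarrow>
      bfich T u (v' \<odot>\<^bsub>D\<^esub> v)
        = (bfich T u v' \<lhd>\<odot> bf2r T c v) \<cdot> (bf2r T c' v' \<odot>\<rhd> bfich T u v)"
    and ich_nat_left: "is3 C \<Gamma> u u' \<Longrightarrow> is2 C u c c' \<Longrightarrow> is2 D v d d' \<Longrightarrow>
      bfich T u' v \<cdot> (bf2r T c' v \<odot>\<rhd> bf3l T \<Gamma> d) = (bf3l T \<Gamma> d' \<lhd>\<odot> bf2r T c v) \<cdot> bfich T u v"
    and ich_nat_right: "is2 C u c c' \<Longrightarrow> is3 D \<Delta> v v' \<Longrightarrow> is2 D v d d' \<Longrightarrow>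
      bfich T u v' \<cdot> (bf3r T c' \<Delta> \<lhd>\<odot> bf2l T u d) = (bf2l T u d' \<odot>\<rhd> bf3r T c \<Delta>) \<cdot> bfich T u v"

text \<open>
  A 2-natural transformation between 2-functors on the Gray tensor product. It suffices to require
  naturality on generators, including the interchangers.
\<close>

locale gray_bifun_two_natural =
  fixes C :: "('c1, 'c2, 'c3, 'l) two_cat_scheme"
    and D :: "('d1, 'd2, 'd3, 'm) two_cat_scheme"
    and E :: "('e1, 'e2, 'e3, 'n) two_cat_scheme" (structure)
    and S :: "('c1, 'c2, 'c3, 'd1, 'd2, 'd3, 'e1, 'e2, 'e3) gray_bifun"
    and T :: "('c1, 'c2, 'c3, 'd1, 'd2, 'd3, 'e1, 'e2, 'e3) gray_bifun"
    and \<tau> :: "'c1 \<Rightarrow> 'd1 \<Rightarrow> 'e2"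
  assumes component: "c \<in> C1 C \<Longrightarrow> d \<in> C1 D \<Longrightarrow> is2 E (\<tau> c d) (bf1 S c d) (bf1 T c d)"
    and nat2l: "is2 C u c c' \<Longrightarrow> d \<in> C1 D \<Longrightarrow> bf2l T u d \<odot> \<tau> c d = \<tau> c' d \<odot> bf2l S u d"
    and nat2r: "c \<in> C1 C \<Longrightarrow> is2 D v d d' \<Longrightarrow> bf2r T c v \<odot> \<tau> c d = \<tau> c d' \<odot> bf2r S c v"
    and nat3l: "is3 C \<Gamma> u u' \<Longrightarrow> is2 C u c c' \<Longrightarrow> d \<in> C1 D \<Longrightarrow>
      bf3l T \<Gamma> d \<lhd>\<odot> \<tau> c d = \<tau> c' d \<odot>\<rhd> bf3l S \<Gamma> d"
    and nat3r: "c \<in> C1 C \<Longrightarrow> is3 D \<Delta> v v' \<Longrightarrow> is2 D v d d' \<Longrightarrow>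
      bf3r T c \<Delta> \<lhd>\<odot> \<tau> c d = \<tau> c d' \<odot>\<rhd> bf3r S c \<Delta>"
    and nat_ich: "is2 C u c c' \<Longrightarrow> is2 D v d d' \<Longrightarrow>
      bfich T u v \<lhd>\<odot> \<tau> c d = \<tau> c' d' \<odot>\<rhd> bfich S u v"


section \<open>Gray-categories and Gray-functors\<close>

text \<open>
  The 2-category part of the following record is the disjoint union of all hom-2-categories. The
  interchanger \<open>ich \<beta> \<alpha>\<close> is the 3-cell \<open>\<beta>\<^sub>\<alpha>\<close> from \<open>(g' \<rhd> \<alpha>) \<odot> (\<beta> \<lhd> f)\<close> to \<open>(\<beta> \<lhd> f') \<odot> (g \<rhd> \<alpha>)\<close>, for
  \<open>\<alpha>\<close> from \<open>f\<close> to \<open>f'\<close> and \<open>\<beta>\<close> from \<open>g\<close> to \<open>g'\<close>.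
\<close>

record ('o, 'f, 'a, 'g) gray = "('f, 'a, 'g) two_cat" +
  C0 :: "'o set"
  dom1 :: "'f \<Rightarrow> 'o"
  cod1 :: "'f \<Rightarrow> 'o"
  one1 :: "'o \<Rightarrow> 'f"
  cmp1 :: "'f \<Rightarrow> 'f \<Rightarrow> 'f"  (infixr "\<bullet>\<index>" 80)
  lwh2 :: "'f \<Rightarrow> 'a \<Rightarrow> 'a"  (infixr "\<rhd>\<index>" 80)
  rwh2 :: "'a \<Rightarrow> 'f \<Rightarrow> 'a"  (infixr "\<lhd>\<index>" 80)
  lwh3 :: "'f \<Rightarrow> 'g \<Rightarrow> 'g"  (infixr "\<unrhd>\<index>" 80)
  rwh3 :: "'g \<Rightarrow> 'f \<Rightarrow> 'g"  (infixr "\<unlhd>\<index>" 80)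
  ich :: "'a \<Rightarrow> 'a \<Rightarrow> 'g"

definition is1 :: "('o, 'f, 'a, 'g) gray \<Rightarrow> 'f \<Rightarrow> 'o \<Rightarrow> 'o \<Rightarrow> bool" where
  "is1 A f X Y \<longleftrightarrow> f \<in> C1 A \<and> dom1 A f = X \<and> cod1 A f = Y"

definition composable :: "('o, 'f, 'a, 'g) gray \<Rightarrow> 'f \<Rightarrow> 'f \<Rightarrow> bool" where
  "composable A g f \<longleftrightarrow> g \<in> C1 A \<and> f \<in> C1 A \<and> cod1 A f = dom1 A g"

definition hom :: "('o, 'f, 'a, 'g) gray \<Rightarrow> 'o \<Rightarrow> 'o \<Rightarrow> ('f, 'a, 'g) two_cat" where
  "hom A X Y = \<lparr>
    C1 = {f \<in> C1 A. is1 A f X Y},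
    C2 = {u \<in> C2 A. is1 A (dom2 A u) X Y \<and> is1 A (cod2 A u) X Y},
    C3 = {\<Gamma> \<in> C3 A. is1 A (dom2 A (dom3 A \<Gamma>)) X Y \<and> is1 A (cod2 A (dom3 A \<Gamma>)) X Y},
    dom2 = dom2 A, cod2 = cod2 A, dom3 = dom3 A, cod3 = cod3 A,
    one2 = one2 A, one3 = one3 A, cmp2 = cmp2 A, hcmp3 = hcmp3 A, vcmp3 = vcmp3 A\<rparr>"

definition cmp_bifun ::
    "('o, 'f, 'a, 'g) gray \<Rightarrow> ('f, 'a, 'g, 'f, 'a, 'g, 'f, 'a, 'g) gray_bifun" where
  "cmp_bifun A = \<lparr>bf1 = cmp1 A, bf2l = rwh2 A, bf2r = lwh2 A, bf3l = rwh3 A, bf3r = lwh3 A,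
    bfich = ich A\<rparr>"

text \<open>
  The associativity axioms are the instances on generators of the threefold Gray tensor product of
  the associativity of composition.
\<close>

locale gray_category =
  fixes A :: "('o, 'f, 'a, 'g) gray" (structure)
  assumes boundary1: "f \<in> C1 A \<Longrightarrow> dom1 A f \<in> C0 A \<and> cod1 A f \<in> C0 A"
    and boundary2: "u \<in> C2 A \<Longrightarrow> dom2 A u \<in> C1 A \<and> cod2 A u \<in> C1 A \<and>
      dom1 A (dom2 A u) = dom1 A (cod2 A u) \<and> cod1 A (dom2 A u) = cod1 A (cod2 A u)"
    and boundary3: "\<Gamma> \<in> C3 A \<Longrightarrow> dom3 A \<Gamma> \<in> C2 A \<and> cod3 A \<Gamma> \<in> C2 A"
    and hom_two_category: "X \<in> C0 A \<Longrightarrow> Y \<in> C0 A \<Longrightarrow> two_category (hom A X Y)"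
    and composition: "X \<in> C0 A \<Longrightarrow> Y \<in> C0 A \<Longrightarrow> Z \<in> C0 A \<Longrightarrow>
      gray_bifunctor (hom A Y Z) (hom A X Y) (hom A X Z) (cmp_bifun A)"
    and unit: "X \<in> C0 A \<Longrightarrow> is1 A (one1 A X) X X"
    and unit1: "is1 A f X Y \<Longrightarrow> f \<bullet> one1 A X = f \<and> one1 A Y \<bullet> f = f"
    and unit2: "is2 A u f f' \<Longrightarrow> is1 A f X Y \<Longrightarrow> u \<lhd> one1 A X = u \<and> one1 A Y \<rhd> u = u"
    and unit3: "is3 A \<Gamma> u u' \<Longrightarrow> is2 A u f f' \<Longrightarrow> is1 A f X Y \<Longrightarrow>
      \<Gamma> \<unlhd> one1 A X = \<Gamma> \<and> one1 A Y \<unrhd> \<Gamma> = \<Gamma>"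
    and assoc1: "is1 A f W X \<Longrightarrow> is1 A g X Y \<Longrightarrow> is1 A h Y Z \<Longrightarrow> (h \<bullet> g) \<bullet> f = h \<bullet> (g \<bullet> f)"
    and assoc2r: "is2 A u f f' \<Longrightarrow> is1 A f W X \<Longrightarrow> is1 A g X Y \<Longrightarrow> is1 A h Y Z \<Longrightarrow>
      (h \<bullet> g) \<rhd> u = h \<rhd> (g \<rhd> u)"
    and assoc2m: "is1 A f W X \<Longrightarrow> is2 A u g g' \<Longrightarrow> is1 A g X Y \<Longrightarrow> is1 A h Y Z \<Longrightarrow>
      (h \<rhd> u) \<lhd> f = h \<rhd> (u \<lhd> f)"
    and assoc2l: "is1 A f W X \<Longrightarrow> is1 A g X Y \<Longrightarrow> is2 A u h h' \<Longrightarrow> is1 A h Y Z \<Longrightarrow>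
      (u \<lhd> g) \<lhd> f = u \<lhd> (g \<bullet> f)"
    and assoc3r: "is3 A \<Gamma> u u' \<Longrightarrow> is2 A u f f' \<Longrightarrow> is1 A f W X \<Longrightarrow> is1 A g X Y \<Longrightarrow> is1 A h Y Z \<Longrightarrow>
      (h \<bullet> g) \<unrhd> \<Gamma> = h \<unrhd> (g \<unrhd> \<Gamma>)"
    and assoc3m: "is1 A f W X \<Longrightarrow> is3 A \<Gamma> u u' \<Longrightarrow> is2 A u g g' \<Longrightarrow> is1 A g X Y \<Longrightarrow> is1 A h Y Z \<Longrightarrow>
      (h \<unrhd> \<Gamma>) \<unlhd> f = h \<unrhd> (\<Gamma> \<unlhd> f)"
    and assoc3l: "is1 A f W X \<Longrightarrow> is1 A g X Y \<Longrightarrow> is3 A \<Gamma> u u' \<Longrightarrow> is2 A u h h' \<Longrightarrow> is1 A h Y Z \<Longrightarrow>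
      (\<Gamma> \<unlhd> g) \<unlhd> f = \<Gamma> \<unlhd> (g \<bullet> f)"
    and assoc_ich_r: "is2 A u f f' \<Longrightarrow> is1 A f W X \<Longrightarrow> is2 A v g g' \<Longrightarrow> is1 A g X Y \<Longrightarrow>
      is1 A h Y Z \<Longrightarrow> ich A (h \<rhd> v) u = h \<unrhd> ich A v u"
    and assoc_ich_m: "is2 A u f f' \<Longrightarrow> is1 A f W X \<Longrightarrow> is1 A g X Y \<Longrightarrow> is2 A w h h' \<Longrightarrow>
      is1 A h Y Z \<Longrightarrow> ich A (w \<lhd> g) u = ich A w (g \<rhd> u)"
    and assoc_ich_l: "is1 A f W X \<Longrightarrow> is2 A v g g' \<Longrightarrow> is1 A g X Y \<Longrightarrow> is2 A w h h' \<Longrightarrow>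
      is1 A h Y Z \<Longrightarrow> ich A w v \<unlhd> f = ich A w (v \<lhd> f)"

record ('o, 'f, 'a, 'g, 'p, 'h, 'b, 'k) gmap =
  act0 :: "'o \<Rightarrow> 'p"
  act1 :: "'f \<Rightarrow> 'h"
  act2 :: "'a \<Rightarrow> 'b"
  act3 :: "'g \<Rightarrow> 'k"

text \<open>
  Assignments on cells are required to be \<^const>\<open>extensional\<close>, i.e. \<^const>\<open>undefined\<close> off the
  carriers, so that equality of such data in the logic is equality on all cells.
\<close>

definition gmap_extensional ::
    "('o, 'f, 'a, 'g) gray \<Rightarrow> ('o, 'f, 'a, 'g, 'p, 'h, 'b, 'k, 'z) gmap_scheme \<Rightarrow> bool" where
  "gmap_extensional A F \<longleftrightarrow> act0 F \<in> extensional (C0 A) \<and> act1 F \<in> extensional (C1 A) \<and>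
    act2 F \<in> extensional (C2 A) \<and> act3 F \<in> extensional (C3 A)"

locale gray_functor =
  fixes A :: "('o, 'f, 'a, 'g) gray"
    and B :: "('p, 'h, 'b, 'k) gray" (structure)
    and F :: "('o, 'f, 'a, 'g, 'p, 'h, 'b, 'k) gmap"
  assumes ext: "gmap_extensional A F"
    and on_objects: "X \<in> C0 A \<Longrightarrow> act0 F X \<in> C0 B"
    and on_homs: "X \<in> C0 A \<Longrightarrow> Y \<in> C0 A \<Longrightarrow>
      two_functor (hom A X Y) (hom B (act0 F X) (act0 F Y)) (act1 F) (act2 F) (act3 F)"
    and pres_one1: "X \<in> C0 A \<Longrightarrow> act1 F (one1 A X) = one1 B (act0 F X)"
    and pres_cmp1: "is1 A f X Y \<Longrightarrow> is1 A g Y Z \<Longrightarrow>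
      act1 F (g \<bullet>\<^bsub>A\<^esub> f) = act1 F g \<bullet> act1 F f"
    and pres_lwh2: "is2 A u f f' \<Longrightarrow> is1 A f X Y \<Longrightarrow> is1 A g Y Z \<Longrightarrow>
      act2 F (g \<rhd>\<^bsub>A\<^esub> u) = act1 F g \<rhd> act2 F u"
    and pres_rwh2: "is1 A f X Y \<Longrightarrow> is2 A v g g' \<Longrightarrow> is1 A g Y Z \<Longrightarrow>
      act2 F (v \<lhd>\<^bsub>A\<^esub> f) = act2 F v \<lhd> act1 F f"
    and pres_lwh3: "is3 A \<Gamma> u u' \<Longrightarrow> is2 A u f f' \<Longrightarrow> is1 A f X Y \<Longrightarrow> is1 A g Y Z \<Longrightarrow>
      act3 F (g \<unrhd>\<^bsub>A\<^esub> \<Gamma>) = act1 F g \<unrhd> act3 F \<Gamma>"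
    and pres_rwh3: "is1 A f X Y \<Longrightarrow> is3 A \<Gamma> v v' \<Longrightarrow> is2 A v g g' \<Longrightarrow> is1 A g Y Z \<Longrightarrow>
      act3 F (\<Gamma> \<unlhd>\<^bsub>A\<^esub> f) = act3 F \<Gamma> \<unlhd> act1 F f"
    and pres_ich: "is2 A u f f' \<Longrightarrow> is1 A f X Y \<Longrightarrow> is2 A v g g' \<Longrightarrow> is1 A g Y Z \<Longrightarrow>
      act3 F (ich A v u) = ich B (act2 F v) (act2 F u)"


section \<open>Adjoint equivalences in a 2-category\<close>

datatype ('a, 'g) adj = Adj (lft: 'a) (rgt: 'a) (unt: 'g) (cnt: 'g)

text \<open>\<open>adj_equiv C e f g\<close>: the left adjoint of \<open>e\<close> is an arrow from \<open>f\<close> to \<open>g\<close>.\<close>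

definition adj_equiv ::
    "('f, 'a, 'g, 'm) two_cat_scheme \<Rightarrow> ('a, 'g) adj \<Rightarrow> 'f \<Rightarrow> 'f \<Rightarrow> bool" where
  "adj_equiv C e f g \<longleftrightarrow>
    is2 C (lft e) f g \<and> is2 C (rgt e) g f \<and>
    iso3 C (unt e) (one2 C f) (cmp2 C (rgt e) (lft e)) \<and>
    iso3 C (cnt e) (cmp2 C (lft e) (rgt e)) (one2 C g) \<and>
    vcmp3 C (rwhisk C (cnt e) (lft e)) (lwhisk C (lft e) (unt e)) = one3 C (lft e) \<and>
    vcmp3 C (lwhisk C (rgt e) (cnt e)) (rwhisk C (unt e) (rgt e)) = one3 C (rgt e)"

definition one_adj :: "('f, 'a, 'g, 'm) two_cat_scheme \<Rightarrow> 'f \<Rightarrow> ('a, 'g) adj" where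
  "one_adj C f = Adj (one2 C f) (one2 C f) (one3 C (one2 C f)) (one3 C (one2 C f))"

definition cmp_adj ::
    "('f, 'a, 'g, 'm) two_cat_scheme \<Rightarrow> ('a, 'g) adj \<Rightarrow> ('a, 'g) adj \<Rightarrow> ('a, 'g) adj" where
  "cmp_adj C e' e = Adj (cmp2 C (lft e') (lft e)) (cmp2 C (rgt e) (rgt e'))
    (vcmp3 C (lwhisk C (rgt e) (rwhisk C (unt e') (lft e))) (unt e))
    (vcmp3 C (cnt e') (lwhisk C (lft e') (rwhisk C (cnt e) (rgt e'))))"

definition lwh_adj :: "('o, 'f, 'a, 'g) gray \<Rightarrow> 'f \<Rightarrow> ('a, 'g) adj \<Rightarrow> ('a, 'g) adj" where
  "lwh_adj B h e = Adj (lwh2 B h (lft e)) (lwh2 B h (rgt e)) (lwh3 B h (unt e)) (lwh3 B h (cnt e))"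

definition rwh_adj :: "('o, 'f, 'a, 'g) gray \<Rightarrow> ('a, 'g) adj \<Rightarrow> 'f \<Rightarrow> ('a, 'g) adj" where
  "rwh_adj B e h = Adj (rwh2 B (lft e) h) (rwh2 B (rgt e) h) (rwh3 B (unt e) h) (rwh3 B (cnt e) h)"


section \<open>Trinatural transformations, trimodifications, perturbations\<close>

record ('o, 'f, 'a, 'h, 'b, 'k) trinat =
  tr0 :: "'o \<Rightarrow> 'h"
  tradj :: "'f \<Rightarrow> ('b, 'k) adj"
  tr2 :: "'a \<Rightarrow> 'k"
  trunit :: "'o \<Rightarrow> 'k"
  trcmp :: "'f \<Rightarrow> 'f \<Rightarrow> 'k"

abbreviation tr1 :: "('o, 'f, 'a, 'h, 'b, 'k) trinat \<Rightarrow> 'f \<Rightarrow> 'b" where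
  "tr1 p f \<equiv> lft (tradj p f)"

locale trinatural_transformation =
  fixes A :: "('o, 'f, 'a, 'g) gray"
    and B :: "('p, 'h, 'b, 'k) gray" (structure)
    and F :: "('o, 'f, 'a, 'g, 'p, 'h, 'b, 'k) gmap"
    and G :: "('o, 'f, 'a, 'g, 'p, 'h, 'b, 'k) gmap"
    and p :: "('o, 'f, 'a, 'h, 'b, 'k) trinat"
  assumes ext: "tr0 p \<in> extensional (C0 A)" "tradj p \<in> extensional (C1 A)"
      "tr2 p \<in> extensional (C2 A)" "trunit p \<in> extensional (C0 A)"
      "\<not> composable A g f \<Longrightarrow> trcmp p g f = undefined"
    and component: "X \<in> C0 A \<Longrightarrow> is1 B (tr0 p X) (act0 F X) (act0 G X)"
    and adjoint: "is1 A f X Y \<Longrightarrow> adj_equiv (hom B (act0 F X) (act0 G Y)) (tradj p f)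
      (tr0 p Y \<bullet> act1 F f) (act1 G f \<bullet> tr0 p X)"
    and naturality: "is2 A \<phi> f g \<Longrightarrow> is1 A f X Y \<Longrightarrow> iso3 B (tr2 p \<phi>)
      (tr1 p g \<odot> (tr0 p Y \<rhd> act2 F \<phi>)) ((act2 G \<phi> \<lhd> tr0 p X) \<odot> tr1 p f)"
    and unitor: "X \<in> C0 A \<Longrightarrow> iso3 B (trunit p X) (one2 B (tr0 p X)) (tr1 p (one1 A X))"
    and compositor: "is1 A f X Y \<Longrightarrow> is1 A g Y Z \<Longrightarrow> iso3 B (trcmp p g f)
      ((act1 G g \<rhd> tr1 p f) \<odot> (tr1 p g \<lhd> act1 F f)) (tr1 p (g \<bullet>\<^bsub>A\<^esub> f))"
    and local_one: "f \<in> C1 A \<Longrightarrow> tr2 p (one2 A f) = one3 B (tr1 p f)"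
    and local_cmp: "is2 A \<phi> f g \<Longrightarrow> is2 A \<psi> g h \<Longrightarrow> is1 A f X Y \<Longrightarrow>
      tr2 p (\<psi> \<odot>\<^bsub>A\<^esub> \<phi>)
        = ((act2 G \<psi> \<lhd> tr0 p X) \<odot>\<rhd> tr2 p \<phi>) \<cdot> (tr2 p \<psi> \<lhd>\<odot> (tr0 p Y \<rhd> act2 F \<phi>))"
    and local_natural: "is3 A \<Omega> \<phi> \<phi>' \<Longrightarrow> is2 A \<phi> f g \<Longrightarrow> is1 A f X Y \<Longrightarrow>
      ((act3 G \<Omega> \<unlhd> tr0 p X) \<lhd>\<odot> tr1 p f) \<cdot> tr2 p \<phi>
        = tr2 p \<phi>' \<cdot> (tr1 p g \<odot>\<rhd> (tr0 p Y \<unrhd> act3 F \<Omega>))"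
    and right_whiskering: "is2 A \<phi> f f' \<Longrightarrow> is1 A f X Y \<Longrightarrow> is1 A g Y Z \<Longrightarrow>
      tr2 p (g \<rhd>\<^bsub>A\<^esub> \<phi>) \<cdot> (trcmp p g f' \<lhd>\<odot> (tr0 p Z \<rhd> act1 F g \<rhd> act2 F \<phi>))
        = ((act1 G g \<rhd> (act2 G \<phi> \<lhd> tr0 p X)) \<odot>\<rhd> trcmp p g f)
          \<cdot> ((act1 G g \<unrhd> tr2 p \<phi>) \<lhd>\<odot> (tr1 p g \<lhd> act1 F f))
          \<cdot> ((act1 G g \<rhd> tr1 p f') \<odot>\<rhd> inv3 B (ich B (tr1 p g) (act2 F \<phi>)))"
    and left_whiskering: "is1 A f X Y \<Longrightarrow> is2 A \<psi> g g' \<Longrightarrow> is1 A g Y Z \<Longrightarrow>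
      tr2 p (\<psi> \<lhd>\<^bsub>A\<^esub> f) \<cdot> (trcmp p g' f \<lhd>\<odot> (tr0 p Z \<rhd> (act2 F \<psi> \<lhd> act1 F f)))
        = ((act2 G \<psi> \<lhd> (act1 G f \<bullet> tr0 p X)) \<odot>\<rhd> trcmp p g f)
          \<cdot> (ich B (act2 G \<psi>) (tr1 p f) \<lhd>\<odot> (tr1 p g \<lhd> act1 F f))
          \<cdot> ((act1 G g' \<rhd> tr1 p f) \<odot>\<rhd> (tr2 p \<psi> \<unlhd> act1 F f))"
    and associativity: "is1 A e W X \<Longrightarrow> is1 A f X Y \<Longrightarrow> is1 A g Y Z \<Longrightarrow>
      trcmp p g (f \<bullet>\<^bsub>A\<^esub> e) \<cdot> ((act1 G g \<unrhd> trcmp p f e) \<lhd>\<odot> (tr1 p g \<lhd> (act1 F f \<bullet> act1 F e)))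
        = trcmp p (g \<bullet>\<^bsub>A\<^esub> f) e
          \<cdot> (((act1 G g \<bullet> act1 G f) \<rhd> tr1 p e) \<odot>\<rhd> (trcmp p g f \<unlhd> act1 F e))"
    and unit_right: "is1 A f X Y \<Longrightarrow>
      trcmp p f (one1 A X) \<cdot> ((act1 G f \<unrhd> trunit p X) \<lhd>\<odot> tr1 p f) = one3 B (tr1 p f)"
    and unit_left: "is1 A f X Y \<Longrightarrow>
      trcmp p (one1 A Y) f \<cdot> (tr1 p f \<odot>\<rhd> (trunit p Y \<unlhd> act1 F f)) = one3 B (tr1 p f)"

record ('o, 'f, 'b, 'k) trimod =
  md0 :: "'o \<Rightarrow> 'b"
  md1 :: "'f \<Rightarrow> 'k"

locale trimodification =
  fixes A :: "('o, 'f, 'a, 'g) gray"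
    and B :: "('p, 'h, 'b, 'k) gray" (structure)
    and F :: "('o, 'f, 'a, 'g, 'p, 'h, 'b, 'k) gmap"
    and G :: "('o, 'f, 'a, 'g, 'p, 'h, 'b, 'k) gmap"
    and p :: "('o, 'f, 'a, 'h, 'b, 'k) trinat"
    and q :: "('o, 'f, 'a, 'h, 'b, 'k) trinat"
    and \<sigma> :: "('o, 'f, 'b, 'k) trimod"
  assumes ext: "md0 \<sigma> \<in> extensional (C0 A)" "md1 \<sigma> \<in> extensional (C1 A)"
    and component: "X \<in> C0 A \<Longrightarrow> is2 B (md0 \<sigma> X) (tr0 p X) (tr0 q X)"
    and naturality: "is1 A f X Y \<Longrightarrow> iso3 B (md1 \<sigma> f)
      ((act1 G f \<rhd> md0 \<sigma> X) \<odot> tr1 p f) (tr1 q f \<odot> (md0 \<sigma> Y \<lhd> act1 F f))"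
    and local_modification: "is2 A \<phi> f g \<Longrightarrow> is1 A f X Y \<Longrightarrow>
      (tr2 q \<phi> \<lhd>\<odot> (md0 \<sigma> Y \<lhd> act1 F f))
          \<cdot> (tr1 q g \<odot>\<rhd> inv3 B (ich B (md0 \<sigma> Y) (act2 F \<phi>)))
          \<cdot> (md1 \<sigma> g \<lhd>\<odot> (tr0 p Y \<rhd> act2 F \<phi>))
        = ((act2 G \<phi> \<lhd> tr0 q X) \<odot>\<rhd> md1 \<sigma> f)
          \<cdot> (ich B (act2 G \<phi>) (md0 \<sigma> X) \<lhd>\<odot> tr1 p f)
          \<cdot> ((act1 G g \<rhd> md0 \<sigma> X) \<odot>\<rhd> tr2 p \<phi>)"
    and unit_law: "X \<in> C0 A \<Longrightarrow>
      md1 \<sigma> (one1 A X) \<cdot> (md0 \<sigma> X \<odot>\<rhd> trunit p X) = trunit q X \<lhd>\<odot> md0 \<sigma> X"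
    and composition_law: "is1 A f X Y \<Longrightarrow> is1 A g Y Z \<Longrightarrow>
      md1 \<sigma> (g \<bullet>\<^bsub>A\<^esub> f) \<cdot> (((act1 G g \<bullet> act1 G f) \<rhd> md0 \<sigma> X) \<odot>\<rhd> trcmp p g f)
        = (trcmp q g f \<lhd>\<odot> (md0 \<sigma> Z \<lhd> (act1 F g \<bullet> act1 F f)))
          \<cdot> ((act1 G g \<rhd> tr1 q f) \<odot>\<rhd> (md1 \<sigma> g \<unlhd> act1 F f))
          \<cdot> ((act1 G g \<unrhd> md1 \<sigma> f) \<lhd>\<odot> (tr1 p g \<lhd> act1 F f))"

locale perturbation =
  fixes A :: "('o, 'f, 'a, 'g) gray"
    and B :: "('p, 'h, 'b, 'k) gray" (structure)
    and F :: "('o, 'f, 'a, 'g, 'p, 'h, 'b, 'k) gmap"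
    and G :: "('o, 'f, 'a, 'g, 'p, 'h, 'b, 'k) gmap"
    and p :: "('o, 'f, 'a, 'h, 'b, 'k) trinat"
    and q :: "('o, 'f, 'a, 'h, 'b, 'k) trinat"
    and \<sigma> :: "('o, 'f, 'b, 'k) trimod"
    and \<tau> :: "('o, 'f, 'b, 'k) trimod"
    and \<Omega> :: "'o \<Rightarrow> 'k"
  assumes ext: "\<Omega> \<in> extensional (C0 A)"
    and component: "X \<in> C0 A \<Longrightarrow> is3 B (\<Omega> X) (md0 \<sigma> X) (md0 \<tau> X)"
    and axiom: "is1 A f X Y \<Longrightarrow>
      md1 \<tau> f \<cdot> ((act1 G f \<unrhd> \<Omega> X) \<lhd>\<odot> tr1 p f)
        = (tr1 q f \<odot>\<rhd> (\<Omega> Y \<unlhd> act1 F f)) \<cdot> md1 \<sigma> f"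


section \<open>3-pseudofunctors\<close>

record ('o, 'f, 'a, 'g, 'p, 'h, 'b, 'k) pseudo = "('o, 'f, 'a, 'g, 'p, 'h, 'b, 'k) gmap" +
  unitor :: "'o \<Rightarrow> 'b"
  compositor :: "'f \<Rightarrow> 'f \<Rightarrow> 'b"

text \<open>The composite of \<open>H \<otimes> H\<close> with the 2-functor \<open>M\<close>, and of the 2-functor \<open>M\<close> with \<open>H\<close>.\<close>

definition bifun_precompose ::
    "('h, 'b, 'k, 'h, 'b, 'k, 'h, 'b, 'k) gray_bifun \<Rightarrow>
      ('o, 'f, 'a, 'g, 'p, 'h, 'b, 'k, 'z) gmap_scheme \<Rightarrow>
      ('f, 'a, 'g, 'f, 'a, 'g, 'h, 'b, 'k) gray_bifun" where
  "bifun_precompose M H = \<lparr>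
    bf1 = \<lambda>g f. bf1 M (act1 H g) (act1 H f),
    bf2l = \<lambda>v f. bf2l M (act2 H v) (act1 H f),
    bf2r = \<lambda>g u. bf2r M (act1 H g) (act2 H u),
    bf3l = \<lambda>\<Gamma> f. bf3l M (act3 H \<Gamma>) (act1 H f),
    bf3r = \<lambda>g \<Gamma>. bf3r M (act1 H g) (act3 H \<Gamma>),
    bfich = \<lambda>v u. bfich M (act2 H v) (act2 H u)\<rparr>"

definition bifun_postcompose ::
    "('o, 'f, 'a, 'g, 'p, 'h, 'b, 'k, 'z) gmap_scheme \<Rightarrow>
      ('f, 'a, 'g, 'f, 'a, 'g, 'f, 'a, 'g) gray_bifun \<Rightarrow>
      ('f, 'a, 'g, 'f, 'a, 'g, 'h, 'b, 'k) gray_bifun" where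
  "bifun_postcompose H M = \<lparr>
    bf1 = \<lambda>g f. act1 H (bf1 M g f),
    bf2l = \<lambda>v f. act2 H (bf2l M v f),
    bf2r = \<lambda>g u. act2 H (bf2r M g u),
    bf3l = \<lambda>\<Gamma> f. act3 H (bf3l M \<Gamma> f),
    bf3r = \<lambda>g \<Gamma>. act3 H (bf3r M g \<Gamma>),
    bfich = \<lambda>v u. act3 H (bfich M v u)\<rparr>"

text \<open>
  Of the two coherence axioms of a trihomomorphism, the unit axiom holds automatically if the
  modifications are identities. All 3-cells occurring in the associativity axiom are then identities
  as well, except for the interchanger of the compositors, so that this axiom becomes \<open>coherence\<close>.
  (Source and target of that interchanger agree by \<open>omega\<close> since the compositors are invertible.)
\<close>

locale three_pseudofunctor =
  fixes A :: "('o, 'f, 'a, 'g) gray"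
    and C :: "('p, 'h, 'b, 'k) gray" (structure)
    and H :: "('o, 'f, 'a, 'g, 'p, 'h, 'b, 'k) pseudo"
  assumes ext: "gmap_extensional A H" "unitor H \<in> extensional (C0 A)"
      "\<not> composable A g f \<Longrightarrow> compositor H g f = undefined"
    and on_objects: "X \<in> C0 A \<Longrightarrow> act0 H X \<in> C0 C"
    and on_homs: "X \<in> C0 A \<Longrightarrow> Y \<in> C0 A \<Longrightarrow>
      two_functor (hom A X Y) (hom C (act0 H X) (act0 H Y)) (act1 H) (act2 H) (act3 H)"
    and unitor_iso: "X \<in> C0 A \<Longrightarrow> iso2 C (unitor H X) (one1 C (act0 H X)) (act1 H (one1 A X))"
    and compositor_iso: "is1 A f X Y \<Longrightarrow> is1 A g Y Z \<Longrightarrow>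
      iso2 C (compositor H g f) (act1 H g \<bullet> act1 H f) (act1 H (g \<bullet>\<^bsub>A\<^esub> f))"
    and compositor_natural: "X \<in> C0 A \<Longrightarrow> Y \<in> C0 A \<Longrightarrow> Z \<in> C0 A \<Longrightarrow>
      gray_bifun_two_natural (hom A Y Z) (hom A X Y) (hom C (act0 H X) (act0 H Z))
        (bifun_precompose (cmp_bifun C) H) (bifun_postcompose H (cmp_bifun A)) (compositor H)"
    and gamma: "is1 A f X Y \<Longrightarrow>
      compositor H (one1 A Y) f \<odot> (unitor H Y \<lhd> act1 H f) = one2 C (act1 H f)"
    and delta: "is1 A f X Y \<Longrightarrow>
      compositor H f (one1 A X) \<odot> (act1 H f \<rhd> unitor H X) = one2 C (act1 H f)"
    and omega: "is1 A f W X \<Longrightarrow> is1 A g X Y \<Longrightarrow> is1 A h Y Z \<Longrightarrow>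
      compositor H (h \<bullet>\<^bsub>A\<^esub> g) f \<odot> (compositor H h g \<lhd> act1 H f)
        = compositor H h (g \<bullet>\<^bsub>A\<^esub> f) \<odot> (act1 H h \<rhd> compositor H g f)"
    and coherence: "is1 A f V W \<Longrightarrow> is1 A g W X \<Longrightarrow> is1 A h X Y \<Longrightarrow> is1 A k Y Z \<Longrightarrow>
      ich C (compositor H k h) (compositor H g f)
        = one3 C ((act1 H (k \<bullet>\<^bsub>A\<^esub> h) \<rhd> compositor H g f)
            \<odot> (compositor H k h \<lhd> (act1 H g \<bullet> act1 H f)))"

definition of_gray_functor ::
    "('o, 'f, 'a, 'g) gray \<Rightarrow> ('p, 'h, 'b, 'k) gray \<Rightarrow>
      ('o, 'f, 'a, 'g, 'p, 'h, 'b, 'k) gmap \<Rightarrow> ('o, 'f, 'a, 'g, 'p, 'h, 'b, 'k) pseudo" where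
  "of_gray_functor A B F = \<lparr>act0 = act0 F, act1 = act1 F, act2 = act2 F, act3 = act3 F,
    unitor = (\<lambda>X\<in>C0 A. one2 B (one1 B (act0 F X))),
    compositor = (\<lambda>g f. if composable A g f then one2 B (cmp1 B (act1 F g) (act1 F f))
      else undefined)\<rparr>"

text \<open>The composite of a 3-pseudofunctor \<open>H\<close> on \<open>A\<close> with a Gray-functor \<open>K\<close>.\<close>

definition after ::
    "('o, 'f, 'a, 'g) gray \<Rightarrow> ('p, 'h, 'b, 'k, 'q, 'i, 'c, 'l) gmap \<Rightarrow>
      ('o, 'f, 'a, 'g, 'p, 'h, 'b, 'k) pseudo \<Rightarrow> ('o, 'f, 'a, 'g, 'q, 'i, 'c, 'l) pseudo" where
  "after A K H = \<lparr>
    act0 = (\<lambda>X\<in>C0 A. act0 K (act0 H X)),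
    act1 = (\<lambda>f\<in>C1 A. act1 K (act1 H f)),
    act2 = (\<lambda>u\<in>C2 A. act2 K (act2 H u)),
    act3 = (\<lambda>\<Gamma>\<in>C3 A. act3 K (act3 H \<Gamma>)),
    unitor = (\<lambda>X\<in>C0 A. act2 K (unitor H X)),
    compositor = (\<lambda>g f. if composable A g f then act2 K (compositor H g f) else undefined)\<rparr>"


section \<open>Path objects\<close>

text \<open>
  Cells of the path objects carry their source and target. A \<open>PCell\<close> is a pair of cells of the
  Gray-category one level below.
\<close>

datatype ('c, 'd) pcell = PCell (pdom: 'c) (pcod: 'c) (part0: 'd) (part1: 'd)


subsection \<open>The path object of 1-cells\<close>

text \<open>\<open>P1Mor x y f0 f1 e\<close> is the morphism \<open>(f \<stileturn> f\<^sup>*, f\<^sub>0, f\<^sub>1)\<close> from \<open>x\<close> to \<open>y\<close>, where \<open>e\<close> is the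
  adjoint equivalence; \<open>P1Two u v \<phi>0 \<phi>1 \<phi>\<close> is the 2-cell \<open>(\<phi>, \<phi>\<^sub>0, \<phi>\<^sub>1)\<close> from \<open>u\<close> to \<open>v\<close>.\<close>

datatype ('f, 'a, 'g) p1mor =
  P1Mor (mdom: 'f) (mcod: 'f) (mor0: 'f) (mor1: 'f) (madj: "('a, 'g) adj")

abbreviation mlft :: "('f, 'a, 'g) p1mor \<Rightarrow> 'a" where
  "mlft u \<equiv> lft (madj u)"

datatype ('f, 'a, 'g) p1two =
  P1Two (tdom: "('f, 'a, 'g) p1mor") (tcod: "('f, 'a, 'g) p1mor") (two0: 'a) (two1: 'a) (tsq: 'g)

type_synonym ('f, 'a, 'g) p1three = "(('f, 'a, 'g) p1two, 'g) pcell"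

type_synonym ('f, 'a, 'g) path1 =
  "('f, ('f, 'a, 'g) p1mor, ('f, 'a, 'g) p1two, ('f, 'a, 'g) p1three) gray"

context
  fixes B :: "('o, 'f, 'a, 'g) gray" (structure)
begin

definition p1_mors :: "('f, 'a, 'g) p1mor set" where
  "p1_mors = {P1Mor x y f0 f1 e | x y f0 f1 e. x \<in> C1 B \<and> y \<in> C1 B \<and>
    is1 B f0 (dom1 B x) (dom1 B y) \<and> is1 B f1 (cod1 B x) (cod1 B y) \<and>
    adj_equiv (hom B (dom1 B x) (cod1 B y)) e (y \<bullet> f0) (f1 \<bullet> x)}"

definition p1_twos :: "('f, 'a, 'g) p1two set" where
  "p1_twos = {P1Two u v \<phi>0 \<phi>1 \<phi> | u v \<phi>0 \<phi>1 \<phi>. u \<in> p1_mors \<and> v \<in> p1_mors \<and>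
    mdom u = mdom v \<and> mcod u = mcod v \<and>
    is2 B \<phi>0 (mor0 u) (mor0 v) \<and> is2 B \<phi>1 (mor1 u) (mor1 v) \<and>
    iso3 B \<phi> (mlft v \<odot> (mcod u \<rhd> \<phi>0)) ((\<phi>1 \<lhd> mdom u) \<odot> mlft u)}"

definition p1_threes :: "('f, 'a, 'g) p1three set" where
  "p1_threes = {PCell \<phi> \<psi> \<Gamma>0 \<Gamma>1 | \<phi> \<psi> \<Gamma>0 \<Gamma>1. \<phi> \<in> p1_twos \<and> \<psi> \<in> p1_twos \<and>
    tdom \<phi> = tdom \<psi> \<and> tcod \<phi> = tcod \<psi> \<and>
    is3 B \<Gamma>0 (two0 \<phi>) (two0 \<psi>) \<and> is3 B \<Gamma>1 (two1 \<phi>) (two1 \<psi>) \<and>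
    tsq \<psi> \<cdot> (mlft (tcod \<phi>) \<odot>\<rhd> (mcod (tdom \<phi>) \<unrhd> \<Gamma>0))
      = ((\<Gamma>1 \<unlhd> mdom (tdom \<phi>)) \<lhd>\<odot> mlft (tdom \<phi>)) \<cdot> tsq \<phi>}"

definition p1_cmp1 :: "('f, 'a, 'g) p1mor \<Rightarrow> ('f, 'a, 'g) p1mor \<Rightarrow> ('f, 'a, 'g) p1mor" where
  "p1_cmp1 u' u = P1Mor (mdom u) (mcod u') (mor0 u' \<bullet> mor0 u) (mor1 u' \<bullet> mor1 u)
    (cmp_adj B (lwh_adj B (mor1 u') (madj u)) (rwh_adj B (madj u') (mor0 u)))"

definition p1_cmp2 :: "('f, 'a, 'g) p1two \<Rightarrow> ('f, 'a, 'g) p1two \<Rightarrow> ('f, 'a, 'g) p1two" where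
  "p1_cmp2 \<psi> \<phi> = P1Two (tdom \<phi>) (tcod \<psi>) (two0 \<psi> \<odot> two0 \<phi>) (two1 \<psi> \<odot> two1 \<phi>)
    (((two1 \<psi> \<lhd> mdom (tdom \<phi>)) \<odot>\<rhd> tsq \<phi>) \<cdot> (tsq \<psi> \<lhd>\<odot> (mcod (tdom \<phi>) \<rhd> two0 \<phi>)))"

text \<open>Whiskering uses an interchanger of \<open>B\<close> to move a naturality square past a 2-cell.\<close>

definition p1_lwh2 :: "('f, 'a, 'g) p1mor \<Rightarrow> ('f, 'a, 'g) p1two \<Rightarrow> ('f, 'a, 'g) p1two" where
  "p1_lwh2 h \<phi> = P1Two (p1_cmp1 h (tdom \<phi>)) (p1_cmp1 h (tcod \<phi>))
    (mor0 h \<rhd> two0 \<phi>) (mor1 h \<rhd> two1 \<phi>)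
    (((mor1 h \<unrhd> tsq \<phi>) \<lhd>\<odot> (mlft h \<lhd> mor0 (tdom \<phi>)))
      \<cdot> ((mor1 h \<rhd> mlft (tcod \<phi>)) \<odot>\<rhd> inv3 B (ich B (mlft h) (two0 \<phi>))))"

definition p1_rwh2 :: "('f, 'a, 'g) p1two \<Rightarrow> ('f, 'a, 'g) p1mor \<Rightarrow> ('f, 'a, 'g) p1two" where
  "p1_rwh2 \<psi> h = P1Two (p1_cmp1 (tdom \<psi>) h) (p1_cmp1 (tcod \<psi>) h)
    (two0 \<psi> \<lhd> mor0 h) (two1 \<psi> \<lhd> mor1 h)
    ((ich B (two1 \<psi>) (mlft h) \<lhd>\<odot> (mlft (tdom \<psi>) \<lhd> mor0 h))
      \<cdot> ((mor1 (tcod \<psi>) \<rhd> mlft h) \<odot>\<rhd> (tsq \<psi> \<unlhd> mor0 h)))"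

definition path1 :: "('f, 'a, 'g) path1" where
  "path1 = \<lparr>
    C1 = p1_mors, C2 = p1_twos, C3 = p1_threes,
    dom2 = tdom, cod2 = tcod, dom3 = pdom, cod3 = pcod,
    one2 = \<lambda>u. P1Two u u (one2 B (mor0 u)) (one2 B (mor1 u)) (one3 B (mlft u)),
    one3 = \<lambda>\<phi>. PCell \<phi> \<phi> (one3 B (two0 \<phi>)) (one3 B (two1 \<phi>)),
    cmp2 = p1_cmp2,
    hcmp3 = \<lambda>\<Delta> \<Gamma>. PCell (p1_cmp2 (pdom \<Delta>) (pdom \<Gamma>)) (p1_cmp2 (pcod \<Delta>) (pcod \<Gamma>))
      (part0 \<Delta> \<star> part0 \<Gamma>) (part1 \<Delta> \<star> part1 \<Gamma>),
    vcmp3 = \<lambda>\<Delta> \<Gamma>. PCell (pdom \<Gamma>) (pcod \<Delta>) (part0 \<Delta> \<cdot> part0 \<Gamma>) (part1 \<Delta> \<cdot> part1 \<Gamma>),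
    C0 = C1 B,
    dom1 = mdom, cod1 = mcod,
    one1 = \<lambda>x. P1Mor x x (one1 B (dom1 B x)) (one1 B (cod1 B x)) (one_adj B x),
    cmp1 = p1_cmp1,
    lwh2 = p1_lwh2,
    rwh2 = p1_rwh2,
    lwh3 = \<lambda>h \<Gamma>. PCell (p1_lwh2 h (pdom \<Gamma>)) (p1_lwh2 h (pcod \<Gamma>))
      (mor0 h \<unrhd> part0 \<Gamma>) (mor1 h \<unrhd> part1 \<Gamma>),
    rwh3 = \<lambda>\<Gamma> h. PCell (p1_rwh2 (pdom \<Gamma>) h) (p1_rwh2 (pcod \<Gamma>) h)
      (part0 \<Gamma> \<unlhd> mor0 h) (part1 \<Gamma> \<unlhd> mor1 h),
    ich = \<lambda>\<psi> \<phi>. PCell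
      (p1_cmp2 (p1_lwh2 (tcod \<psi>) \<phi>) (p1_rwh2 \<psi> (tdom \<phi>)))
      (p1_cmp2 (p1_rwh2 \<psi> (tcod \<phi>)) (p1_lwh2 (tdom \<psi>) \<phi>))
      (ich B (two0 \<psi>) (two0 \<phi>)) (ich B (two1 \<psi>) (two1 \<phi>))\<rparr>"

end

definition path_s0 :: "('o, 'f, 'a, 'g) gray \<Rightarrow> ('f, ('f, 'a, 'g) p1mor, ('f, 'a, 'g) p1two,
    ('f, 'a, 'g) p1three, 'o, 'f, 'a, 'g) gmap" where
  "path_s0 B = \<lparr>
    act0 = restrict (dom1 B) (C0 (path1 B)), act1 = restrict mor0 (C1 (path1 B)),
    act2 = restrict two0 (C2 (path1 B)), act3 = restrict part0 (C3 (path1 B))\<rparr>"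

definition path_t0 :: "('o, 'f, 'a, 'g) gray \<Rightarrow> ('f, ('f, 'a, 'g) p1mor, ('f, 'a, 'g) p1two,
    ('f, 'a, 'g) p1three, 'o, 'f, 'a, 'g) gmap" where
  "path_t0 B = \<lparr>
    act0 = restrict (cod1 B) (C0 (path1 B)), act1 = restrict mor1 (C1 (path1 B)),
    act2 = restrict two1 (C2 (path1 B)), act3 = restrict part1 (C3 (path1 B))\<rparr>"


subsection \<open>The path object of 2-cells\<close>

text \<open>
  A morphism \<open>P2Mor X Y u0 u1 \<theta>\<close> from \<open>X\<close> to \<open>Y\<close> consists of morphisms \<open>u0\<close>, \<open>u1\<close> of the path object
  of 1-cells which share the 1-cells \<open>f\<^sub>0\<close>, \<open>f\<^sub>1\<close>, and of the 3-cell \<open>\<theta>\<close> relating them. Similarly, a 2-cell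
  or 3-cell is a pair of 2-cells \<open>(\<Phi>\<^sub>i, \<phi>\<^sub>0, \<phi>\<^sub>1)\<close> or 3-cells \<open>(\<Gamma>\<^sub>0, \<Gamma>\<^sub>1)\<close> of the path object of 1-cells for
  \<open>i = 0, 1\<close> with the same underlying cells of \<open>B\<close>.
\<close>

datatype ('f, 'a, 'g) p2mor =
  P2Mor (m2dom: 'a) (m2cod: 'a) (face0: "('f, 'a, 'g) p1mor") (face1: "('f, 'a, 'g) p1mor")
    (mcell: 'g)

type_synonym ('f, 'a, 'g) p2two = "(('f, 'a, 'g) p2mor, ('f, 'a, 'g) p1two) pcell"

type_synonym ('f, 'a, 'g) p2three = "(('f, 'a, 'g) p2two, ('f, 'a, 'g) p1three) pcell"

type_synonym ('f, 'a, 'g) path2 =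
  "('a, ('f, 'a, 'g) p2mor, ('f, 'a, 'g) p2two, ('f, 'a, 'g) p2three) gray"

context
  fixes B :: "('o, 'f, 'a, 'g) gray" (structure)
begin

definition p2_mors :: "('f, 'a, 'g) p2mor set" where
  "p2_mors = {P2Mor X Y u0 u1 \<theta> | X Y u0 u1 \<theta>. X \<in> C2 B \<and> Y \<in> C2 B \<and>
    is1 (path1 B) u0 (dom2 B X) (dom2 B Y) \<and> is1 (path1 B) u1 (cod2 B X) (cod2 B Y) \<and>
    mor0 u0 = mor0 u1 \<and> mor1 u0 = mor1 u1 \<and>
    iso3 B \<theta> (mlft u1 \<odot> (Y \<lhd> mor0 u0)) ((mor1 u0 \<rhd> X) \<odot> mlft u0)}"

definition p2_twos :: "('f, 'a, 'g) p2two set" where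
  "p2_twos = {PCell u v \<Phi>0 \<Phi>1 | u v \<Phi>0 \<Phi>1. u \<in> p2_mors \<and> v \<in> p2_mors \<and>
    m2dom u = m2dom v \<and> m2cod u = m2cod v \<and>
    is2 (path1 B) \<Phi>0 (face0 u) (face0 v) \<and> is2 (path1 B) \<Phi>1 (face1 u) (face1 v) \<and>
    two0 \<Phi>0 = two0 \<Phi>1 \<and> two1 \<Phi>0 = two1 \<Phi>1 \<and>
    (ich B (two1 \<Phi>0) (m2dom u) \<lhd>\<odot> mlft (face0 u))
        \<cdot> ((mor1 (face0 v) \<rhd> m2dom u) \<odot>\<rhd> tsq \<Phi>0)
        \<cdot> (mcell v \<lhd>\<odot> (dom2 B (m2cod u) \<rhd> two0 \<Phi>0))
      = ((two1 \<Phi>0 \<lhd> cod2 B (m2dom u)) \<odot>\<rhd> mcell u)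
        \<cdot> (tsq \<Phi>1 \<lhd>\<odot> (m2cod u \<lhd> mor0 (face0 u)))
        \<cdot> (mlft (face1 v) \<odot>\<rhd> inv3 B (ich B (m2cod u) (two0 \<Phi>0)))}"

definition p2_threes :: "('f, 'a, 'g) p2three set" where
  "p2_threes = {PCell \<Phi> \<Psi> \<Gamma> \<Gamma>' | \<Phi> \<Psi> \<Gamma> \<Gamma>'. \<Phi> \<in> p2_twos \<and> \<Psi> \<in> p2_twos \<and>
    pdom \<Phi> = pdom \<Psi> \<and> pcod \<Phi> = pcod \<Psi> \<and>
    is3 (path1 B) \<Gamma> (part0 \<Phi>) (part0 \<Psi>) \<and> is3 (path1 B) \<Gamma>' (part1 \<Phi>) (part1 \<Psi>) \<and>
    part0 \<Gamma> = part0 \<Gamma>' \<and> part1 \<Gamma> = part1 \<Gamma>'}"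

definition p2_cmp1 :: "('f, 'a, 'g) p2mor \<Rightarrow> ('f, 'a, 'g) p2mor \<Rightarrow> ('f, 'a, 'g) p2mor" where
  "p2_cmp1 u' u = P2Mor (m2dom u) (m2cod u')
    (face0 u' \<bullet>\<^bsub>path1 B\<^esub> face0 u) (face1 u' \<bullet>\<^bsub>path1 B\<^esub> face1 u)
    (((mor1 (face0 u') \<unrhd> mcell u) \<lhd>\<odot> (mlft (face0 u') \<lhd> mor0 (face0 u)))
      \<cdot> ((mor1 (face0 u') \<rhd> mlft (face1 u)) \<odot>\<rhd> (mcell u' \<unlhd> mor0 (face0 u))))"

definition p2_cmp2 :: "('f, 'a, 'g) p2two \<Rightarrow> ('f, 'a, 'g) p2two \<Rightarrow> ('f, 'a, 'g) p2two" where
  "p2_cmp2 \<Psi> \<Phi> = PCell (pdom \<Phi>) (pcod \<Psi>)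
    (part0 \<Psi> \<odot>\<^bsub>path1 B\<^esub> part0 \<Phi>) (part1 \<Psi> \<odot>\<^bsub>path1 B\<^esub> part1 \<Phi>)"

definition p2_lwh2 :: "('f, 'a, 'g) p2mor \<Rightarrow> ('f, 'a, 'g) p2two \<Rightarrow> ('f, 'a, 'g) p2two" where
  "p2_lwh2 h \<Phi> = PCell (p2_cmp1 h (pdom \<Phi>)) (p2_cmp1 h (pcod \<Phi>))
    (face0 h \<rhd>\<^bsub>path1 B\<^esub> part0 \<Phi>) (face1 h \<rhd>\<^bsub>path1 B\<^esub> part1 \<Phi>)"

definition p2_rwh2 :: "('f, 'a, 'g) p2two \<Rightarrow> ('f, 'a, 'g) p2mor \<Rightarrow> ('f, 'a, 'g) p2two" where
  "p2_rwh2 \<Psi> h = PCell (p2_cmp1 (pdom \<Psi>) h) (p2_cmp1 (pcod \<Psi>) h)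
    (part0 \<Psi> \<lhd>\<^bsub>path1 B\<^esub> face0 h) (part1 \<Psi> \<lhd>\<^bsub>path1 B\<^esub> face1 h)"

definition path2 :: "('f, 'a, 'g) path2" where
  "path2 = \<lparr>
    C1 = p2_mors, C2 = p2_twos, C3 = p2_threes,
    dom2 = pdom, cod2 = pcod, dom3 = pdom, cod3 = pcod,
    one2 = \<lambda>u. PCell u u (one2 (path1 B) (face0 u)) (one2 (path1 B) (face1 u)),
    one3 = \<lambda>\<Phi>. PCell \<Phi> \<Phi> (one3 (path1 B) (part0 \<Phi>)) (one3 (path1 B) (part1 \<Phi>)),
    cmp2 = p2_cmp2,
    hcmp3 = \<lambda>\<Delta> \<Gamma>. PCell (p2_cmp2 (pdom \<Delta>) (pdom \<Gamma>)) (p2_cmp2 (pcod \<Delta>) (pcod \<Gamma>))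
      (part0 \<Delta> \<star>\<^bsub>path1 B\<^esub> part0 \<Gamma>) (part1 \<Delta> \<star>\<^bsub>path1 B\<^esub> part1 \<Gamma>),
    vcmp3 = \<lambda>\<Delta> \<Gamma>. PCell (pdom \<Gamma>) (pcod \<Delta>)
      (part0 \<Delta> \<cdot>\<^bsub>path1 B\<^esub> part0 \<Gamma>) (part1 \<Delta> \<cdot>\<^bsub>path1 B\<^esub> part1 \<Gamma>),
    C0 = C2 B,
    dom1 = m2dom, cod1 = m2cod,
    one1 = \<lambda>X. P2Mor X X (one1 (path1 B) (dom2 B X)) (one1 (path1 B) (cod2 B X)) (one3 B X),
    cmp1 = p2_cmp1,
    lwh2 = p2_lwh2,
    rwh2 = p2_rwh2,
    lwh3 = \<lambda>h \<Gamma>. PCell (p2_lwh2 h (pdom \<Gamma>)) (p2_lwh2 h (pcod \<Gamma>))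
      (face0 h \<unrhd>\<^bsub>path1 B\<^esub> part0 \<Gamma>) (face1 h \<unrhd>\<^bsub>path1 B\<^esub> part1 \<Gamma>),
    rwh3 = \<lambda>\<Gamma> h. PCell (p2_rwh2 (pdom \<Gamma>) h) (p2_rwh2 (pcod \<Gamma>) h)
      (part0 \<Gamma> \<unlhd>\<^bsub>path1 B\<^esub> face0 h) (part1 \<Gamma> \<unlhd>\<^bsub>path1 B\<^esub> face1 h),
    ich = \<lambda>\<Psi> \<Phi>. PCell
      (p2_cmp2 (p2_lwh2 (pcod \<Psi>) \<Phi>) (p2_rwh2 \<Psi> (pdom \<Phi>)))
      (p2_cmp2 (p2_rwh2 \<Psi> (pcod \<Phi>)) (p2_lwh2 (pdom \<Psi>) \<Phi>))
      (ich (path1 B) (part0 \<Psi>) (part0 \<Phi>)) (ich (path1 B) (part1 \<Psi>) (part1 \<Phi>))\<rparr>"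

end

definition path_s1 :: "('o, 'f, 'a, 'g) gray \<Rightarrow> ('a, ('f, 'a, 'g) p2mor, ('f, 'a, 'g) p2two,
    ('f, 'a, 'g) p2three, 'f, ('f, 'a, 'g) p1mor, ('f, 'a, 'g) p1two, ('f, 'a, 'g) p1three) gmap"
  where
  "path_s1 B = \<lparr>
    act0 = restrict (dom2 B) (C0 (path2 B)), act1 = restrict face0 (C1 (path2 B)),
    act2 = restrict part0 (C2 (path2 B)), act3 = restrict part0 (C3 (path2 B))\<rparr>"

definition path_t1 :: "('o, 'f, 'a, 'g) gray \<Rightarrow> ('a, ('f, 'a, 'g) p2mor, ('f, 'a, 'g) p2two,
    ('f, 'a, 'g) p2three, 'f, ('f, 'a, 'g) p1mor, ('f, 'a, 'g) p1two, ('f, 'a, 'g) p1three) gmap"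
  where
  "path_t1 B = \<lparr>
    act0 = restrict (cod2 B) (C0 (path2 B)), act1 = restrict face1 (C1 (path2 B)),
    act2 = restrict part1 (C2 (path2 B)), act3 = restrict part1 (C3 (path2 B))\<rparr>"


subsection \<open>The path object of 3-cells\<close>

text \<open>
  A morphism, 2-cell or 3-cell is a pair of cells of the path object of 2-cells for \<open>j = 0, 1\<close> with
  the same images under \<open>s\<^sub>1\<close> and \<open>t\<^sub>1\<close>.
\<close>

type_synonym ('f, 'a, 'g) p3mor = "('g, ('f, 'a, 'g) p2mor) pcell"

type_synonym ('f, 'a, 'g) p3two = "(('f, 'a, 'g) p3mor, ('f, 'a, 'g) p2two) pcell"

type_synonym ('f, 'a, 'g) p3three = "(('f, 'a, 'g) p3two, ('f, 'a, 'g) p2three) pcell"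

type_synonym ('f, 'a, 'g) path3 =
  "('g, ('f, 'a, 'g) p3mor, ('f, 'a, 'g) p3two, ('f, 'a, 'g) p3three) gray"

context
  fixes B :: "('o, 'f, 'a, 'g) gray" (structure)
begin

definition p3_mors :: "('f, 'a, 'g) p3mor set" where
  "p3_mors = {PCell x y m0 m1 | x y m0 m1. x \<in> C3 B \<and> y \<in> C3 B \<and>
    is1 (path2 B) m0 (dom3 B x) (dom3 B y) \<and> is1 (path2 B) m1 (cod3 B x) (cod3 B y) \<and>
    face0 m0 = face0 m1 \<and> face1 m0 = face1 m1 \<and>
    mcell m1 \<cdot> (mlft (face1 m0) \<odot>\<rhd> (y \<unlhd> mor0 (face0 m0)))
      = ((mor1 (face0 m0) \<unrhd> x) \<lhd>\<odot> mlft (face0 m0)) \<cdot> mcell m0}"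

definition p3_twos :: "('f, 'a, 'g) p3two set" where
  "p3_twos = {PCell m n \<Phi> \<Phi>' | m n \<Phi> \<Phi>'. m \<in> p3_mors \<and> n \<in> p3_mors \<and>
    pdom m = pdom n \<and> pcod m = pcod n \<and>
    is2 (path2 B) \<Phi> (part0 m) (part0 n) \<and> is2 (path2 B) \<Phi>' (part1 m) (part1 n) \<and>
    part0 \<Phi> = part0 \<Phi>' \<and> part1 \<Phi> = part1 \<Phi>'}"

definition p3_threes :: "('f, 'a, 'g) p3three set" where
  "p3_threes = {PCell \<Phi> \<Psi> \<Gamma> \<Gamma>' | \<Phi> \<Psi> \<Gamma> \<Gamma>'. \<Phi> \<in> p3_twos \<and> \<Psi> \<in> p3_twos \<and>
    pdom \<Phi> = pdom \<Psi> \<and> pcod \<Phi> = pcod \<Psi> \<and>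
    is3 (path2 B) \<Gamma> (part0 \<Phi>) (part0 \<Psi>) \<and> is3 (path2 B) \<Gamma>' (part1 \<Phi>) (part1 \<Psi>) \<and>
    part0 \<Gamma> = part0 \<Gamma>' \<and> part1 \<Gamma> = part1 \<Gamma>'}"

definition p3_cmp1 :: "('f, 'a, 'g) p3mor \<Rightarrow> ('f, 'a, 'g) p3mor \<Rightarrow> ('f, 'a, 'g) p3mor" where
  "p3_cmp1 m' m = PCell (pdom m) (pcod m')
    (part0 m' \<bullet>\<^bsub>path2 B\<^esub> part0 m) (part1 m' \<bullet>\<^bsub>path2 B\<^esub> part1 m)"

definition p3_cmp2 :: "('f, 'a, 'g) p3two \<Rightarrow> ('f, 'a, 'g) p3two \<Rightarrow> ('f, 'a, 'g) p3two" where
  "p3_cmp2 \<Psi> \<Phi> = PCell (pdom \<Phi>) (pcod \<Psi>)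
    (part0 \<Psi> \<odot>\<^bsub>path2 B\<^esub> part0 \<Phi>) (part1 \<Psi> \<odot>\<^bsub>path2 B\<^esub> part1 \<Phi>)"

definition p3_lwh2 :: "('f, 'a, 'g) p3mor \<Rightarrow> ('f, 'a, 'g) p3two \<Rightarrow> ('f, 'a, 'g) p3two" where
  "p3_lwh2 h \<Phi> = PCell (p3_cmp1 h (pdom \<Phi>)) (p3_cmp1 h (pcod \<Phi>))
    (part0 h \<rhd>\<^bsub>path2 B\<^esub> part0 \<Phi>) (part1 h \<rhd>\<^bsub>path2 B\<^esub> part1 \<Phi>)"

definition p3_rwh2 :: "('f, 'a, 'g) p3two \<Rightarrow> ('f, 'a, 'g) p3mor \<Rightarrow> ('f, 'a, 'g) p3two" where
  "p3_rwh2 \<Psi> h = PCell (p3_cmp1 (pdom \<Psi>) h) (p3_cmp1 (pcod \<Psi>) h)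
    (part0 \<Psi> \<lhd>\<^bsub>path2 B\<^esub> part0 h) (part1 \<Psi> \<lhd>\<^bsub>path2 B\<^esub> part1 h)"

definition path3 :: "('f, 'a, 'g) path3" where
  "path3 = \<lparr>
    C1 = p3_mors, C2 = p3_twos, C3 = p3_threes,
    dom2 = pdom, cod2 = pcod, dom3 = pdom, cod3 = pcod,
    one2 = \<lambda>m. PCell m m (one2 (path2 B) (part0 m)) (one2 (path2 B) (part1 m)),
    one3 = \<lambda>\<Phi>. PCell \<Phi> \<Phi> (one3 (path2 B) (part0 \<Phi>)) (one3 (path2 B) (part1 \<Phi>)),
    cmp2 = p3_cmp2,
    hcmp3 = \<lambda>\<Delta> \<Gamma>. PCell (p3_cmp2 (pdom \<Delta>) (pdom \<Gamma>)) (p3_cmp2 (pcod \<Delta>) (pcod \<Gamma>))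
      (part0 \<Delta> \<star>\<^bsub>path2 B\<^esub> part0 \<Gamma>) (part1 \<Delta> \<star>\<^bsub>path2 B\<^esub> part1 \<Gamma>),
    vcmp3 = \<lambda>\<Delta> \<Gamma>. PCell (pdom \<Gamma>) (pcod \<Delta>)
      (part0 \<Delta> \<cdot>\<^bsub>path2 B\<^esub> part0 \<Gamma>) (part1 \<Delta> \<cdot>\<^bsub>path2 B\<^esub> part1 \<Gamma>),
    C0 = C3 B,
    dom1 = pdom, cod1 = pcod,
    one1 = \<lambda>x. PCell x x (one1 (path2 B) (dom3 B x)) (one1 (path2 B) (cod3 B x)),
    cmp1 = p3_cmp1,
    lwh2 = p3_lwh2,
    rwh2 = p3_rwh2,
    lwh3 = \<lambda>h \<Gamma>. PCell (p3_lwh2 h (pdom \<Gamma>)) (p3_lwh2 h (pcod \<Gamma>))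
      (part0 h \<unrhd>\<^bsub>path2 B\<^esub> part0 \<Gamma>) (part1 h \<unrhd>\<^bsub>path2 B\<^esub> part1 \<Gamma>),
    rwh3 = \<lambda>\<Gamma> h. PCell (p3_rwh2 (pdom \<Gamma>) h) (p3_rwh2 (pcod \<Gamma>) h)
      (part0 \<Gamma> \<unlhd>\<^bsub>path2 B\<^esub> part0 h) (part1 \<Gamma> \<unlhd>\<^bsub>path2 B\<^esub> part1 h),
    ich = \<lambda>\<Psi> \<Phi>. PCell
      (p3_cmp2 (p3_lwh2 (pcod \<Psi>) \<Phi>) (p3_rwh2 \<Psi> (pdom \<Phi>)))
      (p3_cmp2 (p3_rwh2 \<Psi> (pcod \<Phi>)) (p3_lwh2 (pdom \<Psi>) \<Phi>))
      (ich (path2 B) (part0 \<Psi>) (part0 \<Phi>)) (ich (path2 B) (part1 \<Psi>) (part1 \<Phi>))\<rparr>"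

end

definition path_s2 :: "('o, 'f, 'a, 'g) gray \<Rightarrow> ('g, ('f, 'a, 'g) p3mor, ('f, 'a, 'g) p3two,
    ('f, 'a, 'g) p3three, 'a, ('f, 'a, 'g) p2mor, ('f, 'a, 'g) p2two, ('f, 'a, 'g) p2three) gmap"
  where
  "path_s2 B = \<lparr>
    act0 = restrict (dom3 B) (C0 (path3 B)), act1 = restrict part0 (C1 (path3 B)),
    act2 = restrict part0 (C2 (path3 B)), act3 = restrict part0 (C3 (path3 B))\<rparr>"

definition path_t2 :: "('o, 'f, 'a, 'g) gray \<Rightarrow> ('g, ('f, 'a, 'g) p3mor, ('f, 'a, 'g) p3two,
    ('f, 'a, 'g) p3three, 'a, ('f, 'a, 'g) p2mor, ('f, 'a, 'g) p2two, ('f, 'a, 'g) p2three) gmap"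
  where
  "path_t2 B = \<lparr>
    act0 = restrict (cod3 B) (C0 (path3 B)), act1 = restrict part1 (C1 (path3 B)),
    act2 = restrict part1 (C2 (path3 B)), act3 = restrict part1 (C3 (path3 B))\<rparr>"

end

theory Submission
  imports Defs
begin

text \<open>
  Since the components on 1-cells, 2-cells and 3-cells of a 3-pseudofunctor into a path object
  have prescribed faces, the only free data are the squares filling them: a 3-pseudofunctor into
  \<open>path1 B\<close> over \<open>F\<close> and \<open>G\<close> is a family of 1-cells \<open>p\<^sub>X\<close>, adjoint equivalences \<open>p\<^sub>f\<close> and
  invertible 3-cells \<open>p\<^sub>\<phi>\<close>, and its unitors and compositors are invertible 3-cells over
  identities, namely the inverses of \<open>p\<^sup>X\<close> and \<open>p\<^bsub>g,f\<^esub>\<close>. Under this dictionary each axiom of a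
  trinatural transformation becomes one axiom of a 3-pseudofunctor, up to moving inverses to the
  other side: preservation of identities, of composites and of 3-cells is local
  pseudonaturality, 2-naturality of the compositors consists of the two whiskering laws, and
  \<open>\<gamma>\<close>, \<open>\<delta>\<close>, \<open>\<omega>\<close> are the unit laws and associativity. The remaining axioms are automatic.

  One level up, a 2-cell or 3-cell is a pair of cells one level below subject to a condition, so
  that all equations are inherited from the two faces. What remains are the values on 1-cells,
  which are the inverses of the 3-cells \<open>\<sigma>\<^sub>f\<close>, and the membership conditions for the 2-cells,
  the unitors and the compositors, which are the three axioms of a trimodification. Two levels
  up only the condition on 1-cells is left, and this is the axiom of a perturbation.
\<close>


section \<open>Strict 2-categories and the 2-category underlying a Gray-category\<close>

text \<open>The inverses come from orientation. The square of a 2-cell of \<open>path1\<close> over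
  identities points from the left adjoint of its target to that of its source, against
  \<open>trunit\<close> and \<open>trcmp\<close>. Likewise the cell of a 1-cell of
  \<open>path2\<close> runs from the \<open>q\<close> side to the \<open>p\<close> side, against
  \<open>md1\<close>. Coherence and naturality in interchangers are automatic because an
  interchanger of a path object consists of interchangers of \<open>B\<close> on the two components,
  and those components come from strict functors. What is left is agreement of the stored sources
  and targets, which is an equation one dimension lower. The bijections are equalities on the nose.
  Therefore composites of adjoint equivalences must be strictly associative and unital, units and
  counits included. Of the path objects the proof establishes what its equations refer to: closure,
  associativity and units for 1-cells, and strict inverses for 2-cells over identities. Equality of
  two pseudofunctors then follows from extensionality off the carriers and from the fact that a cell
  is determined by its boundary, its components and its square.\<close>

definition invertible3 :: "('f, 'a, 'g, 'm) two_cat_scheme \<Rightarrow> 'g \<Rightarrow> bool" where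
  "invertible3 C \<Gamma> \<longleftrightarrow> (\<exists>\<Delta>. inverse3 C \<Gamma> \<Delta>)"

text \<open>Separates typing from invertibility: boundaries can then be rewritten as equations, and
  invertibility remains a side condition that the simplifier discharges structurally.\<close>

lemma iso3_iff: "iso3 C \<Gamma> u v \<longleftrightarrow> is3 C \<Gamma> u v \<and> invertible3 C \<Gamma>"
  by (simp add: iso3_def invertible3_def)

context two_category
begin

section \<open>The axioms of a 2-category as rewrite rules on sources and targets\<close>

lemma boundary_arrow [simp]:
  assumes "u \<in> C2 C"
  shows "dom2 C u \<in> C1 C" "cod2 C u \<in> C1 C"
  using arrow[OF assms] by auto

text \<open>The common boundary of a 3-cell is always expressed through \<open>dom3\<close>; this
  normal form makes side conditions about parallel cells meet.\<close>

lemma boundary_cell [simp]: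
  assumes "\<Gamma> \<in> C3 C"
  shows "dom3 C \<Gamma> \<in> C2 C" "cod3 C \<Gamma> \<in> C2 C"
    "dom2 C (cod3 C \<Gamma>) = dom2 C (dom3 C \<Gamma>)" "cod2 C (cod3 C \<Gamma>) = cod2 C (dom3 C \<Gamma>)"
  using cell[OF assms] globular[OF assms] by auto

lemma one2_simps [simp]:
  assumes "f \<in> C1 C"
  shows "one2 C f \<in> C2 C" "dom2 C (one2 C f) = f" "cod2 C (one2 C f) = f"
  using one2[OF assms] by (auto simp: is2_def)

lemma one3_simps [simp]:
  assumes "u \<in> C2 C"
  shows "one3 C u \<in> C3 C" "dom3 C (one3 C u) = u" "cod3 C (one3 C u) = u"
  using one3[OF assms] by (auto simp: is3_def)

lemma cmp2_simps [simp]: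
  assumes "u \<in> C2 C" "v \<in> C2 C" "cod2 C u = dom2 C v"
  shows "v \<odot> u \<in> C2 C" "dom2 C (v \<odot> u) = dom2 C u" "cod2 C (v \<odot> u) = cod2 C v"
  using cmp2[of u "dom2 C u" "cod2 C u" v "cod2 C v"] assms by (auto simp: is2_def)

lemma vcmp3_simps [simp]:
  assumes "\<Gamma> \<in> C3 C" "\<Delta> \<in> C3 C" "cod3 C \<Gamma> = dom3 C \<Delta>"
  shows "\<Delta> \<cdot> \<Gamma> \<in> C3 C" "dom3 C (\<Delta> \<cdot> \<Gamma>) = dom3 C \<Gamma>" "cod3 C (\<Delta> \<cdot> \<Gamma>) = cod3 C \<Delta>"
  using vcmp3[of \<Gamma> "dom3 C \<Gamma>" "cod3 C \<Gamma>" \<Delta> "cod3 C \<Delta>"] assms by (auto simp: is3_def)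

lemma hcmp3_simps [simp]:
  assumes "\<Gamma> \<in> C3 C" "\<Delta> \<in> C3 C" "cod2 C (dom3 C \<Gamma>) = dom2 C (dom3 C \<Delta>)"
  shows "\<Delta> \<star> \<Gamma> \<in> C3 C" "dom3 C (\<Delta> \<star> \<Gamma>) = dom3 C \<Delta> \<odot> dom3 C \<Gamma>"
    "cod3 C (\<Delta> \<star> \<Gamma>) = cod3 C \<Delta> \<odot> cod3 C \<Gamma>"
  using hcmp3[of \<Gamma> "dom3 C \<Gamma>" "cod3 C \<Gamma>" \<Delta> "dom3 C \<Delta>" "cod3 C \<Delta>"] assms by (auto simp: is3_def)

lemma cmp2_assoc_simp [simp]:
  assumes "u \<in> C2 C" "v \<in> C2 C" "w \<in> C2 C" "cod2 C u = dom2 C v" "cod2 C v = dom2 C w"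
  shows "(w \<odot> v) \<odot> u = w \<odot> (v \<odot> u)"
  using cmp2_assoc[of u "dom2 C u" "cod2 C u" v "cod2 C v" w "cod2 C w"] assms
  by (auto simp: is2_def)

text \<open>The 1-cell under the identity is a variable tied down by a side condition, so the rule
  also fires when it agrees with the boundary only after rewriting. The later unit rules have the
  same shape.\<close>

lemma cmp2_one_simps [simp]:
  assumes "u \<in> C2 C"
  shows "dom2 C u = f \<Longrightarrow> u \<odot> one2 C f = u" "cod2 C u = g \<Longrightarrow> one2 C g \<odot> u = u"
  using cmp2_one[of u "dom2 C u" "cod2 C u"] assms by (auto simp: is2_def)

lemma vcmp3_assoc_simp [simp]:
  assumes "\<Gamma> \<in> C3 C" "\<Delta> \<in> C3 C" "\<Theta> \<in> C3 C" "cod3 C \<Gamma> = dom3 C \<Delta>" "cod3 C \<Delta> = dom3 C \<Theta>"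
  shows "(\<Theta> \<cdot> \<Delta>) \<cdot> \<Gamma> = \<Theta> \<cdot> (\<Delta> \<cdot> \<Gamma>)"
  using vcmp3_assoc[of \<Gamma> "dom3 C \<Gamma>" "cod3 C \<Gamma>" \<Delta> "cod3 C \<Delta>" \<Theta> "cod3 C \<Theta>"] assms
  by (auto simp: is3_def)

lemma vcmp3_one_simps [simp]:
  assumes "\<Gamma> \<in> C3 C"
  shows "dom3 C \<Gamma> = u \<Longrightarrow> \<Gamma> \<cdot> one3 C u = \<Gamma>" "cod3 C \<Gamma> = v \<Longrightarrow> one3 C v \<cdot> \<Gamma> = \<Gamma>"
  using vcmp3_one[of \<Gamma> "dom3 C \<Gamma>" "cod3 C \<Gamma>"] assms by (auto simp: is3_def)

lemma hcmp3_assoc_simp [simp]: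
  assumes "\<Gamma> \<in> C3 C" "\<Delta> \<in> C3 C" "\<Theta> \<in> C3 C"
    "cod2 C (dom3 C \<Gamma>) = dom2 C (dom3 C \<Delta>)" "cod2 C (dom3 C \<Delta>) = dom2 C (dom3 C \<Theta>)"
  shows "(\<Theta> \<star> \<Delta>) \<star> \<Gamma> = \<Theta> \<star> (\<Delta> \<star> \<Gamma>)"
  using hcmp3_assoc[of \<Gamma> "dom3 C \<Gamma>" "cod3 C \<Gamma>" \<Delta> "dom3 C \<Delta>" "cod3 C \<Delta>" \<Theta> "dom3 C \<Theta>" "cod3 C \<Theta>"]
    assms
  by (auto simp: is3_def)

lemma hcmp3_one_simps [simp]:
  assumes "\<Gamma> \<in> C3 C"
  shows "dom2 C (dom3 C \<Gamma>) = f \<Longrightarrow> \<Gamma> \<star> one3 C (one2 C f) = \<Gamma>"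
    "cod2 C (dom3 C \<Gamma>) = g \<Longrightarrow> one3 C (one2 C g) \<star> \<Gamma> = \<Gamma>"
  using hcmp3_one[of \<Gamma> "dom3 C \<Gamma>" "cod3 C \<Gamma>" "dom2 C (dom3 C \<Gamma>)" "cod2 C (dom3 C \<Gamma>)"] assms
  by (auto simp: is2_def is3_def)

lemma hcmp3_one3_simp [simp]:
  assumes "u \<in> C2 C" "v \<in> C2 C" "cod2 C u = dom2 C v"
  shows "one3 C v \<star> one3 C u = one3 C (v \<odot> u)"
  using hcmp3_one3[of u "dom2 C u" "cod2 C u" v "cod2 C v"] assms by (auto simp: is2_def)

text \<open>Bracketing horizontal composites to the right separates two consecutive left whiskers;
  this rule merges them again.\<close>

lemma lwhisk_lwhisk [simp]:
  assumes "\<Gamma> \<in> C3 C" "u \<in> C2 C" "v \<in> C2 C" "cod2 C (dom3 C \<Gamma>) = dom2 C u" "cod2 C u = dom2 C v"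
  shows "one3 C v \<star> (one3 C u \<star> \<Gamma>) = one3 C (v \<odot> u) \<star> \<Gamma>"
  using hcmp3_assoc_simp[of \<Gamma> "one3 C u" "one3 C v"] assms by simp

text \<open>Oriented against the distributivity of whiskering over \<open>vcmp3\<close> below, hence
  kept out of the simp set.\<close>

lemma interchange_simp:
  assumes "\<Gamma> \<in> C3 C" "\<Gamma>' \<in> C3 C" "\<Delta> \<in> C3 C" "\<Delta>' \<in> C3 C" "cod3 C \<Gamma> = dom3 C \<Gamma>'"
    "cod3 C \<Delta> = dom3 C \<Delta>'" "cod2 C (dom3 C \<Gamma>) = dom2 C (dom3 C \<Delta>)"
  shows "(\<Delta>' \<star> \<Gamma>') \<cdot> (\<Delta> \<star> \<Gamma>) = (\<Delta>' \<cdot> \<Delta>) \<star> (\<Gamma>' \<cdot> \<Gamma>)"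
  using interchange[of \<Gamma> "dom3 C \<Gamma>" "cod3 C \<Gamma>" \<Gamma>' "cod3 C \<Gamma>'" \<Delta> "dom3 C \<Delta>" "cod3 C \<Delta>" \<Delta>'
    "cod3 C \<Delta>'"]
    assms by (auto simp: is3_def)

lemma lwhisk_vcmp3 [simp]:
  assumes "\<Gamma> \<in> C3 C" "\<Delta> \<in> C3 C" "v \<in> C2 C" "cod3 C \<Gamma> = dom3 C \<Delta>" "cod2 C (dom3 C \<Gamma>) = dom2 C v"
  shows "v \<odot>\<rhd> (\<Delta> \<cdot> \<Gamma>) = (v \<odot>\<rhd> \<Delta>) \<cdot> (v \<odot>\<rhd> \<Gamma>)"
  using interchange_simp[of \<Gamma> \<Delta> "one3 C v" "one3 C v"] assms by simp

lemma rwhisk_vcmp3 [simp]: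
  assumes "\<Gamma> \<in> C3 C" "\<Delta> \<in> C3 C" "v \<in> C2 C" "cod3 C \<Gamma> = dom3 C \<Delta>" "cod2 C v = dom2 C (dom3 C \<Gamma>)"
  shows "(\<Delta> \<cdot> \<Gamma>) \<lhd>\<odot> v = (\<Delta> \<lhd>\<odot> v) \<cdot> (\<Gamma> \<lhd>\<odot> v)"
  using interchange_simp[of "one3 C v" "one3 C v" \<Gamma> \<Delta>] assms by simp

lemma hcmp3_eq_right_first:
  assumes "\<Gamma> \<in> C3 C" "\<Delta> \<in> C3 C" "cod2 C (dom3 C \<Gamma>) = dom2 C (dom3 C \<Delta>)"
  shows "(\<Delta> \<lhd>\<odot> cod3 C \<Gamma>) \<cdot> (dom3 C \<Delta> \<odot>\<rhd> \<Gamma>) = \<Delta> \<star> \<Gamma>"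
  using interchange_simp[of \<Gamma> "one3 C (cod3 C \<Gamma>)" "one3 C (dom3 C \<Delta>)" \<Delta>] assms by simp

lemma hcmp3_eq_left_first:
  assumes "\<Gamma> \<in> C3 C" "\<Delta> \<in> C3 C" "cod2 C (dom3 C \<Gamma>) = dom2 C (dom3 C \<Delta>)"
  shows "(cod3 C \<Delta> \<odot>\<rhd> \<Gamma>) \<cdot> (\<Delta> \<lhd>\<odot> dom3 C \<Gamma>) = \<Delta> \<star> \<Gamma>"
  using interchange_simp[of "one3 C (dom3 C \<Gamma>)" \<Gamma> \<Delta> "one3 C (cod3 C \<Delta>)"] assms by simp

text \<open>Both sides are the horizontal composite \<open>\<Delta> \<star> \<Gamma>\<close>.
  Distributivity of whiskers does not relate them, so this exchange is instantiated by hand; the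
  boundaries are variables in order to match their simplified forms.\<close>

lemma whisker_exchange:
  assumes "\<Gamma> \<in> C3 C" "\<Delta> \<in> C3 C" "cod2 C (dom3 C \<Gamma>) = dom2 C (dom3 C \<Delta>)"
    "dom3 C \<Gamma> = u" "cod3 C \<Gamma> = u'" "dom3 C \<Delta> = v" "cod3 C \<Delta> = v'"
  shows "(\<Delta> \<lhd>\<odot> u') \<cdot> (v \<odot>\<rhd> \<Gamma>) = (v' \<odot>\<rhd> \<Gamma>) \<cdot> (\<Delta> \<lhd>\<odot> u)"
  using hcmp3_eq_right_first[of \<Gamma> \<Delta>] hcmp3_eq_left_first[of \<Gamma> \<Delta>] assms by simp

section \<open>Inverses of 3-cells\<close>

lemma inverse3_unique:
  assumes "inverse3 C \<Gamma> \<Delta>" "inverse3 C \<Gamma> \<Delta>'"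
  shows "\<Delta>' = \<Delta>"
proof -
  have "\<Delta>' = (\<Delta> \<cdot> \<Gamma>) \<cdot> \<Delta>'" using assms by (simp add: inverse3_def is3_def)
  also have "\<dots> = \<Delta> \<cdot> (\<Gamma> \<cdot> \<Delta>')"
    by (rule vcmp3_assoc_simp) (use assms in \<open>auto simp: inverse3_def is3_def\<close>)
  also have "\<dots> = \<Delta>" using assms by (simp add: inverse3_def is3_def)
  finally show ?thesis .
qed

lemma inv3_eqI: "inverse3 C \<Gamma> \<Delta> \<Longrightarrow> inv3 C \<Gamma> = \<Delta>"
  unfolding inv3_def by (rule the_equality) (auto dest: inverse3_unique)

lemma inverse3_inv3: "invertible3 C \<Gamma> \<Longrightarrow> inverse3 C \<Gamma> (inv3 C \<Gamma>)"
  unfolding invertible3_def using inv3_eqI by auto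

lemma invertible3_C3: "invertible3 C \<Gamma> \<Longrightarrow> \<Gamma> \<in> C3 C"
  by (auto simp: invertible3_def inverse3_def)

lemma inv3_simps [simp]:
  assumes "invertible3 C \<Gamma>"
  shows "inv3 C \<Gamma> \<in> C3 C" "dom3 C (inv3 C \<Gamma>) = cod3 C \<Gamma>" "cod3 C (inv3 C \<Gamma>) = dom3 C \<Gamma>"
    "cod3 C \<Gamma> = u \<Longrightarrow> \<Gamma> \<cdot> inv3 C \<Gamma> = one3 C u" "dom3 C \<Gamma> = v \<Longrightarrow> inv3 C \<Gamma> \<cdot> \<Gamma> = one3 C v"
  using inverse3_inv3[OF assms] by (auto simp: inverse3_def is3_def)

text \<open>Cancellation in the interior of a vertical composite bracketed to the right, where the
  plain inverse laws do not match.\<close>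

lemma inv3_cancel [simp]:
  assumes "invertible3 C \<Gamma>" "\<Delta> \<in> C3 C"
  shows "cod3 C \<Delta> = cod3 C \<Gamma> \<Longrightarrow> \<Gamma> \<cdot> (inv3 C \<Gamma> \<cdot> \<Delta>) = \<Delta>"
    "cod3 C \<Delta> = dom3 C \<Gamma> \<Longrightarrow> inv3 C \<Gamma> \<cdot> (\<Gamma> \<cdot> \<Delta>) = \<Delta>"
proof -
  note [simp] = invertible3_C3[OF assms(1)] assms
  show "\<Gamma> \<cdot> (inv3 C \<Gamma> \<cdot> \<Delta>) = \<Delta>" if [simp]: "cod3 C \<Delta> = cod3 C \<Gamma>"
    by (subst vcmp3_assoc_simp[symmetric]) simp_all
  show "inv3 C \<Gamma> \<cdot> (\<Gamma> \<cdot> \<Delta>) = \<Delta>" if [simp]: "cod3 C \<Delta> = dom3 C \<Gamma>"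
    by (subst vcmp3_assoc_simp[symmetric]) simp_all
qed

lemma inverse3I:
  assumes "\<Gamma> \<in> C3 C" "\<Delta> \<in> C3 C" "dom3 C \<Delta> = cod3 C \<Gamma>" "cod3 C \<Delta> = dom3 C \<Gamma>"
    "\<Delta> \<cdot> \<Gamma> = one3 C (dom3 C \<Gamma>)" "\<Gamma> \<cdot> \<Delta> = one3 C (cod3 C \<Gamma>)"
  shows "inverse3 C \<Gamma> \<Delta>"
  using assms by (simp add: inverse3_def is3_def)

lemma invertible3I: "inverse3 C \<Gamma> \<Delta> \<Longrightarrow> invertible3 C \<Gamma>"
  by (auto simp: invertible3_def)

lemma inverse3_inverse: "invertible3 C \<Gamma> \<Longrightarrow> inverse3 C (inv3 C \<Gamma>) \<Gamma>"
  by (rule inverse3I) (auto simp: invertible3_C3)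

lemma invertible3_inv3 [simp]: "invertible3 C \<Gamma> \<Longrightarrow> invertible3 C (inv3 C \<Gamma>)"
  by (blast intro: invertible3I inverse3_inverse)

lemma inv3_inv3 [simp]: "invertible3 C \<Gamma> \<Longrightarrow> inv3 C (inv3 C \<Gamma>) = \<Gamma>"
  by (blast intro: inv3_eqI inverse3_inverse)

lemma inverse3_one3: "u \<in> C2 C \<Longrightarrow> inverse3 C (one3 C u) (one3 C u)"
  by (rule inverse3I) auto

lemma inverse3_vcmp3:
  assumes "invertible3 C \<Gamma>" "invertible3 C \<Delta>" "cod3 C \<Gamma> = dom3 C \<Delta>"
  shows "inverse3 C (\<Delta> \<cdot> \<Gamma>) (inv3 C \<Gamma> \<cdot> inv3 C \<Delta>)"
  using assms by (intro inverse3I) (auto simp: invertible3_C3)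

lemma inverse3_hcmp3:
  assumes "invertible3 C \<Gamma>" "invertible3 C \<Delta>" "cod2 C (dom3 C \<Gamma>) = dom2 C (dom3 C \<Delta>)"
  shows "inverse3 C (\<Delta> \<star> \<Gamma>) (inv3 C \<Delta> \<star> inv3 C \<Gamma>)"
  using assms by (intro inverse3I) (auto simp: invertible3_C3 interchange_simp)

lemma invertible3_intros [simp]:
  "u \<in> C2 C \<Longrightarrow> invertible3 C (one3 C u)"
  "\<lbrakk>invertible3 C \<Gamma>; invertible3 C \<Delta>; cod3 C \<Gamma> = dom3 C \<Delta>\<rbrakk> \<Longrightarrow> invertible3 C (\<Delta> \<cdot> \<Gamma>)"
  "\<lbrakk>invertible3 C \<Gamma>; invertible3 C \<Delta>; cod2 C (dom3 C \<Gamma>) = dom2 C (dom3 C \<Delta>)\<rbrakk>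
    \<Longrightarrow> invertible3 C (\<Delta> \<star> \<Gamma>)"
  by (blast intro: invertible3I inverse3_one3 inverse3_vcmp3 inverse3_hcmp3)+

lemma inv3_distribs [simp]:
  "u \<in> C2 C \<Longrightarrow> inv3 C (one3 C u) = one3 C u"
  "\<lbrakk>invertible3 C \<Gamma>; invertible3 C \<Delta>; cod3 C \<Gamma> = dom3 C \<Delta>\<rbrakk> \<Longrightarrow> inv3 C (\<Delta> \<cdot> \<Gamma>) = inv3 C \<Gamma> \<cdot> inv3 C \<Delta>"
  "\<lbrakk>invertible3 C \<Gamma>; invertible3 C \<Delta>; cod2 C (dom3 C \<Gamma>) = dom2 C (dom3 C \<Delta>)\<rbrakk>
    \<Longrightarrow> inv3 C (\<Delta> \<star> \<Gamma>) = inv3 C \<Delta> \<star> inv3 C \<Gamma>"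
  by (blast intro: inv3_eqI inverse3_one3 inverse3_vcmp3 inverse3_hcmp3)+

text \<open>Compose with the inverse of \<open>\<Delta>\<close> on the left and of
  \<open>\<Gamma>\<close> on the right. This carries an axiom with a structure cell at each end into
  the corresponding equation for the inverses.\<close>

lemma inv3_flip:
  assumes "invertible3 C \<Gamma>" "invertible3 C \<Delta>" "\<Phi> \<in> C3 C" "\<Psi> \<in> C3 C"
    "dom3 C \<Phi> = cod3 C \<Gamma>" "cod3 C \<Phi> = cod3 C \<Delta>" "dom3 C \<Psi> = dom3 C \<Gamma>" "cod3 C \<Psi> = dom3 C \<Delta>"
  shows "\<Phi> \<cdot> \<Gamma> = \<Delta> \<cdot> \<Psi> \<longleftrightarrow> inv3 C \<Delta> \<cdot> \<Phi> = \<Psi> \<cdot> inv3 C \<Gamma>"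
proof
  note [simp] = invertible3_C3[OF assms(1)] invertible3_C3[OF assms(2)]
  assume *: "\<Phi> \<cdot> \<Gamma> = \<Delta> \<cdot> \<Psi>"
  have "inv3 C \<Delta> \<cdot> \<Phi> = inv3 C \<Delta> \<cdot> ((\<Phi> \<cdot> \<Gamma>) \<cdot> inv3 C \<Gamma>)" using assms by simp
  also have "\<dots> = \<Psi> \<cdot> inv3 C \<Gamma>" unfolding * using assms by simp
  finally show "inv3 C \<Delta> \<cdot> \<Phi> = \<Psi> \<cdot> inv3 C \<Gamma>" .
next
  note [simp] = invertible3_C3[OF assms(1)] invertible3_C3[OF assms(2)]
  assume *: "inv3 C \<Delta> \<cdot> \<Phi> = \<Psi> \<cdot> inv3 C \<Gamma>"
  have "\<Phi> \<cdot> \<Gamma> = \<Delta> \<cdot> ((inv3 C \<Delta> \<cdot> \<Phi>) \<cdot> \<Gamma>)" using assms by simp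
  also have "\<dots> = \<Delta> \<cdot> \<Psi>" unfolding * using assms by simp
  finally show "\<Phi> \<cdot> \<Gamma> = \<Delta> \<cdot> \<Psi>" .
qed

text \<open>Used when every cell of an equation is invertible: inverting both sides then reverses
  all vertical composites at once.\<close>

lemma inv3_inject:
  assumes "invertible3 C \<Gamma>" "invertible3 C \<Delta>"
  shows "inv3 C \<Gamma> = inv3 C \<Delta> \<longleftrightarrow> \<Gamma> = \<Delta>"
  by (metis assms inv3_inv3)

section \<open>Adjoint equivalences and their composition\<close>

lemma adj_equiv_iff: "adj_equiv C e f g \<longleftrightarrow>
    lft e \<in> C2 C \<and> dom2 C (lft e) = f \<and> cod2 C (lft e) = g \<and>
    rgt e \<in> C2 C \<and> dom2 C (rgt e) = g \<and> cod2 C (rgt e) = f \<and>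
    invertible3 C (unt e) \<and> unt e \<in> C3 C \<and> dom3 C (unt e) = one2 C f \<and> cod3 C (unt e) = rgt e \<odot> lft
    e \<and>
    invertible3 C (cnt e) \<and> cnt e \<in> C3 C \<and> dom3 C (cnt e) = lft e \<odot> rgt e \<and> cod3 C (cnt e) = one2 C
    g \<and>
    (cnt e \<lhd>\<odot> lft e) \<cdot> (lft e \<odot>\<rhd> unt e) = one3 C (lft e) \<and>
    (rgt e \<odot>\<rhd> cnt e) \<cdot> (unt e \<lhd>\<odot> rgt e) = one3 C (rgt e)"
  unfolding adj_equiv_def iso3_iff is2_def is3_def by auto

lemma adj_equiv_one_adj:
  assumes "f \<in> C1 C" shows "adj_equiv C (one_adj C f) f f"
  using assms by (simp add: adj_equiv_iff one_adj_def)

text \<open>In each triangle of the composite the counit of \<open>e\<close> meets the unit of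
  \<open>e'\<close>. Once these two are exchanged, the composite factors into a whiskered triangle
  of \<open>e'\<close> and a whiskered triangle of \<open>e\<close>.\<close>

lemma adj_equiv_cmp_adj:
  assumes "adj_equiv C e f g" "adj_equiv C e' g h"
  shows "adj_equiv C (cmp_adj C e' e) f h"
proof -
  obtain l r \<eta> \<epsilon> where e: "e = Adj l r \<eta> \<epsilon>" by (cases e)
  obtain l' r' \<eta>' \<epsilon>' where e': "e' = Adj l' r' \<eta>' \<epsilon>'" by (cases e')
  from assms(1) have E [simp]: "l \<in> C2 C" "dom2 C l = f" "cod2 C l = g" "r \<in> C2 C" "dom2 C r = g"
      "cod2 C r = f"
    "invertible3 C \<eta>" "\<eta> \<in> C3 C" "dom3 C \<eta> = one2 C f" "cod3 C \<eta> = r \<odot> l"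
    "invertible3 C \<epsilon>" "\<epsilon> \<in> C3 C" "dom3 C \<epsilon> = l \<odot> r" "cod3 C \<epsilon> = one2 C g"
    and t1: "(\<epsilon> \<lhd>\<odot> l) \<cdot> (l \<odot>\<rhd> \<eta>) = one3 C l" and t2: "(r \<odot>\<rhd> \<epsilon>) \<cdot> (\<eta> \<lhd>\<odot> r) = one3 C r"
    by (simp_all add: adj_equiv_iff e)
  from assms(2) have E' [simp]: "l' \<in> C2 C" "dom2 C l' = g" "cod2 C l' = h" "r' \<in> C2 C"
      "dom2 C r' = h" "cod2 C r' = g"
    "invertible3 C \<eta>'" "\<eta>' \<in> C3 C" "dom3 C \<eta>' = one2 C g" "cod3 C \<eta>' = r' \<odot> l'"
    "invertible3 C \<epsilon>'" "\<epsilon>' \<in> C3 C" "dom3 C \<epsilon>' = l' \<odot> r'" "cod3 C \<epsilon>' = one2 C h"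
    and t1': "(\<epsilon>' \<lhd>\<odot> l') \<cdot> (l' \<odot>\<rhd> \<eta>') = one3 C l'" and t2': "(r' \<odot>\<rhd> \<epsilon>') \<cdot> (\<eta>' \<lhd>\<odot> r') = one3 C r'"
    by (simp_all add: adj_equiv_iff e')
  have [simp]: "f \<in> C1 C" "g \<in> C1 C" "h \<in> C1 C"
    using boundary_arrow[OF E(1)] boundary_arrow[OF E'(1)] by simp_all
  \<comment> \<open>Both exchanges collapse to \<open>\<eta>' \<cdot> \<epsilon>\<close>, because
    the counit ends and the unit starts at the identity of \<open>g\<close>.\<close>
  have x: "(\<epsilon> \<lhd>\<odot> (r' \<odot> l')) \<cdot> ((l \<odot> r) \<odot>\<rhd> \<eta>') = \<eta>' \<cdot> \<epsilon>"
    using whisker_exchange[of \<eta>' \<epsilon> "one2 C g" "r' \<odot> l'" "l \<odot> r" "one2 C g"] by simp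
  have y: "((r' \<odot> l') \<odot>\<rhd> \<epsilon>) \<cdot> (\<eta>' \<lhd>\<odot> (l \<odot> r)) = \<eta>' \<cdot> \<epsilon>"
    using whisker_exchange[of \<epsilon> \<eta>' "l \<odot> r" "one2 C g" "one2 C g" "r' \<odot> l'"] by simp
  have "((l' \<odot>\<rhd> \<epsilon> \<lhd>\<odot> (r' \<odot> l' \<odot> l)) \<cdot> ((l' \<odot> l \<odot> r) \<odot>\<rhd> \<eta>' \<lhd>\<odot> l)) =
      l' \<odot>\<rhd> (((\<epsilon> \<lhd>\<odot> (r' \<odot> l')) \<cdot> ((l \<odot> r) \<odot>\<rhd> \<eta>')) \<lhd>\<odot> l)"
    by simp
  also have "\<dots> = (l' \<odot>\<rhd> \<eta>' \<lhd>\<odot> l) \<cdot> (l' \<odot>\<rhd> \<epsilon> \<lhd>\<odot> l)" unfolding x by simp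
  finally have 1: "((l' \<odot>\<rhd> \<epsilon> \<lhd>\<odot> (r' \<odot> l' \<odot> l)) \<cdot> ((l' \<odot> l \<odot> r) \<odot>\<rhd> \<eta>' \<lhd>\<odot> l)) = \<dots>" .
  have "(\<epsilon>' \<lhd>\<odot> (l' \<odot> l)) \<cdot> (((l' \<odot>\<rhd> \<epsilon> \<lhd>\<odot> (r' \<odot> l' \<odot> l)) \<cdot> ((l' \<odot> l \<odot> r) \<odot>\<rhd> \<eta>' \<lhd>\<odot> l))
      \<cdot> ((l' \<odot> l) \<odot>\<rhd> \<eta>))
      = (((\<epsilon>' \<lhd>\<odot> l') \<cdot> (l' \<odot>\<rhd> \<eta>')) \<lhd>\<odot> l) \<cdot> (l' \<odot>\<rhd> ((\<epsilon> \<lhd>\<odot> l) \<cdot> (l \<odot>\<rhd> \<eta>)))"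
    unfolding 1 by simp
  also have "\<dots> = one3 C (l' \<odot> l)" unfolding t1 t1' by simp
  finally have A: "(\<epsilon>' \<lhd>\<odot> (l' \<odot> l)) \<cdot> (((l' \<odot>\<rhd> \<epsilon> \<lhd>\<odot> (r' \<odot> l' \<odot> l)) \<cdot> ((l' \<odot> l \<odot> r) \<odot>\<rhd> \<eta>' \<lhd>\<odot> l))
      \<cdot> ((l' \<odot> l) \<odot>\<rhd> \<eta>)) = \<dots>" .
  have "((r \<odot> r' \<odot> l') \<odot>\<rhd> \<epsilon> \<lhd>\<odot> r') \<cdot> (r \<odot>\<rhd> \<eta>' \<lhd>\<odot> (l \<odot> r \<odot> r')) =
      r \<odot>\<rhd> ((((r' \<odot> l') \<odot>\<rhd> \<epsilon>) \<cdot> (\<eta>' \<lhd>\<odot> (l \<odot> r))) \<lhd>\<odot> r')"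
    by simp
  also have "\<dots> = (r \<odot>\<rhd> \<eta>' \<lhd>\<odot> r') \<cdot> (r \<odot>\<rhd> \<epsilon> \<lhd>\<odot> r')" unfolding y by simp
  finally have 2: "((r \<odot> r' \<odot> l') \<odot>\<rhd> \<epsilon> \<lhd>\<odot> r') \<cdot> (r \<odot>\<rhd> \<eta>' \<lhd>\<odot> (l \<odot> r \<odot> r')) = \<dots>" .
  have "((r \<odot> r') \<odot>\<rhd> \<epsilon>') \<cdot> ((((r \<odot> r' \<odot> l') \<odot>\<rhd> \<epsilon> \<lhd>\<odot> r') \<cdot> (r \<odot>\<rhd> \<eta>' \<lhd>\<odot> (l \<odot> r \<odot> r')))
      \<cdot> (\<eta> \<lhd>\<odot> (r \<odot> r')))
      = (r \<odot>\<rhd> ((r' \<odot>\<rhd> \<epsilon>') \<cdot> (\<eta>' \<lhd>\<odot> r'))) \<cdot> (((r \<odot>\<rhd> \<epsilon>) \<cdot> (\<eta> \<lhd>\<odot> r)) \<lhd>\<odot> r')"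
    unfolding 2 by simp
  also have "\<dots> = one3 C (r \<odot> r')" unfolding t2 t2' by simp
  finally have B: "((r \<odot> r') \<odot>\<rhd> \<epsilon>') \<cdot> ((((r \<odot> r' \<odot> l') \<odot>\<rhd> \<epsilon> \<lhd>\<odot> r') \<cdot> (r \<odot>\<rhd> \<eta>' \<lhd>\<odot> (l \<odot> r \<odot> r')))
      \<cdot> (\<eta> \<lhd>\<odot> (r \<odot> r'))) = \<dots>" .
  show ?thesis
    using A B by (simp add: adj_equiv_iff e e' cmp_adj_def)
qed

text \<open>Equality of the units and counits, not just of the adjoints; strict associativity of
  1-cells of the path object depends on it.\<close>

lemma cmp_adj_assoc:
  assumes "adj_equiv C e f g" "adj_equiv C e' g h" "adj_equiv C e'' h k"
  shows "cmp_adj C (cmp_adj C e'' e') e = cmp_adj C e'' (cmp_adj C e' e)"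
  using assms by (cases e; cases e'; cases e'') (auto simp: adj_equiv_iff cmp_adj_def)

lemma cmp_adj_one:
  assumes "adj_equiv C e f g"
  shows "cmp_adj C e (one_adj C f) = e" "cmp_adj C (one_adj C g) e = e"
  using assms by (cases e, auto simp: adj_equiv_iff cmp_adj_def one_adj_def)+

end

section \<open>Hom-2-categories and their union\<close>

lemma hom_sel [simp]:
  "f \<in> C1 (hom A X Y) \<longleftrightarrow> is1 A f X Y"
  "u \<in> C2 (hom A X Y) \<longleftrightarrow> u \<in> C2 A \<and> is1 A (dom2 A u) X Y \<and> is1 A (cod2 A u) X Y"
  "\<Gamma> \<in> C3 (hom A X Y) \<longleftrightarrow>
    \<Gamma> \<in> C3 A \<and> is1 A (dom2 A (dom3 A \<Gamma>)) X Y \<and> is1 A (cod2 A (dom3 A \<Gamma>)) X Y"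
  "dom2 (hom A X Y) = dom2 A" "cod2 (hom A X Y) = cod2 A" "dom3 (hom A X Y) = dom3 A"
  "cod3 (hom A X Y) = cod3 A" "one2 (hom A X Y) = one2 A" "one3 (hom A X Y) = one3 A"
  "cmp2 (hom A X Y) = cmp2 A" "hcmp3 (hom A X Y) = hcmp3 A" "vcmp3 (hom A X Y) = vcmp3 A"
  by (auto simp: hom_def is1_def)

lemma cmp_bifun_sel [simp]:
  "bf1 (cmp_bifun A) = cmp1 A" "bf2l (cmp_bifun A) = rwh2 A" "bf2r (cmp_bifun A) = lwh2 A"
  "bf3l (cmp_bifun A) = rwh3 A" "bf3r (cmp_bifun A) = lwh3 A" "bfich (cmp_bifun A) = ich A"
  by (simp_all add: cmp_bifun_def)

lemma is2_hom [simp]: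
  "is2 (hom A X Y) u f g \<longleftrightarrow> is2 A u f g \<and> is1 A f X Y \<and> is1 A g X Y"
  by (auto simp: is2_def)

lemma is3_hom [simp]:
  "is3 (hom A X Y) \<Gamma> u v \<longleftrightarrow> is3 A \<Gamma> u v \<and> is1 A (dom2 A u) X Y \<and> is1 A (cod2 A u) X Y"
  by (auto simp: is3_def)

context gray_category
begin

lemma boundary_obj [simp]:
  assumes "f \<in> C1 A"
  shows "dom1 A f \<in> C0 A" "cod1 A f \<in> C0 A"
  using boundary1[OF assms] by auto

lemma boundary_two [simp]:
  assumes "u \<in> C2 A"
  shows "dom1 A (cod2 A u) = dom1 A (dom2 A u)" "cod1 A (cod2 A u) = cod1 A (dom2 A u)"
  using boundary2[OF assms] by auto

lemma boundary_two' :
  assumes "u \<in> C2 A"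
  shows "dom2 A u \<in> C1 A" "cod2 A u \<in> C1 A"
  using boundary2[OF assms] by auto

lemma hom2_cat:
  "f \<in> C1 A \<Longrightarrow> two_category (hom A (dom1 A f) (cod1 A f))"
  by (rule hom_two_category) auto

lemma is1_self: "f \<in> C1 A \<Longrightarrow> is1 A f (dom1 A f) (cod1 A f)"
  by (simp add: is1_def)

lemma is2_is1: "is2 A u f g \<Longrightarrow> is1 A f (dom1 A f) (cod1 A f) \<and> is1 A g (dom1 A f) (cod1 A f)"
  using boundary_two' boundary_two by (auto simp: is1_def is2_def)

text \<open>The Gray-category axioms place the boundary of a 3-cell in \<open>C2\<close>; that the
  two 2-cells are parallel is globularity of the hom that contains the cell.\<close>

lemma is3_is2: "is3 A \<Gamma> u v \<Longrightarrow> is2 A u (dom2 A u) (cod2 A u) \<and> is2 A v (dom2 A u) (cod2 A u)"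
proof -
  assume a: "is3 A \<Gamma> u v"
  define X Y where "X = dom1 A (dom2 A u)" and "Y = cod1 A (dom2 A u)"
  have u: "u \<in> C2 A" "v \<in> C2 A" using a boundary3 by (auto simp: is3_def)
  interpret h: two_category "hom A X Y" using hom2_cat[of "dom2 A u"] u boundary_two'
by (simp add: X_def Y_def)
  have "\<Gamma> \<in> C3 (hom A X Y)" using a u boundary_two' by (auto simp: is3_def is1_def X_def Y_def)
  from h.boundary_cell(3,4)[OF this] a u show ?thesis by (auto simp: is2_def is3_def)
qed

text \<open>
  The homs are disjoint, so their union is again a 2-category. Hence equations between 3-cells
  can be proved without mentioning the homs.
\<close>

lemma hom2_cat2: "is2 A u f g \<Longrightarrow> two_category (hom A (dom1 A f) (cod1 A f))"
  using is2_is1[of u f g] hom2_cat[of f] by (simp add: is1_def)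

lemma hom2_cat3: "is3 A \<Gamma> u v \<Longrightarrow> two_category (hom A (dom1 A (dom2 A u)) (cod1 A (dom2 A u)))"
  using is3_is2[of \<Gamma> u v] hom2_cat2[of u] by blast

lemma is3_is1: "is3 A \<Gamma> u v \<Longrightarrow> is2 A u (dom2 A u) (cod2 A u) \<and> is2 A v (dom2 A u) (cod2 A u) \<and>
    is1 A (dom2 A u) (dom1 A (dom2 A u)) (cod1 A (dom2 A u)) \<and>
    is1 A (cod2 A u) (dom1 A (dom2 A u)) (cod1 A (dom2 A u))"
  using is3_is2[of \<Gamma> u v] is2_is1[of u "dom2 A u" "cod2 A u"] by blast

sublocale two_category A
  apply unfold_locales
  subgoal by (simp add: boundary2)
  subgoal by (simp add: boundary3)
  subgoal for \<Gamma>
    using is3_is2[of \<Gamma> "dom3 A \<Gamma>" "cod3 A \<Gamma>"] by (simp add: is2_def is3_def)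
  subgoal for f
    using two_category.one2[OF hom2_cat[of f], of f] by (simp add: is1_self)
  subgoal for u
    using two_category.one3[OF hom2_cat2[of u "dom2 A u" "cod2 A u"], of u]
      is2_is1[of u "dom2 A u" "cod2 A u"] by (simp add: is2_def)
  subgoal for u f g v h
    using two_category.cmp2[OF hom2_cat2[of u f g], of u f g v h] is2_is1[of u f g]
      is2_is1[of v g h]
    by (simp add: is1_def)
  subgoal for \<Gamma> u v \<Delta> w
    using two_category.vcmp3[OF hom2_cat3[of \<Gamma> u v], of \<Gamma> u v \<Delta> w] is3_is1[of \<Gamma> u v]
    by (simp add: is2_def)
  subgoal for \<Gamma> u u' \<Delta> v v'
    using two_category.hcmp3[OF hom2_cat3[of \<Gamma> u u'], of \<Gamma> u u' \<Delta> v v'] is3_is1[of \<Gamma> u u']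
      is3_is1[of \<Delta> v v'] by (simp add: is1_def)
  subgoal for u e f v g w h
    using two_category.cmp2_assoc[OF hom2_cat2[of u e f], of u e f v g w h] is2_is1[of u e f]
      is2_is1[of v f g] is2_is1[of w g h] by (simp add: is1_def)
  subgoal for u f g
    using two_category.cmp2_one[OF hom2_cat2[of u f g], of u f g] is2_is1[of u f g] by simp
  subgoal for \<Gamma> t u \<Delta> v \<Theta> w
    using two_category.vcmp3_assoc[OF hom2_cat3[of \<Gamma> t u], of \<Gamma> t u \<Delta> v \<Theta> w] is3_is1[of \<Gamma> t u]
      is3_is1[of \<Delta> u v] is3_is1[of \<Theta> v w] by (simp add: is2_def)
  subgoal for \<Gamma> u v
    using two_category.vcmp3_one[OF hom2_cat3[of \<Gamma> u v], of \<Gamma> u v] is3_is1[of \<Gamma> u v] by simp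
  subgoal for \<Gamma> u u' \<Delta> v v' \<Theta> w w'
    using two_category.hcmp3_assoc[OF hom2_cat3[of \<Gamma> u u'], of \<Gamma> u u' \<Delta> v v' \<Theta> w w']
      is3_is1[of \<Gamma> u u'] is3_is1[of \<Delta> v v'] is3_is1[of \<Theta> w w'] by (simp add: is1_def)
  subgoal for \<Gamma> u u' f g
    using two_category.hcmp3_one[OF hom2_cat3[of \<Gamma> u u'], of \<Gamma> u u' f g] is3_is1[of \<Gamma> u u']
    by (simp add: is2_def)
  subgoal for u f g v h
    using two_category.hcmp3_one3[OF hom2_cat2[of u f g], of u f g v h] is2_is1[of u f g]
      is2_is1[of v g h] by (simp add: is1_def)
  subgoal for \<Gamma> u u' \<Gamma>' u'' \<Delta> v v' \<Delta>' v''
    using two_category.interchange[OF hom2_cat3[of \<Gamma> u u'], of \<Gamma> u u' \<Gamma>' u'' \<Delta> v v' \<Delta>' v'']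
      is3_is1[of \<Gamma> u u'] is3_is1[of \<Gamma>' u' u''] is3_is1[of \<Delta> v v'] is3_is1[of \<Delta>' v' v'']
    by (simp add: is1_def is2_def)
  done

end


section \<open>Whiskering and Gray-functors\<close>

context gray_category
begin

lemma one1_simps [simp]:
  assumes "X \<in> C0 A"
  shows "one1 A X \<in> C1 A" "dom1 A (one1 A X) = X" "cod1 A (one1 A X) = X"
  using unit[OF assms] by (auto simp: is1_def)

text \<open>Composition in one variable, with the homs recovered from the boundary of
  \<open>g\<close>. Together with its mirror image it is the source of the typing and distributivity
  rules for whiskering.\<close>

lemma left_whiskering_functor:
  assumes "g \<in> C1 A" "X \<in> C0 A"
  shows "two_functor (hom A X (dom1 A g)) (hom A X (cod1 A g)) (cmp1 A g) (lwh2 A g) (lwh3 A g)"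
  using gray_bifunctor.right[OF composition[of X "dom1 A g" "cod1 A g"], of g] assms
  by (simp add: is1_def)

lemma right_whiskering_functor:
  assumes "f \<in> C1 A" "Z \<in> C0 A"
  shows "two_functor (hom A (cod1 A f) Z) (hom A (dom1 A f) Z)
    (\<lambda>g. g \<bullet> f) (\<lambda>u. u \<lhd> f) (\<lambda>\<Gamma>. \<Gamma> \<unlhd> f)"
  using gray_bifunctor.left[OF composition[of "dom1 A f" "cod1 A f" Z], of f] assms
  by (simp add: is1_def)

lemma cmp1_simps [simp]:
  assumes "f \<in> C1 A" "g \<in> C1 A" "cod1 A f = dom1 A g"
  shows "g \<bullet> f \<in> C1 A" "dom1 A (g \<bullet> f) = dom1 A f" "cod1 A (g \<bullet> f) = cod1 A g"
  using two_functor.act1[OF left_whiskering_functor[of g "dom1 A f"], of f] assms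
  by (auto simp: is1_def)

lemma lwh2_simps [simp]:
  assumes "g \<in> C1 A" "u \<in> C2 A" "cod1 A (dom2 A u) = dom1 A g"
  shows "g \<rhd> u \<in> C2 A" "dom2 A (g \<rhd> u) = g \<bullet> dom2 A u" "cod2 A (g \<rhd> u) = g \<bullet> cod2 A u"
  using two_functor.act2[OF left_whiskering_functor[of g "dom1 A
    (dom2 A u)"], of u "dom2 A u" "cod2 A u"] assms
  by (auto simp: is1_def is2_def)

lemma rwh2_simps [simp]:
  assumes "f \<in> C1 A" "u \<in> C2 A" "dom1 A (dom2 A u) = cod1 A f"
  shows "u \<lhd> f \<in> C2 A" "dom2 A (u \<lhd> f) = dom2 A u \<bullet> f" "cod2 A (u \<lhd> f) = cod2 A u \<bullet> f"
  using two_functor.act2[OF right_whiskering_functor[of f "cod1 A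
    (dom2 A u)"], of u "dom2 A u" "cod2 A u"] assms
  by (auto simp: is1_def is2_def)

lemma lwh3_simps [simp]:
  assumes "g \<in> C1 A" "\<Gamma> \<in> C3 A" "cod1 A (dom2 A (dom3 A \<Gamma>)) = dom1 A g"
  shows "g \<unrhd> \<Gamma> \<in> C3 A" "dom3 A (g \<unrhd> \<Gamma>) = g \<rhd> dom3 A \<Gamma>" "cod3 A (g \<unrhd> \<Gamma>) = g \<rhd> cod3 A \<Gamma>"
  using two_functor.act3[OF left_whiskering_functor[of g "dom1 A (dom2 A (dom3 A \<Gamma>))"],
      of \<Gamma> "dom3 A \<Gamma>" "cod3 A \<Gamma>"] assms boundary_two[of "dom3 A \<Gamma>"]
  by (auto simp: is1_def is3_def)

lemma rwh3_simps [simp]: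
  assumes "f \<in> C1 A" "\<Gamma> \<in> C3 A" "dom1 A (dom2 A (dom3 A \<Gamma>)) = cod1 A f"
  shows "\<Gamma> \<unlhd> f \<in> C3 A" "dom3 A (\<Gamma> \<unlhd> f) = dom3 A \<Gamma> \<lhd> f" "cod3 A (\<Gamma> \<unlhd> f) = cod3 A \<Gamma> \<lhd> f"
  using two_functor.act3[OF right_whiskering_functor[of f "cod1 A (dom2 A (dom3 A \<Gamma>))"],
      of \<Gamma> "dom3 A \<Gamma>" "cod3 A \<Gamma>"] assms boundary_two[of "dom3 A \<Gamma>"]
  by (auto simp: is1_def is3_def)

lemma lwh2_distribs [simp]:
  assumes "g \<in> C1 A"
  shows "f \<in> C1 A \<Longrightarrow> cod1 A f = dom1 A g \<Longrightarrow> g \<rhd> one2 A f = one2 A (g \<bullet> f)"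
    "\<lbrakk>u \<in> C2 A; v \<in> C2 A; cod2 A u = dom2 A v; cod1 A (dom2 A u) = dom1 A g\<rbrakk>
      \<Longrightarrow> g \<rhd> (v \<odot> u) = (g \<rhd> v) \<odot> (g \<rhd> u)"
  subgoal
    using two_functor.map_one2[OF left_whiskering_functor[OF assms, of "dom1 A f"], of f] assms
    by (simp add: is1_def)
  subgoal
    using two_functor.map_cmp2[OF left_whiskering_functor[OF assms, of "dom1 A (dom2 A u)"],
        of u "dom2 A u" "cod2 A u" v "cod2 A v"] assms boundary_two[of u] boundary_two[of v]
    by (simp add: is1_def is2_def)
  done

lemma rwh2_distribs [simp]:
  assumes "f \<in> C1 A"
  shows "g \<in> C1 A \<Longrightarrow> dom1 A g = cod1 A f \<Longrightarrow> one2 A g \<lhd> f = one2 A (g \<bullet> f)"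
    "\<lbrakk>u \<in> C2 A; v \<in> C2 A; cod2 A u = dom2 A v; dom1 A (dom2 A u) = cod1 A f\<rbrakk>
      \<Longrightarrow> (v \<odot> u) \<lhd> f = (v \<lhd> f) \<odot> (u \<lhd> f)"
  subgoal
    using two_functor.map_one2[OF right_whiskering_functor[OF assms, of "cod1 A g"], of g] assms
    by (simp add: is1_def)
  subgoal
    using two_functor.map_cmp2[OF right_whiskering_functor[OF assms, of "cod1 A (dom2 A u)"],
        of u "dom2 A u" "cod2 A u" v "cod2 A v"] assms boundary_two[of u] boundary_two[of v]
    by (simp add: is1_def is2_def)
  done

lemma lwh3_distribs [simp]:
  assumes "g \<in> C1 A"
  shows "u \<in> C2 A \<Longrightarrow> cod1 A (dom2 A u) = dom1 A g \<Longrightarrow> g \<unrhd> one3 A u = one3 A (g \<rhd> u)"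
    "\<lbrakk>\<Gamma> \<in> C3 A; \<Delta> \<in> C3 A; cod3 A \<Gamma> = dom3 A \<Delta>; cod1 A (dom2 A (dom3 A \<Gamma>)) = dom1 A g\<rbrakk>
      \<Longrightarrow> g \<unrhd> (\<Delta> \<cdot> \<Gamma>) = (g \<unrhd> \<Delta>) \<cdot> (g \<unrhd> \<Gamma>)"
    "\<lbrakk>\<Gamma> \<in> C3 A; \<Delta> \<in> C3 A; cod2 A (dom3 A \<Gamma>) = dom2 A (dom3 A \<Delta>); cod1 A (dom2 A (dom3 A \<Gamma>))
      = dom1 A g\<rbrakk>
      \<Longrightarrow> g \<unrhd> (\<Delta> \<star> \<Gamma>) = (g \<unrhd> \<Delta>) \<star> (g \<unrhd> \<Gamma>)"
  subgoal
    using two_functor.map_one3[OF left_whiskering_functor[OF assms, of "dom1 A (dom2 A u)"], of u]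
      assms
      boundary_two[of u]
    by (simp add: is1_def)
  subgoal
    using two_functor.map_vcmp3[OF left_whiskering_functor[OF assms, of "dom1 A (dom2 A
      (dom3 A \<Gamma>))"],
        of \<Gamma> "dom3 A \<Gamma>" "cod3 A \<Gamma>" \<Delta> "cod3 A \<Delta>"] assms boundary_two[of
        "dom3 A \<Gamma>"] boundary_cell[of \<Gamma>]
    by (simp add: is1_def is3_def)
  subgoal
    using two_functor.map_hcmp3[OF left_whiskering_functor[OF assms, of "dom1 A (dom2 A
      (dom3 A \<Gamma>))"],
        of \<Gamma> "dom3 A \<Gamma>" "cod3 A \<Gamma>" \<Delta> "dom3 A \<Delta>" "cod3 A \<Delta>"] assms
      boundary_two[of "dom3 A \<Gamma>"] boundary_two[of "dom3 A \<Delta>"]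
    by (simp add: is1_def is3_def)
  done

lemma rwh3_distribs [simp]:
  assumes "f \<in> C1 A"
  shows "u \<in> C2 A \<Longrightarrow> dom1 A (dom2 A u) = cod1 A f \<Longrightarrow> one3 A u \<unlhd> f = one3 A (u \<lhd> f)"
    "\<lbrakk>\<Gamma> \<in> C3 A; \<Delta> \<in> C3 A; cod3 A \<Gamma> = dom3 A \<Delta>; dom1 A (dom2 A (dom3 A \<Gamma>)) = cod1 A f\<rbrakk>
      \<Longrightarrow> (\<Delta> \<cdot> \<Gamma>) \<unlhd> f = (\<Delta> \<unlhd> f) \<cdot> (\<Gamma> \<unlhd> f)"
    "\<lbrakk>\<Gamma> \<in> C3 A; \<Delta> \<in> C3 A; cod2 A (dom3 A \<Gamma>) = dom2 A (dom3 A \<Delta>); dom1 A (dom2 A (dom3 A \<Gamma>))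
      = cod1 A f\<rbrakk>
      \<Longrightarrow> (\<Delta> \<star> \<Gamma>) \<unlhd> f = (\<Delta> \<unlhd> f) \<star> (\<Gamma> \<unlhd> f)"
  subgoal
    using two_functor.map_one3[OF right_whiskering_functor[OF assms, of "cod1 A (dom2 A u)"], of u]
      assms
      boundary_two[of u]
    by (simp add: is1_def)
  subgoal
    using two_functor.map_vcmp3[OF right_whiskering_functor[OF assms, of "cod1 A (dom2 A
      (dom3 A \<Gamma>))"],
        of \<Gamma> "dom3 A \<Gamma>" "cod3 A \<Gamma>" \<Delta> "cod3 A \<Delta>"] assms boundary_two[of
        "dom3 A \<Gamma>"] boundary_cell[of \<Gamma>]
    by (simp add: is1_def is3_def)
  subgoal
    using two_functor.map_hcmp3[OF right_whiskering_functor[OF assms, of "cod1 A (dom2 A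
      (dom3 A \<Gamma>))"],
        of \<Gamma> "dom3 A \<Gamma>" "cod3 A \<Gamma>" \<Delta> "dom3 A \<Delta>" "cod3 A \<Delta>"] assms
      boundary_two[of "dom3 A \<Gamma>"] boundary_two[of "dom3 A \<Delta>"]
    by (simp add: is1_def is3_def)
  done

section \<open>Unit and associativity laws for composition along objects\<close>

lemma unit1_simps [simp]:
  assumes "f \<in> C1 A"
  shows "dom1 A f = X \<Longrightarrow> f \<bullet> one1 A X = f" "cod1 A f = Y \<Longrightarrow> one1 A Y \<bullet> f = f"
  using unit1[of f "dom1 A f" "cod1 A f"] assms by (auto simp: is1_def)

lemma unit2_simps [simp]:
  assumes "u \<in> C2 A"
  shows "dom1 A (dom2 A u) = X \<Longrightarrow> u \<lhd> one1 A X = u" "cod1 A (dom2 A u) = Y \<Longrightarrow> one1 A Y \<rhd> u = u"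
  using unit2[of u "dom2 A u" "cod2 A u" "dom1 A (dom2 A u)" "cod1 A (dom2 A u)"] assms
  by (auto simp: is1_def is2_def)

lemma unit3_simps [simp]:
  assumes "\<Gamma> \<in> C3 A"
  shows "dom1 A (dom2 A (dom3 A \<Gamma>)) = X \<Longrightarrow> \<Gamma> \<unlhd> one1 A X = \<Gamma>"
    "cod1 A (dom2 A (dom3 A \<Gamma>)) = Y \<Longrightarrow> one1 A Y \<unrhd> \<Gamma> = \<Gamma>"
  using unit3[of \<Gamma> "dom3 A \<Gamma>" "cod3 A \<Gamma>" "dom2 A (dom3 A \<Gamma>)" "cod2 A (dom3 A \<Gamma>)"
      "dom1 A (dom2 A (dom3 A \<Gamma>))" "cod1 A (dom2 A (dom3 A \<Gamma>))"] assms
  by (auto simp: is1_def is2_def is3_def)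

lemma assoc1_simp [simp]:
  assumes "f \<in> C1 A" "g \<in> C1 A" "h \<in> C1 A" "cod1 A f = dom1 A g" "cod1 A g = dom1 A h"
  shows "(h \<bullet> g) \<bullet> f = h \<bullet> (g \<bullet> f)"
  using assoc1[of f "dom1 A f" "cod1 A f" g "cod1 A g" h "cod1 A h"] assms by (auto simp: is1_def)

text \<open>Oriented towards the normal form \<open>h \<rhd> (u \<lhd> f)\<close>, with at most one
  composite 1-cell on either side.\<close>

lemma assoc2_simps [simp]:
  "\<lbrakk>u \<in> C2 A; g \<in> C1 A; h \<in> C1 A; cod1 A (dom2 A u) = dom1 A g; cod1 A g = dom1 A h\<rbrakk>
    \<Longrightarrow> h \<rhd> (g \<rhd> u) = (h \<bullet> g) \<rhd> u"
  "\<lbrakk>f \<in> C1 A; u \<in> C2 A; h \<in> C1 A; cod1 A f = dom1 A (dom2 A u); cod1 A (dom2 A u) = dom1 A h\<rbrakk>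
    \<Longrightarrow> (h \<rhd> u) \<lhd> f = h \<rhd> (u \<lhd> f)"
  "\<lbrakk>f \<in> C1 A; g \<in> C1 A; u \<in> C2 A; cod1 A f = dom1 A g; cod1 A g = dom1 A (dom2 A u)\<rbrakk>
    \<Longrightarrow> (u \<lhd> g) \<lhd> f = u \<lhd> (g \<bullet> f)"
  subgoal
    using assoc2r[of u "dom2 A u" "cod2 A u" "dom1 A
      (dom2 A u)" "dom1 A g" g "cod1 A g" h "cod1 A h"]
    by (simp add: is1_def is2_def)
  subgoal
    using assoc2m[of f "dom1 A f" "cod1 A f" u "dom2 A u" "cod2 A u" "dom1 A h" h "cod1 A h"]
    by (simp add: is1_def is2_def)
  subgoal
    using assoc2l[of f "dom1 A f" "cod1 A f" g "cod1 A g" u "dom2 A u" "cod2 A u" "cod1 A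
      (dom2 A u)"]
    by (simp add: is1_def is2_def)
  done

lemma assoc3_simps [simp]:
  "\<lbrakk>\<Gamma> \<in> C3 A; g \<in> C1 A; h \<in> C1 A; cod1 A (dom2 A (dom3 A \<Gamma>)) = dom1 A g; cod1 A g = dom1 A h\<rbrakk>
    \<Longrightarrow> h \<unrhd> (g \<unrhd> \<Gamma>) = (h \<bullet> g) \<unrhd> \<Gamma>"
  "\<lbrakk>f \<in> C1 A; \<Gamma> \<in> C3 A; h \<in> C1 A; cod1 A f = dom1 A (dom2 A (dom3 A \<Gamma>));
      cod1 A (dom2 A (dom3 A \<Gamma>)) = dom1 A h\<rbrakk>
    \<Longrightarrow> (h \<unrhd> \<Gamma>) \<unlhd> f = h \<unrhd> (\<Gamma> \<unlhd> f)"
  "\<lbrakk>f \<in> C1 A; g \<in> C1 A; \<Gamma> \<in> C3 A; cod1 A f = dom1 A g; cod1 A g = dom1 A (dom2 A (dom3 A \<Gamma>))\<rbrakk>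
    \<Longrightarrow> (\<Gamma> \<unlhd> g) \<unlhd> f = \<Gamma> \<unlhd> (g \<bullet> f)"
  subgoal
    using assoc3r[of \<Gamma> "dom3 A \<Gamma>" "cod3 A \<Gamma>" "dom2 A (dom3 A \<Gamma>)" "cod2 A (dom3 A \<Gamma>)"
        "dom1 A (dom2 A (dom3 A \<Gamma>))" "dom1 A g" g "cod1 A g" h "cod1 A h"]
    by (simp add: is1_def is2_def is3_def)
  subgoal
    using assoc3m[of f "dom1 A f" "cod1 A f" \<Gamma> "dom3 A \<Gamma>" "cod3 A \<Gamma>" "dom2 A (dom3 A \<Gamma>)"
        "cod2 A (dom3 A \<Gamma>)" "dom1 A h" h "cod1 A h"]
    by (simp add: is1_def is2_def is3_def)
  subgoal
    using assoc3l[of f "dom1 A f" "cod1 A f" g "cod1 A g" \<Gamma> "dom3 A \<Gamma>" "cod3 A \<Gamma>" "dom2 A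
      (dom3 A \<Gamma>)"
        "cod2 A (dom3 A \<Gamma>)" "cod1 A (dom2 A (dom3 A \<Gamma>))"]
    by (simp add: is1_def is2_def is3_def)
  done

lemma inverse3_hom:
  assumes "inverse3 A \<Gamma> \<Delta>"
  shows "inverse3 (hom A X Y) \<Gamma> \<Delta> \<longleftrightarrow> is1 A (dom2 A (dom3 A \<Gamma>)) X Y"
  using assms boundary_cell[of \<Gamma>] boundary_two[of "dom3 A \<Gamma>"]
  by (auto simp: inverse3_def is3_def is1_def)

lemma inverse3_homD: "inverse3 (hom A X Y) \<Gamma> \<Delta> \<Longrightarrow> inverse3 A \<Gamma> \<Delta> \<and> is1 A (dom2 A (dom3 A \<Gamma>)) X Y"
  by (auto simp: inverse3_def is3_def)

text \<open>An inverse has the reversed boundary and therefore lies in the same hom.\<close>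

lemma invertible3_hom [simp]:
  "invertible3 (hom A X Y) \<Gamma> \<longleftrightarrow> invertible3 A \<Gamma> \<and> is1 A (dom2 A (dom3 A \<Gamma>)) X Y"
  using inverse3_homD inverse3_hom unfolding invertible3_def by blast

section \<open>Interchangers\<close>

lemma ich_iso:
  assumes "u \<in> C2 A" "v \<in> C2 A" "cod1 A (dom2 A u) = dom1 A (dom2 A v)"
  shows "iso3 A (ich A v u) ((cod2 A v \<rhd> u) \<odot> (v \<lhd> dom2 A u)) ((v \<lhd> cod2 A u) \<odot> (dom2 A v \<rhd> u))"
proof -
  let ?X = "dom1 A (dom2 A u)" and ?Y = "dom1 A (dom2 A v)" and ?Z = "cod1 A (dom2 A v)"
  interpret gray_bifunctor "hom A ?Y ?Z" "hom A ?X ?Y" "hom A ?X ?Z" "cmp_bifun A"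
    using assms by (intro composition) auto
  show ?thesis
    using ich[of v "dom2 A v" "cod2 A v" u "dom2 A u" "cod2 A u"] assms
    by (auto simp: iso3_iff is1_def is2_def is3_def)
qed

lemma ich_simps [simp]:
  assumes "u \<in> C2 A" "v \<in> C2 A" "cod1 A (dom2 A u) = dom1 A (dom2 A v)"
  shows "invertible3 A (ich A v u)" "ich A v u \<in> C3 A"
    "dom3 A (ich A v u) = (cod2 A v \<rhd> u) \<odot> (v \<lhd> dom2 A u)"
    "cod3 A (ich A v u) = (v \<lhd> cod2 A u) \<odot> (dom2 A v \<rhd> u)"
  using ich_iso[OF assms] by (auto simp: iso3_iff is3_def)

lemma ich_one [simp]:
  "\<lbrakk>c \<in> C1 A; v \<in> C2 A; cod1 A (dom2 A v) = dom1 A c\<rbrakk> \<Longrightarrow> ich A (one2 A c) v = one3 A (c \<rhd> v)"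
  "\<lbrakk>d \<in> C1 A; u \<in> C2 A; cod1 A d = dom1 A (dom2 A u)\<rbrakk> \<Longrightarrow> ich A u (one2 A d) = one3 A (u \<lhd> d)"
  subgoal
    using gray_bifunctor.ich_one_left[OF composition[of "dom1 A
      (dom2 A v)" "dom1 A c" "cod1 A c"], of c v]
    by (simp add: is1_def)
  subgoal
    using gray_bifunctor.ich_one_right[OF composition[of "dom1 A d" "cod1 A d" "cod1 A
      (dom2 A u)"], of u d]
    by (simp add: is1_def)
  done

text \<open>Outer whiskers are pulled out of the interchanger and a whisker between its two
  arguments is moved to the right one, which gives a normal form.\<close>

lemma ich_whisker [simp]:
  "\<lbrakk>u \<in> C2 A; v \<in> C2 A; h \<in> C1 A; cod1 A (dom2 A u) = dom1 A (dom2 A v); cod1 A (dom2 A v)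
    = dom1 A h\<rbrakk>
    \<Longrightarrow> ich A (h \<rhd> v) u = h \<unrhd> ich A v u"
  "\<lbrakk>u \<in> C2 A; g \<in> C1 A; w \<in> C2 A; cod1 A (dom2 A u) = dom1 A g; cod1 A g = dom1 A (dom2 A w)\<rbrakk>
    \<Longrightarrow> ich A (w \<lhd> g) u = ich A w (g \<rhd> u)"
  "\<lbrakk>f \<in> C1 A; v \<in> C2 A; w \<in> C2 A; cod1 A f = dom1 A (dom2 A v); cod1 A (dom2 A v)
    = dom1 A (dom2 A w)\<rbrakk>
    \<Longrightarrow> ich A w (v \<lhd> f) = ich A w v \<unlhd> f"
  subgoal
    using assoc_ich_r[of u "dom2 A u" "cod2 A u" "dom1 A (dom2 A u)" "dom1 A
      (dom2 A v)" v "dom2 A v" "cod2 A v"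
        "dom1 A h" h "cod1 A h"]
    by (simp add: is1_def is2_def)
  subgoal
    using assoc_ich_m[of u "dom2 A u" "cod2 A u" "dom1 A
      (dom2 A u)" "dom1 A g" g "cod1 A g" w "dom2 A w"
        "cod2 A w" "cod1 A (dom2 A w)"]
    by (simp add: is1_def is2_def)
  subgoal
    using assoc_ich_l[of f "dom1 A f" "cod1 A f" v "dom2 A v" "cod2 A v" "dom1 A
      (dom2 A w)" w "dom2 A w"
        "cod2 A w" "cod1 A (dom2 A w)"]
    by (simp add: is1_def is2_def)
  done

section \<open>Inverses and adjoint equivalences under whiskering\<close>

lemma inverse3_lwh3:
  assumes "invertible3 A \<Gamma>" "g \<in> C1 A" "cod1 A (dom2 A (dom3 A \<Gamma>)) = dom1 A g"
  shows "inverse3 A (g \<unrhd> \<Gamma>) (g \<unrhd> inv3 A \<Gamma>)"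
proof -
  note [simp] = assms invertible3_C3[OF assms(1)]
  show ?thesis by (rule inverse3I) (auto simp flip: lwh3_distribs)
qed

lemma inverse3_rwh3:
  assumes "invertible3 A \<Gamma>" "f \<in> C1 A" "dom1 A (dom2 A (dom3 A \<Gamma>)) = cod1 A f"
  shows "inverse3 A (\<Gamma> \<unlhd> f) (inv3 A \<Gamma> \<unlhd> f)"
proof -
  note [simp] = assms invertible3_C3[OF assms(1)]
  show ?thesis by (rule inverse3I) (auto simp flip: rwh3_distribs)
qed

lemma invertible3_whisker [simp]:
  "\<lbrakk>invertible3 A \<Gamma>; g \<in> C1 A; cod1 A (dom2 A (dom3 A \<Gamma>)) = dom1 A g\<rbrakk> \<Longrightarrow> invertible3 A (g \<unrhd> \<Gamma>)"
  "\<lbrakk>invertible3 A \<Gamma>; f \<in> C1 A; dom1 A (dom2 A (dom3 A \<Gamma>)) = cod1 A f\<rbrakk> \<Longrightarrow> invertible3 A (\<Gamma> \<unlhd> f)"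
  by (blast intro: invertible3I inverse3_lwh3 inverse3_rwh3)+

lemma inv3_whisker [simp]:
  "\<lbrakk>invertible3 A \<Gamma>; g \<in> C1 A; cod1 A (dom2 A (dom3 A \<Gamma>)) = dom1 A g\<rbrakk>
    \<Longrightarrow> inv3 A (g \<unrhd> \<Gamma>) = g \<unrhd> inv3 A \<Gamma>"
  "\<lbrakk>invertible3 A \<Gamma>; f \<in> C1 A; dom1 A (dom2 A (dom3 A \<Gamma>)) = cod1 A f\<rbrakk>
    \<Longrightarrow> inv3 A (\<Gamma> \<unlhd> f) = inv3 A \<Gamma> \<unlhd> f"
  by (blast intro: inv3_eqI inverse3_lwh3 inverse3_rwh3)+

text \<open>Lets adjoint equivalences, which are required in a hom, be handled in the union of all
  homs, where the rewrite rules live.\<close>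

lemma adj_equiv_hom: "adj_equiv (hom A X Y) e f g \<longleftrightarrow> adj_equiv A e f g \<and> is1 A f X Y"
proof
  assume a: "adj_equiv (hom A X Y) e f g"
  then have "is1 A f X Y" by (simp add: adj_equiv_def)
  moreover from this have "f \<in> C1 A" by (simp add: is1_def)
  ultimately show "adj_equiv A e f g \<and> is1 A f X Y" using a
    by (auto simp: adj_equiv_def iso3_iff)
next
  assume a: "adj_equiv A e f g \<and> is1 A f X Y"
  then have l: "lft e \<in> C2 A" "dom2 A (lft e) = f" "cod2 A (lft e) = g"
    by (simp_all add: adj_equiv_def is2_def)
  then have "f \<in> C1 A" "g \<in> C1 A" "is1 A g X Y"
    using a boundary_arrow[OF l(1)] boundary_two[OF l(1)] by (simp_all add: is1_def)
  then show "adj_equiv (hom A X Y) e f g" using a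
    by (auto simp: adj_equiv_def iso3_iff is2_def is3_def)
qed

lemma adj_equiv_lwh_adj:
  assumes "adj_equiv A e f g" "h \<in> C1 A" "cod1 A f = dom1 A h"
  shows "adj_equiv A (lwh_adj A h e) (h \<bullet> f) (h \<bullet> g)"
proof -
  obtain l r \<eta> \<epsilon> where e: "e = Adj l r \<eta> \<epsilon>" by (cases e)
  from assms(1) have E [simp]: "l \<in> C2 A" "dom2 A l = f" "cod2 A l = g" "r \<in> C2 A" "dom2 A r = g"
      "cod2 A r = f"
    "invertible3 A \<eta>" "\<eta> \<in> C3 A" "dom3 A \<eta> = one2 A f" "cod3 A \<eta> = r \<odot> l"
    "invertible3 A \<epsilon>" "\<epsilon> \<in> C3 A" "dom3 A \<epsilon> = l \<odot> r" "cod3 A \<epsilon> = one2 A g"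
    and t: "(\<epsilon> \<lhd>\<odot> l) \<cdot> (l \<odot>\<rhd> \<eta>) = one3 A l" "(r \<odot>\<rhd> \<epsilon>) \<cdot> (\<eta> \<lhd>\<odot> r) = one3 A r"
    by (simp_all add: adj_equiv_iff e)
  have [simp]: "f \<in> C1 A" "g \<in> C1 A" "cod1 A g = cod1 A f" "dom1 A g = dom1 A f"
    using boundary_arrow[OF E(1)] boundary_two[OF E(1)] by simp_all
  \<comment> \<open>Whisker both triangle identities; functoriality turns them into those of the
    whiskered adjunction.\<close>
  show ?thesis using assms(2,3) t[THEN arg_cong, of "lwh3 A h"]
    by (simp add: adj_equiv_iff e lwh_adj_def)
qed

lemma adj_equiv_rwh_adj:
  assumes "adj_equiv A e f g" "h \<in> C1 A" "dom1 A f = cod1 A h"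
  shows "adj_equiv A (rwh_adj A e h) (f \<bullet> h) (g \<bullet> h)"
proof -
  obtain l r \<eta> \<epsilon> where e: "e = Adj l r \<eta> \<epsilon>" by (cases e)
  from assms(1) have E [simp]: "l \<in> C2 A" "dom2 A l = f" "cod2 A l = g" "r \<in> C2 A" "dom2 A r = g"
      "cod2 A r = f"
    "invertible3 A \<eta>" "\<eta> \<in> C3 A" "dom3 A \<eta> = one2 A f" "cod3 A \<eta> = r \<odot> l"
    "invertible3 A \<epsilon>" "\<epsilon> \<in> C3 A" "dom3 A \<epsilon> = l \<odot> r" "cod3 A \<epsilon> = one2 A g"
    and t: "(\<epsilon> \<lhd>\<odot> l) \<cdot> (l \<odot>\<rhd> \<eta>) = one3 A l" "(r \<odot>\<rhd> \<epsilon>) \<cdot> (\<eta> \<lhd>\<odot> r) = one3 A r"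
    by (simp_all add: adj_equiv_iff e)
  have [simp]: "f \<in> C1 A" "g \<in> C1 A" "cod1 A g = cod1 A f" "dom1 A g = dom1 A f"
    using boundary_arrow[OF E(1)] boundary_two[OF E(1)] by simp_all
  show ?thesis using assms(2,3) t[THEN arg_cong, of "\<lambda>\<Gamma>. rwh3 A \<Gamma> h"]
    by (simp add: adj_equiv_iff e rwh_adj_def)
qed

end

section \<open>Preservation rules for Gray-functors\<close>

locale gray_functor_between =
  A: gray_category A + B: gray_category B + gray_functor A B F
  for A :: "('o, 'f, 'a, 'g) gray" and B :: "('p, 'h, 'b, 'k) gray" (structure)
    and F :: "('o, 'f, 'a, 'g, 'p, 'h, 'b, 'k) gmap"
begin

lemma hom_functor:
  assumes "f \<in> C1 A"
  shows "two_functor (hom A (dom1 A f) (cod1 A f)) (hom B (act0 F (dom1 A f)) (act0 F (cod1 A f)))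
    (act1 F) (act2 F) (act3 F)"
  using on_homs[of "dom1 A f" "cod1 A f"] assms by simp

lemma act0_simp [simp]: "X \<in> C0 A \<Longrightarrow> act0 F X \<in> C0 B"
  by (rule on_objects)

lemma act1_simps [simp]:
  assumes "f \<in> C1 A"
  shows "act1 F f \<in> C1 B" "dom1 B (act1 F f) = act0 F (dom1 A f)"
    "cod1 B (act1 F f) = act0 F (cod1 A f)"
  using two_functor.act1[OF hom_functor[OF assms], of f] assms by (auto simp: is1_def)

lemma act2_simps [simp]:
  assumes "u \<in> C2 A"
  shows "act2 F u \<in> C2 B" "dom2 B (act2 F u) = act1 F (dom2 A u)"
    "cod2 B (act2 F u) = act1 F (cod2 A u)"
  using two_functor.act2[OF hom_functor[of "dom2 A u"], of u "dom2 A u" "cod2 A u"] assms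
  by (auto simp: is1_def is2_def)

lemma act3_simps [simp]:
  assumes "\<Gamma> \<in> C3 A"
  shows "act3 F \<Gamma> \<in> C3 B" "dom3 B (act3 F \<Gamma>) = act2 F (dom3 A \<Gamma>)"
    "cod3 B (act3 F \<Gamma>) = act2 F (cod3 A \<Gamma>)"
  using two_functor.act3[OF hom_functor[of "dom2 A (dom3 A \<Gamma>)"], of \<Gamma> "dom3 A \<Gamma>" "cod3 A \<Gamma>"] assms
  by (auto simp: is1_def is3_def)

lemma map_ones [simp]:
  "X \<in> C0 A \<Longrightarrow> act1 F (one1 A X) = one1 B (act0 F X)"
  "f \<in> C1 A \<Longrightarrow> act2 F (one2 A f) = one2 B (act1 F f)"
  "u \<in> C2 A \<Longrightarrow> act3 F (one3 A u) = one3 B (act2 F u)"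
  subgoal by (rule pres_one1)
  subgoal using two_functor.map_one2[OF hom_functor[of f], of f] by (simp add: is1_def)
  subgoal using two_functor.map_one3[OF hom_functor[of "dom2 A u"], of u] by (simp add: is1_def)
  done

lemma map_cmps [simp]:
  "\<lbrakk>f \<in> C1 A; g \<in> C1 A; cod1 A f = dom1 A g\<rbrakk> \<Longrightarrow> act1 F (g \<bullet>\<^bsub>A\<^esub> f) = act1 F g \<bullet> act1 F f"
  "\<lbrakk>u \<in> C2 A; v \<in> C2 A; cod2 A u = dom2 A v\<rbrakk> \<Longrightarrow> act2 F (v \<odot>\<^bsub>A\<^esub> u) = act2 F v \<odot> act2 F u"
  "\<lbrakk>\<Gamma> \<in> C3 A; \<Delta> \<in> C3 A; cod3 A \<Gamma> = dom3 A \<Delta>\<rbrakk> \<Longrightarrow> act3 F (\<Delta> \<cdot>\<^bsub>A\<^esub> \<Gamma>) = act3 F \<Delta> \<cdot> act3 F \<Gamma>"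
  "\<lbrakk>\<Gamma> \<in> C3 A; \<Delta> \<in> C3 A; cod2 A (dom3 A \<Gamma>) = dom2 A (dom3 A \<Delta>)\<rbrakk>
    \<Longrightarrow> act3 F (\<Delta> \<star>\<^bsub>A\<^esub> \<Gamma>) = act3 F \<Delta> \<star> act3 F \<Gamma>"
  subgoal using pres_cmp1[of f "dom1 A f" "cod1 A f" g "cod1 A g"] by (simp add: is1_def)
  subgoal
    using two_functor.map_cmp2[OF hom_functor[of "dom2 A v"], of u "dom2 A u" "cod2 A u" v
      "cod2 A v"]
      A.boundary_two[of u]
    by (simp add: is1_def is2_def)
  subgoal
    using two_functor.map_vcmp3[OF hom_functor[of "dom2 A
      (dom3 A \<Delta>)"], of \<Gamma> "dom3 A \<Gamma>" "cod3 A \<Gamma>" \<Delta> "cod3 A \<Delta>"]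
      A.boundary_cell[of \<Gamma>] by (simp add: is1_def is3_def)
  subgoal
    using two_functor.map_hcmp3[OF hom_functor[of "dom2 A (dom3 A \<Delta>)"],
        of \<Gamma> "dom3 A \<Gamma>" "cod3 A \<Gamma>" \<Delta> "dom3 A \<Delta>" "cod3 A \<Delta>"]
      A.boundary_two[of "dom3 A \<Gamma>"] by (simp add: is1_def is3_def)
  done

lemma map_whiskers [simp]:
  "\<lbrakk>u \<in> C2 A; g \<in> C1 A; cod1 A (dom2 A u) = dom1 A g\<rbrakk> \<Longrightarrow> act2 F (g \<rhd>\<^bsub>A\<^esub> u) = act1 F g \<rhd> act2 F u"
  "\<lbrakk>f \<in> C1 A; v \<in> C2 A; cod1 A f = dom1 A (dom2 A v)\<rbrakk> \<Longrightarrow> act2 F (v \<lhd>\<^bsub>A\<^esub> f) = act2 F v \<lhd> act1 F f"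
  "\<lbrakk>\<Gamma> \<in> C3 A; g \<in> C1 A; cod1 A (dom2 A (dom3 A \<Gamma>)) = dom1 A g\<rbrakk>
    \<Longrightarrow> act3 F (g \<unrhd>\<^bsub>A\<^esub> \<Gamma>) = act1 F g \<unrhd> act3 F \<Gamma>"
  "\<lbrakk>f \<in> C1 A; \<Gamma> \<in> C3 A; cod1 A f = dom1 A (dom2 A (dom3 A \<Gamma>))\<rbrakk>
    \<Longrightarrow> act3 F (\<Gamma> \<unlhd>\<^bsub>A\<^esub> f) = act3 F \<Gamma> \<unlhd> act1 F f"
  "\<lbrakk>u \<in> C2 A; v \<in> C2 A; cod1 A (dom2 A u) = dom1 A (dom2 A v)\<rbrakk>
    \<Longrightarrow> act3 F (ich A v u) = ich B (act2 F v) (act2 F u)"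
  subgoal
    using pres_lwh2[of u "dom2 A u" "cod2 A u" "dom1 A (dom2 A u)" "dom1 A g" g "cod1 A g"]
    by (simp add: is1_def is2_def)
  subgoal
    using pres_rwh2[of f "dom1 A f" "cod1 A f" v "dom2 A v" "cod2 A v" "cod1 A (dom2 A v)"]
    by (simp add: is1_def is2_def)
  subgoal
    using pres_lwh3[of \<Gamma> "dom3 A \<Gamma>" "cod3 A \<Gamma>" "dom2 A (dom3 A \<Gamma>)" "cod2 A (dom3 A \<Gamma>)"
        "dom1 A (dom2 A (dom3 A \<Gamma>))" "dom1 A g" g "cod1 A g"]
    by (simp add: is1_def is2_def is3_def)
  subgoal
    using pres_rwh3[of f "dom1 A f" "cod1 A f" \<Gamma> "dom3 A \<Gamma>" "cod3 A \<Gamma>" "dom2 A (dom3 A \<Gamma>)"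
        "cod2 A (dom3 A \<Gamma>)" "cod1 A (dom2 A (dom3 A \<Gamma>))"]
    by (simp add: is1_def is2_def is3_def)
  subgoal
    using pres_ich[of u "dom2 A u" "cod2 A u" "dom1 A (dom2 A u)" "dom1 A
      (dom2 A v)" v "dom2 A v" "cod2 A v"
        "cod1 A (dom2 A v)"]
    by (simp add: is1_def is2_def)
  done

end


section \<open>3-pseudofunctors, in terms of sources and targets\<close>

text \<open>
  Quantifying over composable cells instead of over homs turns every side condition into an equation
  between sources and targets, which the simplifier decides.
\<close>

locale arrow_pseudofunctor = gray_category A
  for A :: "('o, 'f, 'a, 'g) gray" +
  fixes C :: "('p, 'h, 'b, 'k) gray" (structure)
    and H :: "('o, 'f, 'a, 'g, 'p, 'h, 'b, 'k) pseudo"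
  assumes ext: "gmap_extensional A H" "unitor H \<in> extensional (C0 A)"
      "\<not> composable A g f \<Longrightarrow> compositor H g f = undefined"
    and obj: "X \<in> C0 A \<Longrightarrow> act0 H X \<in> C0 C"
    and mor: "f \<in> C1 A \<Longrightarrow> is1 C (act1 H f) (act0 H (dom1 A f)) (act0 H (cod1 A f))"
    and two: "u \<in> C2 A \<Longrightarrow> is2 C (act2 H u) (act1 H (dom2 A u)) (act1 H (cod2 A u))"
    and three: "\<Gamma> \<in> C3 A \<Longrightarrow> is3 C (act3 H \<Gamma>) (act2 H (dom3 A \<Gamma>)) (act2 H (cod3 A \<Gamma>))"
    and cmp_mor: "\<lbrakk>f \<in> C1 A; g \<in> C1 A; cod1 A f = dom1 A g\<rbrakk> \<Longrightarrow>
      is1 C (act1 H g \<bullet> act1 H f) (act0 H (dom1 A f)) (act0 H (cod1 A g))"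
    and map_one2: "f \<in> C1 A \<Longrightarrow> act2 H (one2 A f) = one2 C (act1 H f)"
    and map_one3: "u \<in> C2 A \<Longrightarrow> act3 H (one3 A u) = one3 C (act2 H u)"
    and map_cmp2: "\<lbrakk>u \<in> C2 A; v \<in> C2 A; cod2 A u = dom2 A v\<rbrakk> \<Longrightarrow>
      act2 H (v \<odot>\<^bsub>A\<^esub> u) = act2 H v \<odot> act2 H u"
    and map_vcmp3: "\<lbrakk>\<Gamma> \<in> C3 A; \<Delta> \<in> C3 A; cod3 A \<Gamma> = dom3 A \<Delta>\<rbrakk> \<Longrightarrow>
      act3 H (\<Delta> \<cdot>\<^bsub>A\<^esub> \<Gamma>) = act3 H \<Delta> \<cdot> act3 H \<Gamma>"
    and map_hcmp3: "\<lbrakk>\<Gamma> \<in> C3 A; \<Delta> \<in> C3 A; cod2 A (dom3 A \<Gamma>) = dom2 A (dom3 A \<Delta>)\<rbrakk> \<Longrightarrow>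
      act3 H (\<Delta> \<star>\<^bsub>A\<^esub> \<Gamma>) = act3 H \<Delta> \<star> act3 H \<Gamma>"
    and unitor_iso: "X \<in> C0 A \<Longrightarrow> iso2 C (unitor H X) (one1 C (act0 H X)) (act1 H (one1 A X))"
    and compositor_iso: "\<lbrakk>f \<in> C1 A; g \<in> C1 A; cod1 A f = dom1 A g\<rbrakk> \<Longrightarrow>
      iso2 C (compositor H g f) (act1 H g \<bullet> act1 H f) (act1 H (g \<bullet>\<^bsub>A\<^esub> f))"
    and nat2l: "\<lbrakk>f \<in> C1 A; v \<in> C2 A; cod1 A f = dom1 A (dom2 A v)\<rbrakk> \<Longrightarrow>
      act2 H (v \<lhd>\<^bsub>A\<^esub> f) \<odot> compositor H (dom2 A v) f
        = compositor H (cod2 A v) f \<odot> (act2 H v \<lhd> act1 H f)"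
    and nat2r: "\<lbrakk>u \<in> C2 A; g \<in> C1 A; cod1 A (dom2 A u) = dom1 A g\<rbrakk> \<Longrightarrow>
      act2 H (g \<rhd>\<^bsub>A\<^esub> u) \<odot> compositor H g (dom2 A u)
        = compositor H g (cod2 A u) \<odot> (act1 H g \<rhd> act2 H u)"
    and nat3l: "\<lbrakk>f \<in> C1 A; \<Gamma> \<in> C3 A; cod1 A f = dom1 A (dom2 A (dom3 A \<Gamma>))\<rbrakk> \<Longrightarrow>
      act3 H (\<Gamma> \<unlhd>\<^bsub>A\<^esub> f) \<lhd>\<odot> compositor H (dom2 A (dom3 A \<Gamma>)) f
        = compositor H (cod2 A (dom3 A \<Gamma>)) f \<odot>\<rhd> (act3 H \<Gamma> \<unlhd> act1 H f)"
    and nat3r: "\<lbrakk>\<Gamma> \<in> C3 A; g \<in> C1 A; cod1 A (dom2 A (dom3 A \<Gamma>)) = dom1 A g\<rbrakk> \<Longrightarrow>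
      act3 H (g \<unrhd>\<^bsub>A\<^esub> \<Gamma>) \<lhd>\<odot> compositor H g (dom2 A (dom3 A \<Gamma>))
        = compositor H g (cod2 A (dom3 A \<Gamma>)) \<odot>\<rhd> (act1 H g \<unrhd> act3 H \<Gamma>)"
    and nat_ich: "\<lbrakk>u \<in> C2 A; v \<in> C2 A; cod1 A (dom2 A u) = dom1 A (dom2 A v)\<rbrakk> \<Longrightarrow>
      act3 H (ich A v u) \<lhd>\<odot> compositor H (dom2 A v) (dom2 A u)
        = compositor H (cod2 A v) (cod2 A u) \<odot>\<rhd> ich C (act2 H v) (act2 H u)"
    and gamma: "f \<in> C1 A \<Longrightarrow>
      compositor H (one1 A (cod1 A f)) f \<odot> (unitor H (cod1 A f) \<lhd> act1 H f) = one2 C (act1 H f)"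
    and delta: "f \<in> C1 A \<Longrightarrow>
      compositor H f (one1 A (dom1 A f)) \<odot> (act1 H f \<rhd> unitor H (dom1 A f)) = one2 C (act1 H f)"
    and omega: "\<lbrakk>f \<in> C1 A; g \<in> C1 A; h \<in> C1 A; cod1 A f = dom1 A g; cod1 A g = dom1 A h\<rbrakk> \<Longrightarrow>
      compositor H (h \<bullet>\<^bsub>A\<^esub> g) f \<odot> (compositor H h g \<lhd> act1 H f)
        = compositor H h (g \<bullet>\<^bsub>A\<^esub> f) \<odot> (act1 H h \<rhd> compositor H g f)"
    and coherence: "\<lbrakk>f \<in> C1 A; g \<in> C1 A; h \<in> C1 A; k \<in> C1 A;
        cod1 A f = dom1 A g; cod1 A g = dom1 A h; cod1 A h = dom1 A k\<rbrakk> \<Longrightarrow>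
      ich C (compositor H k h) (compositor H g f)
        = one3 C ((act1 H (k \<bullet>\<^bsub>A\<^esub> h) \<rhd> compositor H g f)
            \<odot> (compositor H k h \<lhd> (act1 H g \<bullet> act1 H f)))"

lemma bifun_compose_sel [simp]:
  "bf1 (bifun_precompose M H) g f = bf1 M (act1 H g) (act1 H f)"
  "bf2l (bifun_precompose M H) v f = bf2l M (act2 H v) (act1 H f)"
  "bf2r (bifun_precompose M H) g u = bf2r M (act1 H g) (act2 H u)"
  "bf3l (bifun_precompose M H) \<Gamma> f = bf3l M (act3 H \<Gamma>) (act1 H f)"
  "bf3r (bifun_precompose M H) g \<Gamma> = bf3r M (act1 H g) (act3 H \<Gamma>)"
  "bfich (bifun_precompose M H) v u = bfich M (act2 H v) (act2 H u)"
  "bf1 (bifun_postcompose H N) g f = act1 H (bf1 N g f)"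
  "bf2l (bifun_postcompose H N) v f = act2 H (bf2l N v f)"
  "bf2r (bifun_postcompose H N) g u = act2 H (bf2r N g u)"
  "bf3l (bifun_postcompose H N) \<Gamma> f = act3 H (bf3l N \<Gamma> f)"
  "bf3r (bifun_postcompose H N) g \<Gamma> = act3 H (bf3r N g \<Gamma>)"
  "bfich (bifun_postcompose H N) v u = act3 H (bfich N v u)"
  by (simp_all add: bifun_precompose_def bifun_postcompose_def)

context gray_category
begin

lemma is1_iff: "is1 A f X Y \<longleftrightarrow> f \<in> C1 A \<and> X = dom1 A f \<and> Y = cod1 A f"
  by (auto simp: is1_def)

lemma is2_iff: "is2 A u f g \<longleftrightarrow> u \<in> C2 A \<and> f = dom2 A u \<and> g = cod2 A u"
  by (auto simp: is2_def)

lemma is3_iff: "is3 A \<Gamma> u v \<longleftrightarrow> \<Gamma> \<in> C3 A \<and> u = dom3 A \<Gamma> \<and> v = cod3 A \<Gamma>"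
  by (auto simp: is3_def)

section \<open>Agreement of the two formulations of 3-pseudofunctors\<close>

lemma arrow_pseudofunctor_imp:
  assumes "arrow_pseudofunctor A C H"
  shows "three_pseudofunctor A C H"
proof -
  interpret H: arrow_pseudofunctor A C H by fact
  have homs: "two_functor (hom A X Y) (hom C (act0 H X) (act0 H Y)) (act1 H) (act2 H) (act3 H)"
      for X Y
    apply (rule two_functor.intro)
    subgoal for f using H.mor[of f] by (simp add: is1_iff)
    subgoal for u f g using H.mor[of f] H.mor[of g] H.two[of u] by (simp add: is1_iff is2_iff)
    subgoal for \<Gamma> u v
      using H.mor[of "dom2 A u"] H.mor[of "cod2 A u"] H.two[of u] H.three[of \<Gamma>]
      by (simp add: is1_iff is3_iff is2_def[of C])
    subgoal for f using H.map_one2[of f] by (simp add: is1_iff)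
    subgoal for u using H.map_one3[of u] by simp
    subgoal for u f g v h using H.map_cmp2[of u v] by (simp add: is2_iff)
    subgoal for \<Gamma> u v \<Delta> using H.map_vcmp3[of \<Gamma> \<Delta>] by (simp add: is3_iff)
    subgoal for \<Gamma> u u' \<Delta> using H.map_hcmp3[of \<Gamma> \<Delta>] by (simp add: is3_iff)
    done
  have nat: "gray_bifun_two_natural (hom A Y Z) (hom A X Y) (hom C (act0 H X) (act0 H Z))
      (bifun_precompose (cmp_bifun C) H) (bifun_postcompose H (cmp_bifun A))
      (compositor H)" for X Y Z
    apply (rule gray_bifun_two_natural.intro)
    subgoal for g f
      using H.compositor_iso[of f g] H.cmp_mor[of f g] H.mor[of "g \<bullet>\<^bsub>A\<^esub> f"]
      by (simp add: is1_iff iso2_def)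
    subgoal for v g g' f using H.nat2l[of f v] by (simp add: is1_iff is2_iff)
    subgoal for g u f f' using H.nat2r[of u g] by (simp add: is1_iff is2_iff)
    subgoal for \<Gamma> v v' g g' f using H.nat3l[of f \<Gamma>] by (auto simp: is1_def is2_def is3_def)
    subgoal for g \<Gamma> u u' f f' using H.nat3r[of \<Gamma> g] by (auto simp: is1_def is2_def is3_def)
    subgoal for v g g' u f f' using H.nat_ich[of u v] by (auto simp: is1_def is2_def)
    done
  show ?thesis
    by (rule three_pseudofunctor.intro)
      (rule homs nat | fact H.ext H.obj H.unitor_iso
        | (auto simp: is1_iff intro!: H.compositor_iso H.gamma H.delta H.omega H.coherence)[1])+
qed

lemma three_pseudofunctor_imp:
  assumes "three_pseudofunctor A C H"
  shows "arrow_pseudofunctor A C H"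
proof -
  interpret H: three_pseudofunctor A C H by fact
  have hom: "two_functor (hom A (dom1 A f) (cod1 A f)) (hom C (act0 H (dom1 A f)) (act0 H
      (cod1 A f)))
      (act1 H) (act2 H) (act3 H)" if "f \<in> C1 A" for f
    using H.on_homs that by simp
  note hom2 = hom[OF boundary_two'(1)] and hom3 = hom[OF boundary_two'(1)[OF boundary_cell(1)]]
  have bi: "gray_bifun_two_natural (hom A (dom1 A g) (cod1 A g)) (hom A (dom1 A f) (cod1 A f))
      (hom C (act0 H (dom1 A f)) (act0 H (cod1 A g)))
        (bifun_precompose (cmp_bifun C) H) (bifun_postcompose H (cmp_bifun A)) (compositor H)"
    if "f \<in> C1 A" "g \<in> C1 A" "cod1 A f = dom1 A g" for f g
    using H.compositor_natural[of "dom1 A f" "dom1 A g" "cod1 A g"] that by simp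
  show ?thesis
    apply unfold_locales
                       apply (fact H.ext H.on_objects)+
    subgoal for f using two_functor.act1[OF hom[of f], of f] by (auto simp: is1_iff)
    subgoal for u
      using two_functor.act2[OF hom2[of u], of u "dom2 A u" "cod2 A u"]
      by (simp add: is1_iff is2_iff)
    subgoal for \<Gamma>
      using two_functor.act3[OF hom3[of \<Gamma>], of \<Gamma> "dom3 A \<Gamma>" "cod3 A \<Gamma>"]
      by (simp add: is1_iff is3_iff)
    \<comment> \<open>The typing of a composite in \<open>C\<close> is read off the source of the
      compositor, which is required to be an arrow of a hom of \<open>C\<close>.\<close>
    subgoal for f g
      using gray_bifun_two_natural.component[OF bi[of f g], of g f] by (simp add: is1_iff)
    subgoal for f using two_functor.map_one2[OF hom[of f], of f] by (simp add: is1_iff)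
    subgoal for u using two_functor.map_one3[OF hom2[of u], of u] by (simp add: is1_iff is2_iff)
    subgoal for u v
      using two_functor.map_cmp2[OF hom2[of u], of u "dom2 A u" "cod2 A u" v "cod2 A v"]
        boundary_two[of u] boundary_two[of v] by (simp add: is1_iff is2_iff)
    subgoal for \<Gamma> \<Delta>
      using two_functor.map_vcmp3[OF hom3[of \<Gamma>], of \<Gamma> "dom3 A \<Gamma>" "cod3 A \<Gamma>" \<Delta> "cod3 A \<Delta>"]
        boundary_cell[of \<Gamma>] by (simp add: is1_iff is3_iff)
    subgoal for \<Gamma> \<Delta>
      using two_functor.map_hcmp3[OF hom3[of \<Gamma>], of \<Gamma> "dom3 A \<Gamma>" "cod3 A \<Gamma>" \<Delta> "dom3 A \<Delta>" "cod3 A \<Delta>"]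
        boundary_two[of "dom3 A \<Gamma>"] boundary_two[of "dom3 A \<Delta>"] by (simp add: is1_iff is3_iff)
    subgoal by (rule H.unitor_iso)
    subgoal for f g by (auto simp: is1_iff intro!: H.compositor_iso)
    subgoal for f v
      using gray_bifun_two_natural.nat2l[OF bi[of f "dom2 A v"], of v "dom2 A v" "cod2 A v" f]
      by (simp add: is1_iff is2_iff)
    subgoal for u g
      using gray_bifun_two_natural.nat2r[OF bi[of "dom2 A u" g], of g u "dom2 A u" "cod2 A u"]
      by (simp add: is1_iff is2_iff)
    subgoal for f \<Gamma>
      using gray_bifun_two_natural.nat3l[OF bi[of f "dom2 A (dom3 A \<Gamma>)"], of \<Gamma> "dom3 A \<Gamma>" "cod3 A \<Gamma>"
          "dom2 A (dom3 A \<Gamma>)" "cod2 A (dom3 A \<Gamma>)" f]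
      by (simp add: is1_iff is2_iff is3_iff)
    subgoal for \<Gamma> g
      using gray_bifun_two_natural.nat3r[OF bi[of "dom2 A
        (dom3 A \<Gamma>)" g], of g \<Gamma> "dom3 A \<Gamma>" "cod3 A \<Gamma>"
          "dom2 A (dom3 A \<Gamma>)" "cod2 A (dom3 A \<Gamma>)"]
      by (simp add: is1_iff is2_iff is3_iff)
    subgoal for u v
      using gray_bifun_two_natural.nat_ich[OF bi[of "dom2 A u" "dom2 A v"], of v "dom2 A v"
        "cod2 A v"
          u "dom2 A u" "cod2 A u"]
      by (simp add: is1_iff is2_iff)
    subgoal for f by (rule H.gamma[OF is1_self])
    subgoal for f by (rule H.delta[OF is1_self])
    subgoal for f g h by (rule H.omega) (auto simp: is1_iff)
    subgoal for f g h k by (rule H.coherence) (auto simp: is1_iff)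
    done
qed

lemma three_pseudofunctor_iff: "three_pseudofunctor A C H \<longleftrightarrow> arrow_pseudofunctor A C H"
  using arrow_pseudofunctor_imp three_pseudofunctor_imp by blast

end


section \<open>The path object of 1-cells\<close>

lemma path1_sel [simp]:
  "C0 (path1 B) = C1 B" "C1 (path1 B) = p1_mors B" "C2 (path1 B) = p1_twos B"
  "C3 (path1 B) = p1_threes B"
  "dom1 (path1 B) = mdom" "cod1 (path1 B) = mcod" "dom2 (path1 B) = tdom" "cod2 (path1 B) = tcod"
  "dom3 (path1 B) = pdom" "cod3 (path1 B) = pcod"
  "one1 (path1 B) x = P1Mor x x (one1 B (dom1 B x)) (one1 B (cod1 B x)) (one_adj B x)"
  "one2 (path1 B) u = P1Two u u (one2 B (mor0 u)) (one2 B (mor1 u)) (one3 B (mlft u))"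
  "one3 (path1 B) \<phi> = PCell \<phi> \<phi> (one3 B (two0 \<phi>)) (one3 B (two1 \<phi>))"
  "cmp1 (path1 B) = p1_cmp1 B" "cmp2 (path1 B) = p1_cmp2 B"
  "lwh2 (path1 B) = p1_lwh2 B" "rwh2 (path1 B) = p1_rwh2 B"
  "vcmp3 (path1 B) \<Delta> \<Gamma> = PCell (pdom \<Gamma>) (pcod \<Delta>) (vcmp3 B (part0 \<Delta>) (part0 \<Gamma>)) (vcmp3 B (part1 \<Delta>)
    (part1 \<Gamma>))"
  "hcmp3 (path1 B) \<Delta> \<Gamma> = PCell (p1_cmp2 B (pdom \<Delta>) (pdom \<Gamma>)) (p1_cmp2 B (pcod \<Delta>) (pcod \<Gamma>))
      (hcmp3 B (part0 \<Delta>) (part0 \<Gamma>)) (hcmp3 B (part1 \<Delta>) (part1 \<Gamma>))"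
  "lwh3 (path1 B) h \<Gamma> = PCell (p1_lwh2 B h (pdom \<Gamma>)) (p1_lwh2 B h (pcod \<Gamma>))
      (lwh3 B (mor0 h) (part0 \<Gamma>)) (lwh3 B (mor1 h) (part1 \<Gamma>))"
  "rwh3 (path1 B) \<Gamma> h = PCell (p1_rwh2 B (pdom \<Gamma>) h) (p1_rwh2 B (pcod \<Gamma>) h)
      (rwh3 B (part0 \<Gamma>) (mor0 h)) (rwh3 B (part1 \<Gamma>) (mor1 h))"
  "ich (path1 B) \<psi> \<phi> = PCell
      (p1_cmp2 B (p1_lwh2 B (tcod \<psi>) \<phi>) (p1_rwh2 B \<psi> (tdom \<phi>)))
      (p1_cmp2 B (p1_rwh2 B \<psi> (tcod \<phi>)) (p1_lwh2 B (tdom \<psi>) \<phi>))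
      (ich B (two0 \<psi>) (two0 \<phi>)) (ich B (two1 \<psi>) (two1 \<phi>))"
  by (simp_all add: path1_def)

lemma p1_op_sel [simp]:
  "mdom (p1_cmp1 B u' u) = mdom u" "mcod (p1_cmp1 B u' u) = mcod u'"
  "mor0 (p1_cmp1 B u' u) = cmp1 B (mor0 u') (mor0 u)"
  "mor1 (p1_cmp1 B u' u) = cmp1 B (mor1 u') (mor1 u)"
  "mlft (p1_cmp1 B u' u) = cmp2 B (lwh2 B (mor1 u') (mlft u)) (rwh2 B (mlft u') (mor0 u))"
  "tdom (p1_cmp2 B \<psi> \<phi>) = tdom \<phi>" "tcod (p1_cmp2 B \<psi> \<phi>) = tcod \<psi>"
  "two0 (p1_cmp2 B \<psi> \<phi>) = cmp2 B (two0 \<psi>) (two0 \<phi>)"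
  "two1 (p1_cmp2 B \<psi> \<phi>) = cmp2 B (two1 \<psi>) (two1 \<phi>)"
  "tdom (p1_lwh2 B h \<phi>) = p1_cmp1 B h (tdom \<phi>)" "tcod (p1_lwh2 B h \<phi>) = p1_cmp1 B h (tcod \<phi>)"
  "two0 (p1_lwh2 B h \<phi>) = lwh2 B (mor0 h) (two0 \<phi>)"
  "two1 (p1_lwh2 B h \<phi>) = lwh2 B (mor1 h) (two1 \<phi>)"
  "tdom (p1_rwh2 B \<psi> h) = p1_cmp1 B (tdom \<psi>) h" "tcod (p1_rwh2 B \<psi> h) = p1_cmp1 B (tcod \<psi>) h"
  "two0 (p1_rwh2 B \<psi> h) = rwh2 B (two0 \<psi>) (mor0 h)"
  "two1 (p1_rwh2 B \<psi> h) = rwh2 B (two1 \<psi>) (mor1 h)"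
  by (simp_all add: p1_cmp1_def p1_cmp2_def p1_lwh2_def p1_rwh2_def cmp_adj_def lwh_adj_def
    rwh_adj_def)

context gray_category
begin

section \<open>Membership in the path object of 1-cells, through selectors\<close>

lemma p1_mors_iff: "u \<in> p1_mors A \<longleftrightarrow> mdom u \<in> C1 A \<and> mcod u \<in> C1 A \<and>
    mor0 u \<in> C1 A \<and> dom1 A (mor0 u) = dom1 A (mdom u) \<and> cod1 A (mor0 u) = dom1 A (mcod u) \<and>
    mor1 u \<in> C1 A \<and> dom1 A (mor1 u) = cod1 A (mdom u) \<and> cod1 A (mor1 u) = cod1 A (mcod u) \<and>
    adj_equiv A (madj u) (mcod u \<bullet> mor0 u) (mor1 u \<bullet> mdom u)"
  by (cases u) (auto simp: p1_mors_def is1_def adj_equiv_hom)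

lemma p1_mors_simps [simp]:
  assumes "u \<in> p1_mors A"
  shows "mdom u \<in> C1 A" "mcod u \<in> C1 A" "mor0 u \<in> C1 A" "mor1 u \<in> C1 A"
    "dom1 A (mor0 u) = dom1 A (mdom u)" "cod1 A (mor0 u) = dom1 A (mcod u)"
    "dom1 A (mor1 u) = cod1 A (mdom u)" "cod1 A (mor1 u) = cod1 A (mcod u)"
    "mlft u \<in> C2 A" "dom2 A (mlft u) = mcod u \<bullet> mor0 u" "cod2 A (mlft u) = mor1 u \<bullet> mdom u"
  using assms by (auto simp: p1_mors_iff adj_equiv_iff)

lemma p1_mors_adj: "u \<in> p1_mors A \<Longrightarrow> adj_equiv A (madj u) (mcod u \<bullet> mor0 u) (mor1 u \<bullet> mdom u)"
  using p1_mors_iff by blast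

lemma p1_twos_iff: "\<phi> \<in> p1_twos A \<longleftrightarrow> tdom \<phi> \<in> p1_mors A \<and> tcod \<phi> \<in> p1_mors A \<and>
    mdom (tcod \<phi>) = mdom (tdom \<phi>) \<and> mcod (tcod \<phi>) = mcod (tdom \<phi>) \<and>
    two0 \<phi> \<in> C2 A \<and> dom2 A (two0 \<phi>) = mor0 (tdom \<phi>) \<and> cod2 A (two0 \<phi>) = mor0 (tcod \<phi>) \<and>
    two1 \<phi> \<in> C2 A \<and> dom2 A (two1 \<phi>) = mor1 (tdom \<phi>) \<and> cod2 A (two1 \<phi>) = mor1 (tcod \<phi>) \<and>
    invertible3 A (tsq \<phi>) \<and> tsq \<phi> \<in> C3 A \<and>
    dom3 A (tsq \<phi>) = mlft (tcod \<phi>) \<odot> (mcod (tdom \<phi>) \<rhd> two0 \<phi>) \<and>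
    cod3 A (tsq \<phi>) = (two1 \<phi> \<lhd> mdom (tdom \<phi>)) \<odot> mlft (tdom \<phi>)"
  by (cases \<phi>) (auto simp: p1_twos_def is2_def is3_def iso3_iff)

lemma p1_twos_simps [simp]:
  assumes "\<phi> \<in> p1_twos A"
  shows "tdom \<phi> \<in> p1_mors A" "tcod \<phi> \<in> p1_mors A"
    "mdom (tcod \<phi>) = mdom (tdom \<phi>)" "mcod (tcod \<phi>) = mcod (tdom \<phi>)"
    "two0 \<phi> \<in> C2 A" "dom2 A (two0 \<phi>) = mor0 (tdom \<phi>)" "cod2 A (two0 \<phi>) = mor0 (tcod \<phi>)"
    "two1 \<phi> \<in> C2 A" "dom2 A (two1 \<phi>) = mor1 (tdom \<phi>)" "cod2 A (two1 \<phi>) = mor1 (tcod \<phi>)"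
    "invertible3 A (tsq \<phi>)" "tsq \<phi> \<in> C3 A"
    "dom3 A (tsq \<phi>) = mlft (tcod \<phi>) \<odot> (mcod (tdom \<phi>) \<rhd> two0 \<phi>)"
    "cod3 A (tsq \<phi>) = (two1 \<phi> \<lhd> mdom (tdom \<phi>)) \<odot> mlft (tdom \<phi>)"
  using assms by (auto simp: p1_twos_iff)

lemma p1_threes_iff: "\<Gamma> \<in> p1_threes A \<longleftrightarrow> pdom \<Gamma> \<in> p1_twos A \<and> pcod \<Gamma> \<in> p1_twos A \<and>
    tdom (pcod \<Gamma>) = tdom (pdom \<Gamma>) \<and> tcod (pcod \<Gamma>) = tcod (pdom \<Gamma>) \<and>
    part0 \<Gamma> \<in> C3 A \<and> dom3 A (part0 \<Gamma>) = two0 (pdom \<Gamma>) \<and> cod3 A (part0 \<Gamma>) = two0 (pcod \<Gamma>) \<and>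
    part1 \<Gamma> \<in> C3 A \<and> dom3 A (part1 \<Gamma>) = two1 (pdom \<Gamma>) \<and> cod3 A (part1 \<Gamma>) = two1 (pcod \<Gamma>) \<and>
    tsq (pcod \<Gamma>) \<cdot> (mlft (tcod (pdom \<Gamma>)) \<odot>\<rhd> (mcod (tdom (pdom \<Gamma>)) \<unrhd> part0 \<Gamma>))
      = ((part1 \<Gamma> \<unlhd> mdom (tdom (pdom \<Gamma>))) \<lhd>\<odot> mlft (tdom (pdom \<Gamma>))) \<cdot> tsq (pdom \<Gamma>)"
  by (cases \<Gamma>) (auto simp: p1_threes_def is2_def is3_def)

lemma p1_one1_mem: "x \<in> C1 A \<Longrightarrow> one1 (path1 A) x \<in> p1_mors A"
  using adj_equiv_one_adj[of x] by (simp add: p1_mors_iff)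

lemma p1_cmp1_mem [simp]:
  assumes "u \<in> p1_mors A" "u' \<in> p1_mors A" "mcod u = mdom u'"
  shows "p1_cmp1 A u' u \<in> p1_mors A"
proof -
  have "adj_equiv A (cmp_adj A (lwh_adj A (mor1 u') (madj u)) (rwh_adj A (madj u') (mor0 u)))
     ((mcod u' \<bullet> mor0 u') \<bullet> mor0 u) (mor1 u' \<bullet> (mor1 u \<bullet> mdom u))"
    using adj_equiv_rwh_adj[OF p1_mors_adj[OF assms(2)], of "mor0 u"]
      adj_equiv_lwh_adj[OF p1_mors_adj[OF assms(1)], of "mor1 u'"] assms
    \<comment> \<open>The 1-cell at which the whiskered adjoint equivalences meet:
      \<open>mdom u'\<close> is also \<open>mcod u\<close>.\<close>
    by (intro adj_equiv_cmp_adj[where g = "mor1 u' \<bullet> mdom u' \<bullet> mor0 u"]) simp_all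
  then show ?thesis
    using assms by (subst p1_mors_iff) (simp add: p1_cmp1_def)
qed

section \<open>Strict associativity and units for 1-cells of the path object\<close>

lemma lwh_adj_cmp_adj:
  assumes "adj_equiv A e f g" "adj_equiv A e' g h" "k \<in> C1 A" "cod1 A f = dom1 A k" "f \<in> C1 A"
  shows "lwh_adj A k (cmp_adj A e' e) = cmp_adj A (lwh_adj A k e') (lwh_adj A k e)"
proof -
  have *: "lft e \<in> C2 A" "lft e' \<in> C2 A" "rgt e \<in> C2 A" "rgt e' \<in> C2 A"
    using assms by (auto simp: adj_equiv_iff)
  note b = this[THEN boundary_two(2)] this[THEN boundary_two'(1)] this[THEN boundary_two'(2)]
  show ?thesis
    using assms b by (cases e; cases e') (clarsimp simp: lwh_adj_def cmp_adj_def adj_equiv_iff)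
qed

lemma rwh_adj_cmp_adj:
  assumes "adj_equiv A e f g" "adj_equiv A e' g h" "k \<in> C1 A" "dom1 A f = cod1 A k" "f \<in> C1 A"
  shows "rwh_adj A (cmp_adj A e' e) k = cmp_adj A (rwh_adj A e' k) (rwh_adj A e k)"
proof -
  have *: "lft e \<in> C2 A" "lft e' \<in> C2 A" "rgt e \<in> C2 A" "rgt e' \<in> C2 A"
    using assms by (auto simp: adj_equiv_iff)
  note b = this[THEN boundary_two(1)] this[THEN boundary_two'(1)] this[THEN boundary_two'(2)]
  show ?thesis
    using assms b by (cases e; cases e') (clarsimp simp: rwh_adj_def cmp_adj_def adj_equiv_iff)
qed

lemma whisker_adj_assoc:
  assumes "adj_equiv A e f g" "f \<in> C1 A"
  shows "\<lbrakk>h \<in> C1 A; k \<in> C1 A; cod1 A f = dom1 A h; cod1 A h = dom1 A k\<rbrakk>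
      \<Longrightarrow> lwh_adj A k (lwh_adj A h e) = lwh_adj A (k \<bullet> h) e"
    "\<lbrakk>h \<in> C1 A; k \<in> C1 A; cod1 A f = dom1 A h; cod1 A k = dom1 A f\<rbrakk>
      \<Longrightarrow> rwh_adj A (lwh_adj A h e) k = lwh_adj A h (rwh_adj A e k)"
    "\<lbrakk>h \<in> C1 A; k \<in> C1 A; cod1 A h = dom1 A f; cod1 A k = dom1 A h\<rbrakk>
      \<Longrightarrow> rwh_adj A (rwh_adj A e h) k = rwh_adj A e (h \<bullet> k)"
proof -
  have *: "lft e \<in> C2 A" "rgt e \<in> C2 A"
    using assms by (auto simp: adj_equiv_iff)
  note b = this[THEN boundary_two(1)] this[THEN boundary_two(2)] this[THEN boundary_two'(1)]
      this[THEN boundary_two'(2)]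
  { assume "h \<in> C1 A" "k \<in> C1 A" "cod1 A f = dom1 A h" "cod1 A h = dom1 A k"
    then show "lwh_adj A k (lwh_adj A h e) = lwh_adj A (k \<bullet> h) e"
    using assms b by (cases e) (clarsimp simp: rwh_adj_def lwh_adj_def adj_equiv_iff) }
  { assume "h \<in> C1 A" "k \<in> C1 A" "cod1 A f = dom1 A h" "cod1 A k = dom1 A f"
    then show "rwh_adj A (lwh_adj A h e) k = lwh_adj A h (rwh_adj A e k)"
    using assms b by (cases e) (clarsimp simp: rwh_adj_def lwh_adj_def adj_equiv_iff) }
  { assume "h \<in> C1 A" "k \<in> C1 A" "cod1 A h = dom1 A f" "cod1 A k = dom1 A h"
    then show "rwh_adj A (rwh_adj A e h) k = rwh_adj A e (h \<bullet> k)"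
    using assms b by (cases e) (clarsimp simp: rwh_adj_def lwh_adj_def adj_equiv_iff) }
qed

text \<open>Whiskering distributes over composites of adjoint equivalences, so both bracketings are
  composites of the same three whiskered equivalences, coming from \<open>w\<close>,
  \<open>v\<close> and \<open>u\<close>. These agree by \<open>cmp_adj_assoc\<close>.\<close>

lemma p1_cmp1_assoc:
  assumes "u \<in> p1_mors A" "v \<in> p1_mors A" "w \<in> p1_mors A" "mcod u = mdom v" "mcod v = mdom w"
  shows "p1_cmp1 A (p1_cmp1 A w v) u = p1_cmp1 A w (p1_cmp1 A v u)"
proof -
  note [simp] = assms
  have U: "adj_equiv A (madj u) (mdom v \<bullet> mor0 u) (mor1 u \<bullet> mdom u)"
    and V: "adj_equiv A (madj v) (mdom w \<bullet> mor0 v) (mor1 v \<bullet> mdom v)"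
    and W: "adj_equiv A (madj w) (mcod w \<bullet> mor0 w) (mor1 w \<bullet> mdom w)"
    using assms(1-3)[THEN p1_mors_adj] by simp_all
  have Wv: "adj_equiv A (rwh_adj A (madj w) (mor0 v)) (mcod w \<bullet> mor0 w \<bullet> mor0 v)
      (mor1 w \<bullet> mdom w \<bullet> mor0 v)"
    and Wvu: "adj_equiv A (rwh_adj A (madj w) (mor0 v \<bullet> mor0 u)) (mcod w \<bullet> mor0 w \<bullet> mor0 v \<bullet> mor0 u)
      (mor1 w \<bullet> mdom w \<bullet> mor0 v \<bullet> mor0 u)"
    and Vu: "adj_equiv A (rwh_adj A (madj v) (mor0 u)) (mdom w \<bullet> mor0 v \<bullet> mor0 u)
        (mor1 v \<bullet> mdom v \<bullet> mor0 u)"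
    and wV: "adj_equiv A (lwh_adj A (mor1 w) (madj v)) (mor1 w \<bullet> mdom w \<bullet> mor0 v)
        (mor1 w \<bullet> mor1 v \<bullet> mdom v)"
    and vU: "adj_equiv A (lwh_adj A (mor1 v) (madj u)) (mor1 v \<bullet> mdom v \<bullet> mor0 u)
        (mor1 v \<bullet> mor1 u \<bullet> mdom u)"
    and wvU: "adj_equiv A (lwh_adj A (mor1 w \<bullet> mor1 v) (madj u)) (mor1 w \<bullet> mor1 v \<bullet> mdom v \<bullet> mor0 u)
      (mor1 w \<bullet> mor1 v \<bullet> mor1 u \<bullet> mdom u)"
    using adj_equiv_rwh_adj[OF W, of "mor0 v"] adj_equiv_rwh_adj[OF W, of "mor0 v \<bullet> mor0 u"]
      adj_equiv_rwh_adj[OF V, of "mor0 u"] adj_equiv_lwh_adj[OF V, of "mor1 w"]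
      adj_equiv_lwh_adj[OF U, of "mor1 v"] adj_equiv_lwh_adj[OF U, of "mor1 w \<bullet> mor1 v"] by simp_all
  have wVu: "adj_equiv A (lwh_adj A (mor1 w) (rwh_adj A (madj v) (mor0 u)))
      (mor1 w \<bullet> mdom w \<bullet> mor0 v \<bullet> mor0 u) (mor1 w \<bullet> mor1 v \<bullet> mdom v \<bullet> mor0 u)"
    using adj_equiv_lwh_adj[OF Vu, of "mor1 w"] by simp
  have "rwh_adj A (cmp_adj A (lwh_adj A (mor1 w) (madj v)) (rwh_adj A (madj w) (mor0 v))) (mor0 u)
      = cmp_adj A (lwh_adj A (mor1 w) (rwh_adj A (madj v) (mor0 u)))
      (rwh_adj A (madj w) (mor0 v \<bullet> mor0 u))"
    using rwh_adj_cmp_adj[OF Wv wV, of "mor0 u"] whisker_adj_assoc(2)[OF V, of "mor1 w" "mor0 u"]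
      whisker_adj_assoc(3)[OF W, of "mor0 v" "mor0 u"] by simp
  moreover have "lwh_adj A (mor1 w) (cmp_adj A (lwh_adj A (mor1 v) (madj u)) (rwh_adj A (madj v)
      (mor0 u)))
      = cmp_adj A (lwh_adj A (mor1 w \<bullet> mor1 v) (madj u))
      (lwh_adj A (mor1 w) (rwh_adj A (madj v) (mor0 u)))"
    using lwh_adj_cmp_adj[OF Vu vU, of "mor1 w"] whisker_adj_assoc(1)[OF U, of "mor1 v" "mor1 w"]
    by simp
  ultimately show ?thesis
    using cmp_adj_assoc[OF Wvu wVu wvU] by (simp add: p1_cmp1_def)
qed

lemma whisker_one_adj:
  "x \<in> C1 A \<Longrightarrow> h \<in> C1 A \<Longrightarrow> cod1 A x = dom1 A h \<Longrightarrow> lwh_adj A h (one_adj A x) = one_adj A (h \<bullet> x)"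
  "x \<in> C1 A \<Longrightarrow> h \<in> C1 A \<Longrightarrow> cod1 A h = dom1 A x \<Longrightarrow> rwh_adj A (one_adj A x) h = one_adj A (x \<bullet> h)"
  by (simp_all add: lwh_adj_def rwh_adj_def one_adj_def)

lemma one_whisker_adj:
  assumes "adj_equiv A e f g" "f \<in> C1 A"
  shows "cod1 A f = Y \<Longrightarrow> lwh_adj A (one1 A Y) e = e" "dom1 A f = X \<Longrightarrow> rwh_adj A e (one1 A X) = e"
proof -
  have *: "lft e \<in> C2 A" "rgt e \<in> C2 A" "dom2 A (lft e) = f" "dom2 A (rgt e) = g"
      "cod2 A (lft e) = g"
    using assms by (auto simp: adj_equiv_iff)
  note b = boundary_two[OF *(1)]
  { assume "cod1 A f = Y" then show "lwh_adj A (one1 A Y) e = e"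
    using assms b * by (cases e) (clarsimp simp: lwh_adj_def adj_equiv_iff) }
  { assume "dom1 A f = X" then show "rwh_adj A e (one1 A X) = e"
    using assms b * by (cases e) (clarsimp simp: rwh_adj_def adj_equiv_iff) }
qed

lemma p1_cmp1_one:
  assumes "u \<in> p1_mors A"
  shows "mdom u = x \<Longrightarrow> p1_cmp1 A u (one1 (path1 A) x) = u"
    "mcod u = x \<Longrightarrow> p1_cmp1 A (one1 (path1 A) x) u = u"
proof -
  note U = p1_mors_adj[OF assms]
  { assume "mdom u = x"
    then have x: "x = mdom u" by simp
    show "p1_cmp1 A u (one1 (path1 A) x) = u"
      unfolding x using assms U whisker_one_adj(1)[of "mdom u" "mor1 u"] one_whisker_adj(2)[OF U]
        cmp_adj_one[OF U]
    by (simp add: p1_cmp1_def p1mor.expand) }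
  { assume "mcod u = x"
    then have x: "x = mcod u" by simp
    show "p1_cmp1 A (one1 (path1 A) x) u = u"
      unfolding x using assms U whisker_one_adj(2)[of "mcod u" "mor0 u"] one_whisker_adj(1)[OF U]
        cmp_adj_one[OF U]
    by (simp add: p1_cmp1_def p1mor.expand) }
qed

section \<open>Composition of 2-cells, and inverses over identities\<close>

lemma p1_cmp2_assoc:
  assumes "\<phi> \<in> p1_twos A" "\<psi> \<in> p1_twos A" "\<theta> \<in> p1_twos A" "tcod \<phi> = tdom \<psi>" "tcod \<psi> = tdom \<theta>"
  shows "p1_cmp2 A (p1_cmp2 A \<theta> \<psi>) \<phi> = p1_cmp2 A \<theta> (p1_cmp2 A \<psi> \<phi>)"
proof -
  have "mcod (tdom \<psi>) = mcod (tdom \<phi>)" "mdom (tdom \<psi>) = mdom (tdom \<phi>)"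
    "mcod (tdom \<theta>) = mcod (tdom \<phi>)" "mdom (tdom \<theta>) = mdom (tdom \<phi>)"
    using assms p1_twos_simps(3,4)[OF assms(1)] p1_twos_simps(3,4)[OF assms(2)] by simp_all
  then show ?thesis
    using assms by (simp add: p1_cmp2_def)
qed

text \<open>Pasting of two commuting squares along the common side \<open>y\<close>. It derives
  naturality at a composite 2-cell from naturality at its factors.\<close>

lemma p1_cmp2_paste:
  assumes "a \<in> p1_twos A" "b \<in> p1_twos A" "\<phi> \<in> p1_twos A" "\<psi> \<in> p1_twos A"
    "x \<in> p1_twos A" "y \<in> p1_twos A" "z \<in> p1_twos A"
    "tcod x = tdom a" "tcod a = tdom b" "tcod \<phi> = tdom \<psi>" "tcod \<psi> = tdom z"
    "tcod \<phi> = tdom y" "tcod y = tdom b"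
    and "p1_cmp2 A a x = p1_cmp2 A y \<phi>" "p1_cmp2 A b y = p1_cmp2 A z \<psi>"
  shows "p1_cmp2 A (p1_cmp2 A b a) x = p1_cmp2 A z (p1_cmp2 A \<psi> \<phi>)"
  using assms p1_cmp2_assoc[of x a b] p1_cmp2_assoc[of \<phi> y b] p1_cmp2_assoc[of \<phi> \<psi> z] by metis

lemma p1_lwh2_mem [simp]:
  assumes "\<phi> \<in> p1_twos A" "h \<in> p1_mors A" "mcod (tdom \<phi>) = mdom h"
  shows "p1_lwh2 A h \<phi> \<in> p1_twos A"
  using assms by (subst p1_twos_iff) (simp add: p1_lwh2_def)

lemma p1_rwh2_mem [simp]:
  assumes "\<phi> \<in> p1_twos A" "h \<in> p1_mors A" "mcod h = mdom (tdom \<phi>)"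
  shows "p1_rwh2 A \<phi> h \<in> p1_twos A"
  using assms by (subst p1_twos_iff) (simp add: p1_rwh2_def)

text \<open>The components are kept and only the square is inverted, so this is an inverse for
  2-cells lying over identities.\<close>

definition p1_inv :: "('f, 'a, 'g) p1two \<Rightarrow> ('f, 'a, 'g) p1two" where
  "p1_inv \<phi> = P1Two (tcod \<phi>) (tdom \<phi>) (two0 \<phi>) (two1 \<phi>) (inv3 A (tsq \<phi>))"

text \<open>Unitors and compositors over strict functors have this form.\<close>

definition p1_identical :: "('f, 'a, 'g) p1two \<Rightarrow> bool" where
  "p1_identical \<phi> \<longleftrightarrow> two0 \<phi> = one2 A (mor0 (tdom \<phi>)) \<and> two1 \<phi> = one2 A (mor1 (tdom \<phi>))"

text \<open>Over identities the whiskered components disappear from the boundary of the square, and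
  a 3-cell from the left adjoint of the target to that of the source remains.\<close>

lemma p1_identical_simps:
  assumes "\<phi> \<in> p1_twos A" "p1_identical \<phi>"
  shows "mor0 (tcod \<phi>) = mor0 (tdom \<phi>)" (is ?mor0) "mor1 (tcod \<phi>) = mor1 (tdom \<phi>)" (is ?mor1)
    "two0 \<phi> = one2 A (mor0 (tdom \<phi>))" (is ?two0) "two1 \<phi> = one2 A (mor1 (tdom \<phi>))" (is ?two1)
    "mlft (tdom \<phi>) \<in> C2 A" (is ?l) "dom2 A (mlft (tdom \<phi>))
      = mcod (tdom \<phi>) \<bullet> mor0 (tdom \<phi>)" (is ?dom_l)
    "cod2 A (mlft (tdom \<phi>)) = mor1 (tdom \<phi>) \<bullet> mdom (tdom \<phi>)" (is ?cod_l)
    "mlft (tcod \<phi>) \<in> C2 A" (is ?l') "dom2 A (mlft (tcod \<phi>))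
      = mcod (tdom \<phi>) \<bullet> mor0 (tdom \<phi>)" (is ?dom_l')
    "cod2 A (mlft (tcod \<phi>)) = mor1 (tdom \<phi>) \<bullet> mdom (tdom \<phi>)" (is ?cod_l')
    "dom3 A (tsq \<phi>) = mlft (tcod \<phi>)" "cod3 A (tsq \<phi>) = mlft (tdom \<phi>)"
proof -
  show i: ?two0 ?two1
    using assms(2) by (simp_all add: p1_identical_def)
  show c: ?mor0 ?mor1
    using p1_twos_simps(7,10)[OF assms(1)] assms by (simp_all add: i)
  show l: ?l ?dom_l ?cod_l ?l' ?dom_l' ?cod_l'
    using assms c by simp_all
  show "dom3 A (tsq \<phi>) = mlft (tcod \<phi>)" "cod3 A (tsq \<phi>) = mlft (tdom \<phi>)"
    using assms(1) l by (simp_all add: i)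
qed

lemma p1_inv:
  assumes "\<phi> \<in> p1_twos A" "p1_identical \<phi>"
  shows "p1_inv \<phi> \<in> p1_twos A"
    "p1_cmp2 A (p1_inv \<phi>) \<phi> = one2 (path1 A) (tdom \<phi>)"
    "p1_cmp2 A \<phi> (p1_inv \<phi>) = one2 (path1 A) (tcod \<phi>)"
proof -
  note a = p1_identical_simps[OF assms]
  show "p1_inv \<phi> \<in> p1_twos A"
    using assms(1) a by (subst p1_twos_iff) (simp add: p1_inv_def)
  show "p1_cmp2 A (p1_inv \<phi>) \<phi> = one2 (path1 A) (tdom \<phi>)"
      "p1_cmp2 A \<phi> (p1_inv \<phi>) = one2 (path1 A) (tcod \<phi>)"
    using assms(1) a by (simp_all add: p1_cmp2_def p1_inv_def)
qed

text \<open>Supplies the strict invertibility demanded of unitors and compositors.\<close>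

lemma p1_iso2I:
  assumes "\<phi> \<in> p1_twos A" "p1_identical \<phi>"
  shows "iso2 (path1 A) \<phi> (tdom \<phi>) (tcod \<phi>)"
  using assms p1_inv[OF assms] by (auto simp: iso2_def is2_def p1_inv_def intro!: exI[of _
    "p1_inv \<phi>"])

end


section \<open>Trinatural transformations\<close>

definition p1_mor :: "('o, 'f, 'a, 'g) gray \<Rightarrow> ('o, 'f, 'a, 'g, 'p, 'h, 'b, 'k) gmap \<Rightarrow>
    ('o, 'f, 'a, 'g, 'p, 'h, 'b, 'k) gmap \<Rightarrow> ('o, 'f, 'a, 'h, 'b, 'k) trinat \<Rightarrow> 'f \<Rightarrow> ('h, 'b, 'k)
    p1mor" where
  "p1_mor A F G p f = P1Mor (tr0 p (dom1 A f)) (tr0 p (cod1 A f)) (act1 F f) (act1 G f) (tradj p f)"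

definition p1_two :: "('o, 'f, 'a, 'g) gray \<Rightarrow> ('o, 'f, 'a, 'g, 'p, 'h, 'b, 'k) gmap \<Rightarrow>
    ('o, 'f, 'a, 'g, 'p, 'h, 'b, 'k) gmap \<Rightarrow> ('o, 'f, 'a, 'h, 'b, 'k) trinat \<Rightarrow> 'a \<Rightarrow> ('h, 'b, 'k)
    p1two" where
  "p1_two A F G p u = P1Two (p1_mor A F G p (dom2 A u)) (p1_mor A F G p (cod2 A u))
    (act2 F u) (act2 G u) (tr2 p u)"

text \<open>The bijection at the level of transformations. Unitors and compositors lie over
  identities since those of \<open>F\<close> and \<open>G\<close> are identities, and their squares
  are inverses because they run against \<open>trunit\<close> and \<open>trcmp\<close>.\<close>

definition pseudo1 where
  "pseudo1 A B F G p = \<lparr>act0 = tr0 p,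
    act1 = restrict (p1_mor A F G p) (C1 A),
    act2 = restrict (p1_two A F G p) (C2 A),
    act3 = (\<lambda>\<Gamma>\<in>C3 A. PCell (p1_two A F G p (dom3 A \<Gamma>)) (p1_two A F G p (cod3 A \<Gamma>)) (act3 F \<Gamma>) (act3
    G \<Gamma>)),
    unitor = (\<lambda>X\<in>C0 A. P1Two (one1 (path1 B) (tr0 p X)) (p1_mor A F G p (one1 A X))
      (one2 B (one1 B (act0 F X))) (one2 B (one1 B (act0 G X))) (inv3 B (trunit p X))),
    compositor = (\<lambda>g f. if composable A g f
      then P1Two (p1_cmp1 B (p1_mor A F G p g) (p1_mor A F G p f)) (p1_mor A F G p (cmp1 A g f))
        (one2 B (cmp1 B (act1 F g) (act1 F f))) (one2 B (cmp1 B (act1 G g) (act1 G f)))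
        (inv3 B (trcmp p g f))
      else undefined)\<rparr>"

locale two_gray_functors =
  F: gray_functor_between A B F + G: gray_functor_between A B G
  for A :: "('o, 'f, 'a, 'g) gray" and B :: "('p, 'h, 'b, 'k) gray" (structure)
    and F :: "('o, 'f, 'a, 'g, 'p, 'h, 'b, 'k) gmap"
    and G :: "('o, 'f, 'a, 'g, 'p, 'h, 'b, 'k) gmap"

text \<open>The typed data without the equations. They already type the 1-cells and 2-cells of the
  associated pseudofunctor, so that each axiom can be compared with one of its equations
  separately.\<close>

locale trinat_data = two_gray_functors A B F G
  for A :: "('o, 'f, 'a, 'g) gray" and B :: "('p, 'h, 'b, 'k) gray" (structure)
    and F :: "('o, 'f, 'a, 'g, 'p, 'h, 'b, 'k) gmap"
    and G :: "('o, 'f, 'a, 'g, 'p, 'h, 'b, 'k) gmap" +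
  fixes p :: "('o, 'f, 'a, 'h, 'b, 'k) trinat"
  assumes ext: "tr0 p \<in> extensional (C0 A)" "tradj p \<in> extensional (C1 A)"
      "tr2 p \<in> extensional (C2 A)" "trunit p \<in> extensional (C0 A)"
      "\<not> composable A g f \<Longrightarrow> trcmp p g f = undefined"
    and component: "X \<in> C0 A \<Longrightarrow> is1 B (tr0 p X) (act0 F X) (act0 G X)"
    and adjoint: "f \<in> C1 A \<Longrightarrow> adj_equiv B (tradj p f)
      (tr0 p (cod1 A f) \<bullet> act1 F f) (act1 G f \<bullet> tr0 p (dom1 A f))"
    and naturality: "u \<in> C2 A \<Longrightarrow> iso3 B (tr2 p u)
      (tr1 p (cod2 A u) \<odot> (tr0 p (cod1 A (dom2 A u)) \<rhd> act2 F u))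
      ((act2 G u \<lhd> tr0 p (dom1 A (dom2 A u))) \<odot> tr1 p (dom2 A u))"
    and unitor: "X \<in> C0 A \<Longrightarrow> iso3 B (trunit p X) (one2 B (tr0 p X)) (tr1 p (one1 A X))"
    and compositor: "\<lbrakk>f \<in> C1 A; g \<in> C1 A; cod1 A f = dom1 A g\<rbrakk> \<Longrightarrow> iso3 B (trcmp p g f)
      ((act1 G g \<rhd> tr1 p f) \<odot> (tr1 p g \<lhd> act1 F f)) (tr1 p (g \<bullet>\<^bsub>A\<^esub> f))"
begin

lemma tr0_simps [simp]:
  assumes "X \<in> C0 A"
  shows "tr0 p X \<in> C1 B" "dom1 B (tr0 p X) = act0 F X" "cod1 B (tr0 p X) = act0 G X"
  using component[OF assms] by (auto simp: is1_def)

lemma tr1_simps [simp]: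
  assumes "f \<in> C1 A"
  shows "tr1 p f \<in> C2 B" "dom2 B (tr1 p f) = tr0 p (cod1 A f) \<bullet> act1 F f"
    "cod2 B (tr1 p f) = act1 G f \<bullet> tr0 p (dom1 A f)"
  using adjoint[OF assms] by (auto simp: F.B.adj_equiv_iff)

lemma tr2_simps [simp]:
  assumes "u \<in> C2 A"
  shows "invertible3 B (tr2 p u)" "tr2 p u \<in> C3 B"
    "dom3 B (tr2 p u) = tr1 p (cod2 A u) \<odot> (tr0 p (cod1 A (dom2 A u)) \<rhd> act2 F u)"
    "cod3 B (tr2 p u) = (act2 G u \<lhd> tr0 p (dom1 A (dom2 A u))) \<odot> tr1 p (dom2 A u)"
  using naturality[OF assms] by (auto simp: iso3_iff is3_def)

lemma trunit_simps [simp]: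
  assumes "X \<in> C0 A"
  shows "invertible3 B (trunit p X)" "trunit p X \<in> C3 B"
    "dom3 B (trunit p X) = one2 B (tr0 p X)" "cod3 B (trunit p X) = tr1 p (one1 A X)"
  using unitor[OF assms] by (auto simp: iso3_iff is3_def)

lemma trcmp_simps [simp]:
  assumes "f \<in> C1 A" "g \<in> C1 A" "cod1 A f = dom1 A g"
  shows "invertible3 B (trcmp p g f)" "trcmp p g f \<in> C3 B"
    "dom3 B (trcmp p g f) = (act1 G g \<rhd> tr1 p f) \<odot> (tr1 p g \<lhd> act1 F f)"
    "cod3 B (trcmp p g f) = tr1 p (g \<bullet>\<^bsub>A\<^esub> f)"
  using compositor[OF assms] by (auto simp: iso3_iff is3_def)

abbreviation "m \<equiv> p1_mor A F G p"
abbreviation "t \<equiv> p1_two A F G p"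
abbreviation "P \<equiv> pseudo1 A B F G p"
abbreviation "\<iota> \<equiv> unitor P"
abbreviation "\<chi> \<equiv> compositor P"

lemma p1_mor_sel [simp]:
  "mdom (m f) = tr0 p (dom1 A f)" "mcod (m f) = tr0 p (cod1 A f)"
  "mor0 (m f) = act1 F f" "mor1 (m f) = act1 G f" "madj (m f) = tradj p f"
  by (simp_all add: p1_mor_def)

lemma p1_two_sel [simp]:
  "tdom (t u) = m (dom2 A u)" "tcod (t u) = m (cod2 A u)"
  "two0 (t u) = act2 F u" "two1 (t u) = act2 G u" "tsq (t u) = tr2 p u"
  by (simp_all add: p1_two_def)

lemma p1_mor_mem [simp]: "f \<in> C1 A \<Longrightarrow> m f \<in> p1_mors B"
  by (subst F.B.p1_mors_iff) (simp add: adjoint)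

lemma p1_two_mem [simp]: "u \<in> C2 A \<Longrightarrow> t u \<in> p1_twos B"
  by (subst F.B.p1_twos_iff) simp

lemma P_sel [simp]:
  "X \<in> C0 A \<Longrightarrow> act0 P X = tr0 p X"
  "f \<in> C1 A \<Longrightarrow> act1 P f = m f"
  "u \<in> C2 A \<Longrightarrow> act2 P u = t u"
  "\<Gamma> \<in> C3 A \<Longrightarrow> act3 P \<Gamma> = PCell (t (dom3 A \<Gamma>)) (t (cod3 A \<Gamma>)) (act3 F \<Gamma>) (act3 G \<Gamma>)"
  "X \<in> C0 A \<Longrightarrow> \<iota> X = P1Two (one1 (path1 B) (tr0 p X)) (m (one1 A X))
      (one2 B (one1 B (act0 F X))) (one2 B (one1 B (act0 G X))) (inv3 B (trunit p X))"
  "\<lbrakk>f \<in> C1 A; g \<in> C1 A; cod1 A f = dom1 A g\<rbrakk> \<Longrightarrow> \<chi> g f =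
      P1Two (p1_cmp1 B (m g) (m f)) (m (g \<bullet>\<^bsub>A\<^esub> f))
        (one2 B (act1 F g \<bullet> act1 F f)) (one2 B (act1 G g \<bullet> act1 G f)) (inv3 B (trcmp p g f))"
  by (simp_all add: pseudo1_def composable_def)

lemma unitor_mem: "X \<in> C0 A \<Longrightarrow> \<iota> X \<in> p1_twos B"
  using F.B.p1_one1_mem[of "tr0 p X"] by (subst F.B.p1_twos_iff) (simp add: one_adj_def)

lemma compositor_mem:
  "\<lbrakk>f \<in> C1 A; g \<in> C1 A; cod1 A f = dom1 A g\<rbrakk> \<Longrightarrow> \<chi> g f \<in> p1_twos B"
  by (subst F.B.p1_twos_iff) simp

section \<open>The axioms of a transformation as conditions on cells of the path object\<close>

lemma map_one2_iff:
  assumes "f \<in> C1 A"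
  shows "act2 P (one2 A f) = one2 (path1 B) (act1 P f) \<longleftrightarrow> tr2 p (one2 A f) = one3 B (tr1 p f)"
  using assms by (simp add: p1_two_def)

lemma map_cmp2_iff:
  assumes "u \<in> C2 A" "v \<in> C2 A" "cod2 A u = dom2 A v"
  shows "act2 P (v \<odot>\<^bsub>A\<^esub> u) = p1_cmp2 B (act2 P v) (act2 P u) \<longleftrightarrow>
    tr2 p (v \<odot>\<^bsub>A\<^esub> u) = ((act2 G v \<lhd> tr0 p (dom1 A (dom2 A u))) \<odot>\<rhd> tr2 p u)
      \<cdot> (tr2 p v \<lhd>\<odot> (tr0 p (cod1 A (dom2 A u)) \<rhd> act2 F u))"
  using assms by (simp add: p1_two_def p1_cmp2_def)

text \<open>A 3-cell of the path object has no data besides its two components, so local naturality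
  turns into a membership condition rather than an equation between cells.\<close>

lemma three_iff:
  assumes "\<Omega> \<in> C3 A"
  shows "act3 P \<Omega> \<in> p1_threes B \<longleftrightarrow>
      ((act3 G \<Omega> \<unlhd> tr0 p (dom1 A (dom2 A (dom3 A \<Omega>)))) \<lhd>\<odot> tr1 p (dom2 A (dom3 A \<Omega>))) \<cdot> tr2 p
      (dom3 A \<Omega>)
        = tr2 p (cod3 A \<Omega>) \<cdot> (tr1 p (cod2 A (dom3 A \<Omega>)) \<odot>\<rhd> (tr0 p (cod1 A (dom2 A (dom3 A \<Omega>))) \<unrhd>
          act3 F \<Omega>))"
  using assms by (subst F.B.p1_threes_iff) auto

text \<open>The components agree because \<open>F\<close> and \<open>G\<close> are strict, so the
  equation is one between squares. It has an inverse of \<open>trcmp\<close> at an end of each side,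
  and \<open>inv3_flip\<close> moves both across. The inverse interchanger is the one built into
  \<open>p1_lwh2\<close>.\<close>

lemma nat2r_iff:
  assumes "u \<in> C2 A" "g \<in> C1 A" "cod1 A (dom2 A u) = dom1 A g"
  shows "p1_cmp2 B (act2 P (g \<rhd>\<^bsub>A\<^esub> u)) (\<chi> g (dom2 A u))
      = p1_cmp2 B (\<chi> g (cod2 A u)) (p1_lwh2 B (act1 P g) (act2 P u)) \<longleftrightarrow>
      tr2 p (g \<rhd>\<^bsub>A\<^esub> u) \<cdot> (trcmp p g (cod2 A u) \<lhd>\<odot> (tr0 p (cod1 A g) \<rhd> act1 F g \<rhd> act2 F u))
        = ((act1 G g \<rhd> (act2 G u \<lhd> tr0 p (dom1 A (dom2 A u)))) \<odot>\<rhd> trcmp p g (dom2 A u))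
          \<cdot> ((act1 G g \<unrhd> tr2 p u) \<lhd>\<odot> (tr1 p g \<lhd> act1 F (dom2 A u)))
          \<cdot> ((act1 G g \<rhd> tr1 p (cod2 A u)) \<odot>\<rhd> inv3 B (ich B (tr1 p g) (act2 F u)))"
  using assms
  by (subst F.B.inv3_flip) (simp_all, simp add: p1_two_def p1_cmp2_def p1_lwh2_def)

lemma nat2l_iff:
  assumes "f \<in> C1 A" "v \<in> C2 A" "cod1 A f = dom1 A (dom2 A v)"
  shows "p1_cmp2 B (act2 P (v \<lhd>\<^bsub>A\<^esub> f)) (\<chi> (dom2 A v) f)
      = p1_cmp2 B (\<chi> (cod2 A v) f) (p1_rwh2 B (act2 P v) (act1 P f)) \<longleftrightarrow>
      tr2 p (v \<lhd>\<^bsub>A\<^esub> f) \<cdot> (trcmp p (cod2 A v) f \<lhd>\<odot> (tr0 p (cod1 A (dom2 A v)) \<rhd> (act2 F v \<lhd> act1 F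
      f)))
        = ((act2 G v \<lhd> (act1 G f \<bullet> tr0 p (dom1 A f))) \<odot>\<rhd> trcmp p (dom2 A v) f)
          \<cdot> (ich B (act2 G v) (tr1 p f) \<lhd>\<odot> (tr1 p (dom2 A v) \<lhd> act1 F f))
          \<cdot> ((act1 G (cod2 A v) \<rhd> tr1 p f) \<odot>\<rhd> (tr2 p v \<unlhd> act1 F f))"
  using assms
  by (subst F.B.inv3_flip) (simp_all, simp add: p1_two_def p1_cmp2_def p1_rwh2_def)

text \<open>Invert both sides; an identity is its own inverse. The unit law for 1-cells of the path
  object identifies the sources.\<close>

lemma gamma_iff:
  assumes "f \<in> C1 A"
  shows "p1_cmp2 B (\<chi> (one1 A (cod1 A f)) f) (p1_rwh2 B (\<iota> (cod1 A f)) (act1 P f))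
      = one2 (path1 B) (act1 P f) \<longleftrightarrow>
      trcmp p (one1 A (cod1 A f)) f \<cdot> (tr1 p f \<odot>\<rhd> (trunit p (cod1 A f) \<unlhd> act1 F f)) = one3 B
      (tr1 p f)"
  using assms F.B.p1_cmp1_one(2)[of "m f" "tr0 p (cod1 A f)"]
  by (subst F.B.inv3_inject[symmetric]) (simp_all, simp add: p1_cmp2_def p1_rwh2_def one_adj_def)

lemma delta_iff:
  assumes "f \<in> C1 A"
  shows "p1_cmp2 B (\<chi> f (one1 A (dom1 A f))) (p1_lwh2 B (act1 P f) (\<iota> (dom1 A f)))
      = one2 (path1 B) (act1 P f) \<longleftrightarrow>
      trcmp p f (one1 A (dom1 A f)) \<cdot> ((act1 G f \<unrhd> trunit p (dom1 A f)) \<lhd>\<odot> tr1 p f) = one3 B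
      (tr1 p f)"
  using assms F.B.p1_cmp1_one(1)[of "m f" "tr0 p (dom1 A f)"]
  by (subst F.B.inv3_inject[symmetric]) (simp_all, simp add: p1_cmp2_def p1_lwh2_def one_adj_def)

text \<open>Inverting both sides exchanges compositor squares for \<open>trcmp\<close>. The final
  \<open>eq_commute\<close> accounts for the two notions listing the sides of associativity in
  opposite order.\<close>

lemma omega_iff:
  assumes "f \<in> C1 A" "g \<in> C1 A" "h \<in> C1 A" "cod1 A f = dom1 A g" "cod1 A g = dom1 A h"
  shows "p1_cmp2 B (\<chi> (h \<bullet>\<^bsub>A\<^esub> g) f) (p1_rwh2 B (\<chi> h g) (act1 P f))
        = p1_cmp2 B (\<chi> h (g \<bullet>\<^bsub>A\<^esub> f)) (p1_lwh2 B (act1 P h) (\<chi> g f)) \<longleftrightarrow>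
      trcmp p h (g \<bullet>\<^bsub>A\<^esub> f) \<cdot> ((act1 G h \<unrhd> trcmp p g f) \<lhd>\<odot> (tr1 p h \<lhd> (act1 F g \<bullet> act1 F f)))
        = trcmp p (h \<bullet>\<^bsub>A\<^esub> g) f
          \<cdot> (((act1 G h \<bullet> act1 G g) \<rhd> tr1 p f) \<odot>\<rhd> (trcmp p h g \<unlhd> act1 F f))"
  using assms F.B.p1_cmp1_assoc[of "m f" "m g" "m h"]
  by (subst F.B.inv3_inject[symmetric])
    (simp_all, simp add: p1_cmp2_def p1_lwh2_def p1_rwh2_def, rule eq_commute)

text \<open>The components are interchangers of identity 2-cells, hence identities. It remains to
  identify source and target, whose squares contain the two inverted compositors in opposite order:
  an instance of \<open>whisker_exchange\<close>.\<close>

lemma coherence: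
  assumes "f \<in> C1 A" "g \<in> C1 A" "h \<in> C1 A" "k \<in> C1 A"
    "cod1 A f = dom1 A g" "cod1 A g = dom1 A h" "cod1 A h = dom1 A k"
  shows "ich (path1 B) (\<chi> k h) (\<chi> g f)
        = one3 (path1 B) (p1_cmp2 B (p1_lwh2 B (act1 P (k \<bullet>\<^bsub>A\<^esub> h)) (\<chi> g f))
            (p1_rwh2 B (\<chi> k h) (p1_cmp1 B (act1 P g) (act1 P f))))"
  using assms F.B.whisker_exchange[of "inv3 B (trcmp p k h) \<unlhd> (act1 F g \<bullet> act1 F f)"
      "(act1 G k \<bullet> act1 G h) \<unrhd> inv3 B (trcmp p g f)"]
  by simp (simp add: p1_cmp2_def p1_lwh2_def p1_rwh2_def)

end

text \<open>Halfway between the two notions: transformation data, subject to those conditions on the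
  associated pseudofunctor that carry the transformation axioms.\<close>

locale arrow_trinat = trinat_data +
  assumes map_one2: "f \<in> C1 A \<Longrightarrow> act2 P (one2 A f) = one2 (path1 B) (act1 P f)"
    and map_cmp2: "\<lbrakk>u \<in> C2 A; v \<in> C2 A; cod2 A u = dom2 A v\<rbrakk> \<Longrightarrow>
      act2 P (v \<odot>\<^bsub>A\<^esub> u) = p1_cmp2 B (act2 P v) (act2 P u)"
    and three_mem: "\<Omega> \<in> C3 A \<Longrightarrow> act3 P \<Omega> \<in> p1_threes B"
    and nat2r: "\<lbrakk>u \<in> C2 A; g \<in> C1 A; cod1 A (dom2 A u) = dom1 A g\<rbrakk> \<Longrightarrow>
      p1_cmp2 B (act2 P (g \<rhd>\<^bsub>A\<^esub> u)) (\<chi> g (dom2 A u))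
        = p1_cmp2 B (\<chi> g (cod2 A u)) (p1_lwh2 B (act1 P g) (act2 P u))"
    and nat2l: "\<lbrakk>f \<in> C1 A; v \<in> C2 A; cod1 A f = dom1 A (dom2 A v)\<rbrakk> \<Longrightarrow>
      p1_cmp2 B (act2 P (v \<lhd>\<^bsub>A\<^esub> f)) (\<chi> (dom2 A v) f)
        = p1_cmp2 B (\<chi> (cod2 A v) f) (p1_rwh2 B (act2 P v) (act1 P f))"
    and omega: "\<lbrakk>f \<in> C1 A; g \<in> C1 A; h \<in> C1 A; cod1 A f = dom1 A g; cod1 A g = dom1 A h\<rbrakk> \<Longrightarrow>
      p1_cmp2 B (\<chi> (h \<bullet>\<^bsub>A\<^esub> g) f) (p1_rwh2 B (\<chi> h g) (act1 P f))
        = p1_cmp2 B (\<chi> h (g \<bullet>\<^bsub>A\<^esub> f)) (p1_lwh2 B (act1 P h) (\<chi> g f))"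
    and gamma: "f \<in> C1 A \<Longrightarrow>
      p1_cmp2 B (\<chi> (one1 A (cod1 A f)) f)
        (p1_rwh2 B (\<iota> (cod1 A f)) (act1 P f)) = one2 (path1 B) (act1 P f)"
    and delta: "f \<in> C1 A \<Longrightarrow>
      p1_cmp2 B (\<chi> f (one1 A (dom1 A f)))
        (p1_lwh2 B (act1 P f) (\<iota> (dom1 A f))) = one2 (path1 B) (act1 P f)"
begin

lemma two_cmp2: "\<lbrakk>u \<in> C2 A; v \<in> C2 A; cod2 A u = dom2 A v\<rbrakk> \<Longrightarrow> t (v \<odot>\<^bsub>A\<^esub> u) = p1_cmp2 B (t v) (t u)"
  using map_cmp2[of u v] by simp

lemma compositor_typing:
  assumes "f \<in> C1 A" "g \<in> C1 A" "cod1 A f = dom1 A g"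
  shows "\<chi> g f \<in> p1_twos B" "tdom (\<chi> g f) = p1_cmp1 B (m g) (m f)"
    "tcod (\<chi> g f) = m (g \<bullet>\<^bsub>A\<^esub> f)"
  using compositor_mem[OF assms] assms by simp_all

text \<open>Naturality of the compositor at the source of the interchanger of \<open>v\<close> and
  \<open>u\<close>, pasted from naturality in each variable. Its companion \<open>nat_cmp2'\<close>
  treats the target; together they give the boundaries in naturality for interchangers.\<close>

lemma nat_cmp2:
  assumes "u \<in> C2 A" "v \<in> C2 A" "cod1 A (dom2 A u) = dom1 A (dom2 A v)"
  shows "p1_cmp2 B (t ((cod2 A v \<rhd>\<^bsub>A\<^esub> u) \<odot>\<^bsub>A\<^esub> (v \<lhd>\<^bsub>A\<^esub> dom2 A u))) (\<chi> (dom2 A v) (dom2 A u))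
    = p1_cmp2 B (\<chi> (cod2 A v) (cod2 A u))
      (p1_cmp2 B (p1_lwh2 B (m (cod2 A v)) (t u)) (p1_rwh2 B (t v) (m (dom2 A u))))"
  using assms nat2l[of "dom2 A u" v] nat2r[of u "cod2 A v"]
    compositor_typing[of "dom2 A u" "dom2 A v"]
    compositor_typing[of "dom2 A u" "cod2 A v"] compositor_typing[of "cod2 A u" "cod2 A v"]
  \<comment> \<open>The squares share the compositor at the mixed pair \<open>cod2 A v\<close>,
    \<open>dom2 A u\<close>. Compositors are kept folded so that the typing facts match.\<close>
  by (subst two_cmp2) (simp_all add: P_sel(2,3) del: P_sel(6), rule F.B.p1_cmp2_paste[where y = "\<chi>
    (cod2 A v) (dom2 A u)"], simp_all del: P_sel(6))

lemma nat_cmp2':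
  assumes "u \<in> C2 A" "v \<in> C2 A" "cod1 A (dom2 A u) = dom1 A (dom2 A v)"
  shows "p1_cmp2 B (t ((v \<lhd>\<^bsub>A\<^esub> cod2 A u) \<odot>\<^bsub>A\<^esub> (dom2 A v \<rhd>\<^bsub>A\<^esub> u))) (\<chi> (dom2 A v) (dom2 A u))
    = p1_cmp2 B (\<chi> (cod2 A v) (cod2 A u))
      (p1_cmp2 B (p1_rwh2 B (t v) (m (cod2 A u))) (p1_lwh2 B (m (dom2 A v)) (t u)))"
  using assms nat2l[of "cod2 A u" v] nat2r[of u "dom2 A v"]
    compositor_typing[of "dom2 A u" "dom2 A v"]
    compositor_typing[of "cod2 A u" "dom2 A v"] compositor_typing[of "cod2 A u" "cod2 A v"]
  by (subst two_cmp2) (simp_all add: P_sel(2,3) del: P_sel(6), rule F.B.p1_cmp2_paste[where y = "\<chi>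
    (dom2 A v) (cod2 A u)"], simp_all del: P_sel(6))

text \<open>An equation between 3-cells splits into two parts. The components agree because
  \<open>F\<close> and \<open>G\<close> are strict; the stored boundaries agree by an equation
  between 2-cells.\<close>

lemma P_pseudofunctor: "arrow_pseudofunctor A (path1 B) P"
  apply unfold_locales
  subgoal using ext by (simp add: gmap_extensional_def pseudo1_def)
  subgoal by (simp add: pseudo1_def)
  subgoal by (simp add: pseudo1_def)
  subgoal by simp
  subgoal by (simp add: is1_def)
  subgoal by (simp add: is2_def)
  subgoal for \<Gamma> using three_mem[of \<Gamma>] by (simp add: is3_def)
  subgoal by (simp add: is1_def)
  subgoal by (rule map_one2)
  subgoal by simp
  subgoal for u v using map_cmp2[of u v] by simp
  subgoal by simp
  subgoal for \<Gamma> \<Delta>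
    using two_cmp2[of "dom3 A \<Gamma>" "dom3 A \<Delta>"] two_cmp2[of "cod3 A \<Gamma>" "cod3 A \<Delta>"] by simp
  subgoal for X
    using F.B.p1_iso2I[OF unitor_mem, of X] by (simp add: one_adj_def F.B.p1_identical_def)
  subgoal for f g
    using F.B.p1_iso2I[OF compositor_mem, of f g] by (simp add: F.B.p1_identical_def)
  subgoal for f v using nat2l[of f v] by (simp only: path1_sel)
  subgoal for u g using nat2r[of u g] by (simp only: path1_sel)
  subgoal for f \<Gamma> using nat2l[of f "dom3 A \<Gamma>"] nat2l[of f "cod3 A \<Gamma>"] by simp
  subgoal for \<Gamma> g using nat2r[of "dom3 A \<Gamma>" g] nat2r[of "cod3 A \<Gamma>" g] by simp
  subgoal for u v using nat_cmp2[of u v] nat_cmp2'[of u v] by simp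
  subgoal for f using gamma[of f] by (simp only: path1_sel)
  subgoal for f using delta[of f] by (simp only: path1_sel)
  subgoal for f g h using omega[of f g h] by (simp only: path1_sel)
  subgoal for f g h k using coherence[of f g h k] by (simp only: path1_sel)
  done

end

context trinat_data
begin

lemma arrow_trinatI:
  assumes "arrow_pseudofunctor A (path1 B) P"
  shows "arrow_trinat A B F G p"
proof -
  interpret H: arrow_pseudofunctor A "path1 B" P by fact
  \<comment> \<open>Unfolds carriers, boundaries and compositions of \<open>path1\<close>, but
    leaves its identities folded, as in the axioms to be matched.\<close>
  note ops = path1_sel(1-10,14-17)
  have three: "act3 P \<Gamma> \<in> p1_threes B" if "\<Gamma> \<in> C3 A" for \<Gamma>
    using H.three[OF that] by (simp only: is3_def ops)
  show ?thesis
    by unfold_locales (fact three H.map_one2 H.map_cmp2[unfolded ops] H.nat2r[unfolded ops]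
      H.nat2l[unfolded ops] H.omega[unfolded ops] H.gamma[unfolded ops] H.delta[unfolded ops])+
qed

end

section \<open>Projections, and comparison with trinatural transformations\<close>

lemma restrict_eqI: "g \<in> extensional S \<Longrightarrow> (\<And>x. x \<in> S \<Longrightarrow> f x = g x) \<Longrightarrow> restrict f S = g"
  by (auto intro: extensionalityI)

lemma gmap_extensionalD:
  assumes "gmap_extensional A F"
  shows "x \<notin> C0 A \<Longrightarrow> act0 F x = undefined" "f \<notin> C1 A \<Longrightarrow> act1 F f = undefined"
    "u \<notin> C2 A \<Longrightarrow> act2 F u = undefined" "\<Gamma> \<notin> C3 A \<Longrightarrow> act3 F \<Gamma> = undefined"
  using assms by (auto simp: gmap_extensional_def extensional_def)

lemma path_proj_sel [simp]:
  "x \<in> C1 B \<Longrightarrow> act0 (path_s0 B) x = dom1 B x" "x \<in> C1 B \<Longrightarrow> act0 (path_t0 B) x = cod1 B x"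
  "u \<in> p1_mors B \<Longrightarrow> act1 (path_s0 B) u = mor0 u" "u \<in> p1_mors B \<Longrightarrow> act1 (path_t0 B) u = mor1 u"
  "\<phi> \<in> p1_twos B \<Longrightarrow> act2 (path_s0 B) \<phi> = two0 \<phi>" "\<phi> \<in> p1_twos B \<Longrightarrow> act2 (path_t0 B) \<phi> = two1 \<phi>"
  "\<Gamma> \<in> p1_threes B \<Longrightarrow> act3 (path_s0 B) \<Gamma> = part0 \<Gamma>" "\<Gamma> \<in> p1_threes B \<Longrightarrow> act3 (path_t0 B) \<Gamma> = part1 \<Gamma>"
  by (simp_all add: path_s0_def path_t0_def)

context two_gray_functors
begin

lemma arrow_trinat_imp:
  assumes "arrow_trinat A B F G p"
  shows "trinatural_transformation A B F G p"
proof -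
  interpret arrow_trinat A B F G p by fact
  note ax = map_cmp2_iff[THEN iffD1, OF _ _ _ map_cmp2] three_iff[THEN iffD1, OF _ three_mem]
    nat2r_iff[THEN iffD1, OF _ _ _ nat2r] nat2l_iff[THEN iffD1, OF _ _ _ nat2l]
    omega_iff[THEN iffD1, OF _ _ _ _ _ omega]
    gamma_iff[THEN iffD1, OF _ gamma] delta_iff[THEN iffD1, OF _ delta]
  show ?thesis
    apply (rule trinatural_transformation.intro)
                     apply (fact ext component)+
    subgoal for f X Y
      using adjoint[of f] by (auto simp: F.B.adj_equiv_hom F.A.is1_iff is1_def[of B])
    subgoal for \<phi> f g X Y
      using naturality[of \<phi>] by (auto simp: F.A.is1_iff F.A.is2_iff)
    subgoal by (rule unitor)
    subgoal for f X Y g Z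
      using compositor[of f g] by (auto simp: is1_def)
    subgoal for f
      using map_one2_iff[of f] map_one2[of f] by blast
    subgoal for \<phi> f g \<psi>
      using ax(1)[of \<phi> \<psi>] by (auto simp: F.A.is1_iff is2_def)
    subgoal for \<Omega>
      using ax(2)[of \<Omega>] by (auto simp: is1_def is2_def is3_def)
    subgoal for \<phi> f f' X Y g Z
      using ax(3)[of \<phi> g] by (clarsimp simp: is1_def is2_def)
    subgoal for f X Y \<psi>
      using ax(4)[of f \<psi>] by (clarsimp simp: is1_def is2_def)
    subgoal for e W X f Y g Z
      using ax(5)[of e f g] by (simp add: is1_def)
    subgoal for f X Y
      using ax(7)[of f] by (auto simp: is1_def)
    subgoal for f X Y
      using ax(6)[of f] by (auto simp: is1_def)
    done
qed

lemma trinatural_imp: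
  assumes "trinatural_transformation A B F G p"
  shows "arrow_trinat A B F G p"
proof -
  interpret t: trinatural_transformation A B F G p by fact
  interpret trinat_data A B F G p
    apply unfold_locales
             apply (fact t.ext t.component)+
    subgoal for f
      using t.adjoint[of f] by (simp add: is1_def F.B.adj_equiv_hom)
    subgoal for u
      using t.naturality[of u] by (simp add: is1_def is2_def)
    subgoal by (rule t.unitor)
    subgoal for f g
      using t.compositor[of f "dom1 A f" "cod1 A f" g "cod1 A g"] by (simp add: is1_def)
    done
  show ?thesis
    apply unfold_locales
    subgoal premises a for f
      by (rule map_one2_iff[OF a, THEN iffD2], rule t.local_one[OF a])
    subgoal premises a for u v
      by (rule map_cmp2_iff[OF a, THEN iffD2], rule t.local_cmp)
        (use a in \<open>auto simp: is1_def is2_def\<close>)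
    subgoal premises a for \<Omega>
      by (rule three_iff[OF a, THEN iffD2], rule t.local_natural)
        (use a in \<open>auto simp: is1_def is2_def is3_def\<close>)
    subgoal premises a for u g
      by (rule nat2r_iff[OF a, THEN iffD2], rule t.right_whiskering[where Y = "dom1 A g"])
        (use a in \<open>auto simp: is1_def is2_def\<close>)
    subgoal premises a for f v
      by (rule nat2l_iff[OF a, THEN iffD2], rule t.left_whiskering[where Y = "cod1 A f"])
        (use a in \<open>auto simp: is1_def is2_def\<close>)
    subgoal premises a for f g h
      by (rule omega_iff[OF a, THEN iffD2], rule t.associativity[where X = "cod1 A f" and Y =
        "cod1 A g"])
        (use a in \<open>auto simp: is1_def\<close>)
    subgoal premises a for f
      by (rule gamma_iff[OF a, THEN iffD2], rule t.unit_left[OF F.A.is1_self[OF a]])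
    subgoal premises a for f
      by (rule delta_iff[OF a, THEN iffD2], rule t.unit_right[OF F.A.is1_self[OF a]])
    done
qed

lemma trinatural_iff: "trinatural_transformation A B F G p \<longleftrightarrow> arrow_trinat A B F G p"
  using arrow_trinat_imp trinatural_imp by blast

end

context arrow_trinat
begin

text \<open>On cells the projections read off components. Off the carriers both sides are
  \<open>undefined\<close>, since \<open>F\<close> and \<open>G\<close> are extensional.\<close>

lemma P_projections:
  "after A (path_s0 B) P = of_gray_functor A B F" "after A (path_t0 B) P = of_gray_functor A B G"
proof -
  interpret P: arrow_pseudofunctor A "path1 B" P by (rule P_pseudofunctor)
  have 3: "act3 P \<Gamma> \<in> p1_threes B" if "\<Gamma> \<in> C3 A" for \<Gamma>
    using P.three[OF that] by (simp add: is3_def)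
  note e = gmap_extensionalD[OF F.ext] gmap_extensionalD[OF G.ext]
  show "after A (path_s0 B) P = of_gray_functor A B F"
    unfolding after_def of_gray_functor_def
    using unitor_mem compositor_mem 3
    by (auto simp: composable_def fun_eq_iff e)
  show "after A (path_t0 B) P = of_gray_functor A B G"
    unfolding after_def of_gray_functor_def
    using unitor_mem compositor_mem 3
    by (auto simp: composable_def fun_eq_iff e)
qed

end

section \<open>Recovering a transformation from its 3-pseudofunctor\<close>

definition trinat_of where
  "trinat_of A B H = \<lparr>tr0 = act0 H, tradj = (\<lambda>f\<in>C1 A. madj (act1 H f)), tr2
    = (\<lambda>u\<in>C2 A. tsq (act2 H u)),
    trunit = (\<lambda>X\<in>C0 A. inv3 B (tsq (unitor H X))),
    trcmp = (\<lambda>g f. if composable A g f then inv3 B (tsq (compositor H g f)) else undefined)\<rparr>"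

context two_gray_functors
begin

lemma trinat_of_pseudo1:
  assumes "trinat_data A B F G p"
  shows "trinat_of A B (pseudo1 A B F G p) = p"
proof -
  interpret trinat_data A B F G p by fact
  have "trcmp p = (\<lambda>g f. if composable A g f then inv3 B (tsq (compositor P g f)) else undefined)"
    using ext(5) by (auto simp: fun_eq_iff composable_def)
  moreover have "(\<lambda>f\<in>C1 A. madj (act1 P f)) = tradj p" by (rule restrict_eqI[OF ext(2)]) simp
  moreover have "(\<lambda>u\<in>C2 A. tsq (act2 P u)) = tr2 p" by (rule restrict_eqI[OF ext(3)]) simp
  moreover have "(\<lambda>X\<in>C0 A. inv3 B (tsq (unitor P X))) = trunit p"
    by (rule restrict_eqI[OF ext(4)]) simp
  moreover have "act0 P = tr0 p" by (simp add: pseudo1_def)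
  ultimately show ?thesis by (simp add: trinat_of_def)
qed

text \<open>The projections prescribe all components of \<open>H\<close>, its typing prescribes all
  boundaries, and only the adjoint equivalences and squares stay free. These are what
  \<open>trinat_of\<close> reads off, so rebuilding the cells returns \<open>H\<close>.\<close>

lemma pseudo1_trinat_of:
  assumes "arrow_pseudofunctor A (path1 B) H"
    and s: "after A (path_s0 B) H = of_gray_functor A B F" and t:
        "after A (path_t0 B) H = of_gray_functor A B G"
  shows "trinat_data A B F G (trinat_of A B H)" "pseudo1 A B F G (trinat_of A B H) = H"
proof -
  interpret H: arrow_pseudofunctor A "path1 B" H by fact
  let ?p = "trinat_of A B H"
  have C0 [simp]: "act0 H X \<in> C1 B" if "X \<in> C0 A" for X
    using H.obj[OF that] by simp
  have C1 [simp]: "act1 H f \<in> p1_mors B" "mdom (act1 H f) = act0 H (dom1 A f)"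
      "mcod (act1 H f) = act0 H (cod1 A f)"
    if "f \<in> C1 A" for f
    using H.mor[OF that] by (auto simp: is1_def)
  have C2 [simp]: "act2 H u \<in> p1_twos B" "tdom (act2 H u) = act1 H (dom2 A u)"
      "tcod (act2 H u) = act1 H (cod2 A u)"
    if "u \<in> C2 A" for u
    using H.two[OF that] by (auto simp: is2_def)
  have C3 [simp]: "act3 H \<Gamma> \<in> p1_threes B" "pdom (act3 H \<Gamma>) = act2 H (dom3 A \<Gamma>)"
      "pcod (act3 H \<Gamma>) = act2 H (cod3 A \<Gamma>)"
    if "\<Gamma> \<in> C3 A" for \<Gamma>
    using H.three[OF that] by (auto simp: is3_def)
  have U [simp]: "unitor H X \<in> p1_twos B" "tdom (unitor H X) = one1 (path1 B) (act0 H X)"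
    "tcod (unitor H X) = act1 H (one1 A X)" if "X \<in> C0 A" for X
    using H.unitor_iso[OF that] by (auto simp: iso2_def is2_def)
  have K [simp]: "compositor H g f \<in> p1_twos B"
      "tdom (compositor H g f) = p1_cmp1 B (act1 H g) (act1 H f)"
    "tcod (compositor H g f) = act1 H (g \<bullet>\<^bsub>A\<^esub> f)" if "f \<in> C1 A" "g \<in> C1 A" "cod1 A f = dom1 A g"
    for f g
    using H.compositor_iso[OF that] by (auto simp: iso2_def is2_def)
  \<comment> \<open>Equality with \<open>of_gray_functor\<close> includes unitors, which is what
    forces the unitor of \<open>H\<close> to lie over identities. The same holds for the compositors
    further down.\<close>
  have F0 [simp]: "dom1 B (act0 H X) = act0 F X" "cod1 B (act0 H X) = act0 G X"
    "two0 (unitor H X) = one2 B (one1 B (act0 F X))"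
    "two1 (unitor H X) = one2 B (one1 B (act0 G X))" if "X \<in> C0 A" for X
    using arg_cong[OF s, of "\<lambda>K. act0 K X"] arg_cong[OF t, of "\<lambda>K. act0 K X"]
     arg_cong[OF s, of "\<lambda>K. unitor K X"] arg_cong[OF t, of "\<lambda>K. unitor K X"] that
    by (simp_all add: after_def of_gray_functor_def)
  have F1 [simp]: "mor0 (act1 H f) = act1 F f" "mor1 (act1 H f) = act1 G f" if "f \<in> C1 A" for f
    using arg_cong[OF s, of "\<lambda>K. act1 K f"] arg_cong[OF t, of "\<lambda>K. act1 K f"] that
    by (simp_all add: after_def of_gray_functor_def)
  have F2 [simp]: "two0 (act2 H u) = act2 F u" "two1 (act2 H u) = act2 G u" if "u \<in> C2 A" for u
    using arg_cong[OF s, of "\<lambda>K. act2 K u"] arg_cong[OF t, of "\<lambda>K. act2 K u"] that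
    by (simp_all add: after_def of_gray_functor_def)
  have F3 [simp]: "part0 (act3 H \<Gamma>) = act3 F \<Gamma>" "part1 (act3 H \<Gamma>) = act3 G \<Gamma>" if "\<Gamma> \<in> C3 A" for \<Gamma>
    using arg_cong[OF s, of "\<lambda>K. act3 K \<Gamma>"] arg_cong[OF t, of "\<lambda>K. act3 K \<Gamma>"] that
    by (simp_all add: after_def of_gray_functor_def)
  have F4 [simp]: "two0 (compositor H g f) = one2 B (act1 F g \<bullet> act1 F f)"
      "two1 (compositor H g f) = one2 B (act1 G g \<bullet> act1 G f)"
    if "f \<in> C1 A" "g \<in> C1 A" "cod1 A f = dom1 A g" for f g
    using arg_cong[OF s, of "\<lambda>K. compositor K g f"] arg_cong[OF t, of "\<lambda>K. compositor K g f"] that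
    by (simp_all add: after_def of_gray_functor_def composable_def)
  have q [simp]: "tr0 ?p = act0 H" "f \<in> C1 A \<Longrightarrow> tradj ?p f = madj (act1 H f)"
    "u \<in> C2 A \<Longrightarrow> tr2 ?p u = tsq (act2 H u)"
    "X \<in> C0 A \<Longrightarrow> trunit ?p X = inv3 B (tsq (unitor H X))"
    "\<lbrakk>f \<in> C1 A; g \<in> C1 A; cod1 A f = dom1 A g\<rbrakk> \<Longrightarrow> trcmp ?p g f = inv3 B (tsq (compositor H g f))"
    for f u X g
    by (simp_all add: trinat_of_def composable_def)
  have l [simp]: "mlft (act1 H f) \<in> C2 B" "dom2 B (mlft (act1 H f)) = act0 H (cod1 A f) \<bullet> act1 F f"
    "cod2 B (mlft (act1 H f)) = act1 G f \<bullet> act0 H (dom1 A f)" if "f \<in> C1 A" for f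
    using F.B.p1_mors_simps(9-11)[OF C1(1)[OF that]] that by simp_all
  show "trinat_data A B F G ?p"
    apply unfold_locales
             apply (use H.ext(1) in \<open>auto simp: trinat_of_def gmap_extensional_def\<close>)[5]
    subgoal for X by (simp add: is1_def)
    subgoal for f using F.B.p1_mors_adj[of "act1 H f"] by simp
      apply (auto simp: iso3_iff is3_def one_adj_def)
    done
  then interpret trinat_data A B F G ?p .
  have M: "m f = act1 H f" if "f \<in> C1 A" for f
    using that by (intro p1mor.expand) simp
  have T: "p1_two A F G ?p u = act2 H u" if "u \<in> C2 A" for u
    using that by (intro p1two.expand) (simp add: M)
  note e = H.ext(1)[unfolded gmap_extensional_def]
  have "act3 P = act3 H"
    unfolding pseudo1_def using e by (auto intro!: restrict_eqI pcell.expand simp: T)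
  moreover have "unitor P = unitor H"
    unfolding pseudo1_def using H.ext(2) by (auto intro!: restrict_eqI p1two.expand simp: M)
  moreover have "compositor P g f = compositor H g f" for g f
  proof (cases "composable A g f")
    case True
    then show ?thesis by (auto intro!: p1two.expand simp: M composable_def)
  qed (simp add: pseudo1_def H.ext(3))
  moreover have "act1 P = act1 H" "act2 P = act2 H"
    unfolding pseudo1_def using e by (auto intro!: restrict_eqI simp: M T)
  moreover have "act0 P = act0 H" by (simp add: pseudo1_def)
  ultimately show "pseudo1 A B F G ?p = H"
    by (intro pseudo.equality) (auto simp: fun_eq_iff)
qed

theorem bij_pseudo1:
  "bij_betw (pseudo1 A B F G) {p. trinatural_transformation A B F G p}
    {P. three_pseudofunctor A (path1 B) P \<and>
      after A (path_s0 B) P = of_gray_functor A B F \<and> after A (path_t0 B) P = of_gray_functor A B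
      G}"
proof (rule bij_betw_byWitness[where f' = "trinat_of A B"], goal_cases)
  case 1
  show ?case using trinat_of_pseudo1 by (auto simp: trinatural_iff arrow_trinat_def)
next
  case 2
  show ?case using pseudo1_trinat_of(2) by (auto simp: F.A.three_pseudofunctor_iff)
next
  case 3
  show ?case using arrow_trinat.P_pseudofunctor arrow_trinat.P_projections
    by (auto simp: trinatural_iff F.A.three_pseudofunctor_iff)
next
  case 4
  show ?case
  proof clarify
    fix H assume "three_pseudofunctor A (path1 B) H"
      "after A (path_s0 B) H = of_gray_functor A B F"
      "after A (path_t0 B) H = of_gray_functor A B G"
    then have "arrow_pseudofunctor A (path1 B) H" and *: "trinat_data A B F G (trinat_of A B H)"
      "pseudo1 A B F G (trinat_of A B H) = H"
      using pseudo1_trinat_of by (simp_all add: F.A.three_pseudofunctor_iff)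
    then show "trinatural_transformation A B F G (trinat_of A B H)"
      using trinat_data.arrow_trinatI[OF *(1)] by (simp add: trinatural_iff)
  qed
qed

end


section \<open>Pairs of 3-pseudofunctors\<close>

text \<open>
  The common shape of the path object of 2-cells (over that of 1-cells) and of the path object
  of 3-cells (over that of 2-cells): 2-cells and 3-cells of \<open>E\<close> are pairs of cells of \<open>D\<close>. The
  equations hold without side conditions, as cells of path objects store their sources and targets.
\<close>

locale pair_path =
  fixes D :: "('y, 'n, 't, 's) gray"
    and E :: "('x, 'm, ('m, 't) pcell, (('m, 't) pcell, 's) pcell) gray"
    and K0 K1 :: "('x, 'm, ('m, 't) pcell, (('m, 't) pcell, 's) pcell, 'y, 'n, 't, 's) gmap"
    and ob0 ob1 :: "'x \<Rightarrow> 'y" and fa0 fa1 :: "'m \<Rightarrow> 'n"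
  assumes base_sel [simp]: "dom3 D (one3 D u) = u" "cod3 D (one3 D u) = u"
    "dom3 D (hcmp3 D \<Delta> \<Gamma>) = cmp2 D (dom3 D \<Delta>) (dom3 D \<Gamma>)"
    "cod3 D (hcmp3 D \<Delta> \<Gamma>) = cmp2 D (cod3 D \<Delta>) (cod3 D \<Gamma>)"
    "dom3 D (ich D v u) = cmp2 D (lwh2 D (cod2 D v) u) (rwh2 D v (dom2 D u))"
    "cod3 D (ich D v u) = cmp2 D (rwh2 D v (cod2 D u)) (lwh2 D (dom2 D v) u)"
  and pair_sel [simp]: "dom2 E = pdom" "cod2 E = pcod" "dom3 E = pdom" "cod3 E = pcod"
    "one2 E f = PCell f f (one2 D (fa0 f)) (one2 D (fa1 f))"
    "one3 E \<Phi> = PCell \<Phi> \<Phi> (one3 D (part0 \<Phi>)) (one3 D (part1 \<Phi>))"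
    "cmp2 E \<Psi> \<Phi> = PCell (pdom \<Phi>) (pcod \<Psi>) (cmp2 D (part0 \<Psi>) (part0 \<Phi>)) (cmp2 D (part1 \<Psi>) (part1 \<Phi>))"
    "vcmp3 E \<Theta> \<Lambda> = PCell (pdom \<Lambda>) (pcod \<Theta>) (vcmp3 D (part0 \<Theta>) (part0 \<Lambda>)) (vcmp3 D (part1 \<Theta>)
      (part1 \<Lambda>))"
    "hcmp3 E \<Theta> \<Lambda> = PCell (cmp2 E (pdom \<Theta>) (pdom \<Lambda>)) (cmp2 E (pcod \<Theta>) (pcod \<Lambda>))
      (hcmp3 D (part0 \<Theta>) (part0 \<Lambda>)) (hcmp3 D (part1 \<Theta>) (part1 \<Lambda>))"
    "lwh2 E f \<Phi> = PCell (cmp1 E f (pdom \<Phi>)) (cmp1 E f (pcod \<Phi>)) (lwh2 D (fa0 f) (part0 \<Phi>)) (lwh2 D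
      (fa1 f) (part1 \<Phi>))"
    "rwh2 E \<Phi> f = PCell (cmp1 E (pdom \<Phi>) f) (cmp1 E (pcod \<Phi>) f) (rwh2 D (part0 \<Phi>) (fa0 f)) (rwh2 D
      (part1 \<Phi>) (fa1 f))"
    "lwh3 E f \<Lambda> = PCell (lwh2 E f (pdom \<Lambda>)) (lwh2 E f (pcod \<Lambda>)) (lwh3 D (fa0 f) (part0 \<Lambda>)) (lwh3 D
      (fa1 f) (part1 \<Lambda>))"
    "rwh3 E \<Lambda> f = PCell (rwh2 E (pdom \<Lambda>) f) (rwh2 E (pcod \<Lambda>) f) (rwh3 D (part0 \<Lambda>) (fa0 f)) (rwh3 D
      (part1 \<Lambda>) (fa1 f))"
    "ich E \<Psi> \<Phi> = PCell (cmp2 E (lwh2 E (pcod \<Psi>) \<Phi>) (rwh2 E \<Psi> (pdom \<Phi>)))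
      (cmp2 E (rwh2 E \<Psi> (pcod \<Phi>)) (lwh2 E (pdom \<Psi>) \<Phi>))
      (ich D (part0 \<Psi>) (part0 \<Phi>)) (ich D (part1 \<Psi>) (part1 \<Phi>))"
    "fa0 (cmp1 E g f) = cmp1 D (fa0 g) (fa0 f)" "fa1 (cmp1 E g f) = cmp1 D (fa1 g) (fa1 f)"
  and proj_sel [simp]:
    "x \<in> C0 E \<Longrightarrow> act0 K0 x = ob0 x" "x \<in> C0 E \<Longrightarrow> act0 K1 x = ob1 x"
    "f \<in> C1 E \<Longrightarrow> act1 K0 f = fa0 f" "f \<in> C1 E \<Longrightarrow> act1 K1 f = fa1 f"
    "\<Phi> \<in> C2 E \<Longrightarrow> act2 K0 \<Phi> = part0 \<Phi>" "\<Phi> \<in> C2 E \<Longrightarrow> act2 K1 \<Phi> = part1 \<Phi>"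
    "\<Lambda> \<in> C3 E \<Longrightarrow> act3 K0 \<Lambda> = part0 \<Lambda>" "\<Lambda> \<in> C3 E \<Longrightarrow> act3 K1 \<Lambda> = part1 \<Lambda>"

context pair_path
begin

section \<open>Boundary equations inherited from the base\<close>

lemma boundaries:
  assumes "arrow_pseudofunctor A D H"
  shows "u \<in> C2 A \<Longrightarrow> dom2 D (act2 H u) = act1 H (dom2 A u)"
    "u \<in> C2 A \<Longrightarrow> cod2 D (act2 H u) = act1 H (cod2 A u)"
    "\<Gamma> \<in> C3 A \<Longrightarrow> dom3 D (act3 H \<Gamma>) = act2 H (dom3 A \<Gamma>)"
    "\<Gamma> \<in> C3 A \<Longrightarrow> cod3 D (act3 H \<Gamma>) = act2 H (cod3 A \<Gamma>)"
    "\<lbrakk>f \<in> C1 A; g \<in> C1 A; cod1 A f = dom1 A g\<rbrakk> \<Longrightarrow>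
      dom2 D (compositor H g f) = cmp1 D (act1 H g) (act1 H f)"
    "\<lbrakk>f \<in> C1 A; g \<in> C1 A; cod1 A f = dom1 A g\<rbrakk> \<Longrightarrow>
      cod2 D (compositor H g f) = act1 H (cmp1 A g f)"
  using arrow_pseudofunctor.two[OF assms] arrow_pseudofunctor.three[OF assms]
    arrow_pseudofunctor.compositor_iso[OF assms]
  by (auto simp: is2_def is3_def iso2_def)

text \<open>Source and target of the naturality equation for interchangers in \<open>D\<close>,
  computable because boundaries in \<open>D\<close> are given by formulas valid for arbitrary
  arguments. They compare the boundaries stored in \<open>E\<close>.\<close>

lemma nat_ich_boundary:
  assumes "arrow_pseudofunctor A D H" "u \<in> C2 A" "v \<in> C2 A" "cod1 A (dom2 A u) = dom1 A (dom2 A v)"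
  shows "cmp2 D (act2 H (cmp2 A (lwh2 A (cod2 A v) u) (rwh2 A v (dom2 A u))))
        (compositor H (dom2 A v) (dom2 A u))
      = cmp2 D (compositor H (cod2 A v) (cod2 A u))
        (cmp2 D (lwh2 D (act1 H (cod2 A v)) (act2 H u)) (rwh2 D (act2 H v) (act1 H (dom2 A u))))"
          (is ?dom)
    "cmp2 D (act2 H (cmp2 A (rwh2 A v (cod2 A u)) (lwh2 A (dom2 A v) u)))
        (compositor H (dom2 A v) (dom2 A u))
      = cmp2 D (compositor H (cod2 A v) (cod2 A u))
        (cmp2 D (rwh2 D (act2 H v) (act1 H (cod2 A u))) (lwh2 D (act1 H (dom2 A v)) (act2 H u)))"
          (is ?cod)
proof -
  interpret H: arrow_pseudofunctor A D H by fact
  show ?dom ?cod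
    using arg_cong[OF H.nat_ich[OF assms(2-4)], of "dom3 D"]
      arg_cong[OF H.nat_ich[OF assms(2-4)], of "cod3 D"] assms(2-4)
    by (simp_all add: boundaries[OF assms(1)])
qed

text \<open>The target of the coherence equation in \<open>D\<close>: the interchanger of
  compositors equals an identity, so its target is the 2-cell under that identity.\<close>

lemma coherence_boundary:
  assumes "arrow_pseudofunctor A D H" "f \<in> C1 A" "g \<in> C1 A" "h \<in> C1 A" "k \<in> C1 A"
    "cod1 A f = dom1 A g" "cod1 A g = dom1 A h" "cod1 A h = dom1 A k"
  shows "cmp2 D (rwh2 D (compositor H k h) (act1 H (cmp1 A g f)))
        (lwh2 D (cmp1 D (act1 H k) (act1 H h)) (compositor H g f))
      = cmp2 D (lwh2 D (act1 H (cmp1 A k h)) (compositor H g f))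
        (rwh2 D (compositor H k h) (cmp1 D (act1 H g) (act1 H f)))"
proof -
  interpret H: arrow_pseudofunctor A D H by fact
  show ?thesis
    using arg_cong[OF H.coherence[OF assms(2-8)], of "cod3 D"] assms(2-8)
    by (simp add: boundaries[OF assms(1)])
qed

end

text \<open>Only \<open>a0\<close> and \<open>a1\<close> are new data. From dimension 2 on, a cell
  is the pair of the values of \<open>H0\<close> and \<open>H1\<close>, with a boundary dictated by
  \<open>a1\<close> and compositions in \<open>E\<close>.\<close>

definition pair_pseudo where
  "pair_pseudo A E a0 a1 H0 H1 = (let two = \<lambda>u. PCell (a1 (dom2 A u)) (a1 (cod2 A u)) (act2 H0 u)
    (act2 H1 u) in
    \<lparr>act0 = a0, act1 = restrict a1 (C1 A), act2 = restrict two (C2 A),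
    act3 = (\<lambda>\<Gamma>\<in>C3 A. PCell (two (dom3 A \<Gamma>)) (two (cod3 A \<Gamma>)) (act3 H0 \<Gamma>) (act3 H1 \<Gamma>)),
    unitor = (\<lambda>X\<in>C0 A. PCell (one1 E (a0 X)) (a1 (one1 A X)) (unitor H0 X) (unitor H1 X)),
    compositor = (\<lambda>g f. if composable A g f then PCell (cmp1 E (a1 g) (a1 f)) (a1 (cmp1 A g f))
      (compositor H0 g f) (compositor H1 g f) else undefined)\<rparr>)"

text \<open>A recovered function on 1-cells agrees with the original one on the carrier; this makes
  such agreement sufficient.\<close>

lemma (in gray_category) pair_pseudo_cong:
  assumes "\<And>f. f \<in> C1 A \<Longrightarrow> a1 f = a1' f"
  shows "pair_pseudo A E a0 a1 H0 H1 = pair_pseudo A E a0 a1' H0 H1"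
  using assms unfolding pair_pseudo_def Let_def
  by (auto simp: composable_def fun_eq_iff restrict_def)

text \<open>What a concrete path object has to supply: membership of the paired cells, strict
  inverses of paired unitors and compositors, and the laws for composing 1-cells. The latter enter
  through the boundaries stored in the equations for \<gamma>, \<delta> and \<omega>.\<close>

locale pair_data = pair_path D E K0 K1 ob0 ob1 fa0 fa1
    + H0: arrow_pseudofunctor A D H0 + H1: arrow_pseudofunctor A D H1
  for A :: "('o, 'f, 'a, 'g) gray"
    and D :: "('y, 'n, 't, 's) gray"
    and E :: "('x, 'm, ('m, 't) pcell, (('m, 't) pcell, 's) pcell) gray"
    and K0 K1 ob0 ob1 fa0 fa1 H0 H1 +
  fixes a0 :: "'o \<Rightarrow> 'x" and a1 :: "'f \<Rightarrow> 'm"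
  assumes a_ext: "a0 \<in> extensional (C0 A)"
    and a_obj: "X \<in> C0 A \<Longrightarrow> a0 X \<in> C0 E"
    and a_mor: "f \<in> C1 A \<Longrightarrow> is1 E (a1 f) (a0 (dom1 A f)) (a0 (cod1 A f))"
    and a_ob [simp]: "X \<in> C0 A \<Longrightarrow> ob0 (a0 X) = act0 H0 X" "X \<in> C0 A \<Longrightarrow> ob1 (a0 X) = act0 H1 X"
    and a_fa [simp]: "f \<in> C1 A \<Longrightarrow> fa0 (a1 f) = act1 H0 f" "f \<in> C1 A \<Longrightarrow> fa1 (a1 f) = act1 H1 f"
    and a_two: "u \<in> C2 A \<Longrightarrow> PCell (a1 (dom2 A u)) (a1 (cod2 A u)) (act2 H0 u) (act2 H1 u) \<in> C2 E"
    and a_three: "\<Gamma> \<in> C3 A \<Longrightarrow>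
      PCell (PCell (a1 (dom2 A (dom3 A \<Gamma>))) (a1 (cod2 A (dom3 A \<Gamma>))) (act2 H0 (dom3 A \<Gamma>)) (act2 H1
      (dom3 A \<Gamma>)))
        (PCell (a1 (dom2 A (dom3 A \<Gamma>))) (a1 (cod2 A (dom3 A \<Gamma>))) (act2 H0 (cod3 A \<Gamma>)) (act2 H1
        (cod3 A \<Gamma>)))
        (act3 H0 \<Gamma>) (act3 H1 \<Gamma>) \<in> C3 E"
    and a_cmp: "\<lbrakk>f \<in> C1 A; g \<in> C1 A; cod1 A f = dom1 A g\<rbrakk> \<Longrightarrow>
      is1 E (cmp1 E (a1 g) (a1 f)) (a0 (dom1 A f)) (a0 (cod1 A g))"
    and a_unitor: "X \<in> C0 A \<Longrightarrow>
      iso2 E (PCell (one1 E (a0 X)) (a1 (one1 A X)) (unitor H0 X) (unitor H1 X))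
        (one1 E (a0 X)) (a1 (one1 A X))"
    and a_compositor: "\<lbrakk>f \<in> C1 A; g \<in> C1 A; cod1 A f = dom1 A g\<rbrakk> \<Longrightarrow>
      iso2 E (PCell (cmp1 E (a1 g) (a1 f)) (a1 (cmp1 A g f)) (compositor H0 g f) (compositor H1 g
      f))
        (cmp1 E (a1 g) (a1 f)) (a1 (cmp1 A g f))"
    and a_one: "f \<in> C1 A \<Longrightarrow> cmp1 E (a1 f) (one1 E (a0 (dom1 A f))) = a1 f"
      "f \<in> C1 A \<Longrightarrow> cmp1 E (one1 E (a0 (cod1 A f))) (a1 f) = a1 f"
    and a_assoc: "\<lbrakk>f \<in> C1 A; g \<in> C1 A; h \<in> C1 A; cod1 A f = dom1 A g; cod1 A g = dom1 A h\<rbrakk> \<Longrightarrow>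
      cmp1 E (cmp1 E (a1 h) (a1 g)) (a1 f) = cmp1 E (a1 h) (cmp1 E (a1 g) (a1 f))"
begin

abbreviation "S \<equiv> pair_pseudo A E a0 a1 H0 H1"

lemma S_sel [simp]:
  "X \<in> C0 A \<Longrightarrow> act0 S X = a0 X" "f \<in> C1 A \<Longrightarrow> act1 S f = a1 f"
  "u \<in> C2 A \<Longrightarrow> act2 S u = PCell (a1 (dom2 A u)) (a1 (cod2 A u)) (act2 H0 u) (act2 H1 u)"
  "\<Gamma> \<in> C3 A \<Longrightarrow> act3 S \<Gamma> = PCell (act2 S (dom3 A \<Gamma>)) (act2 S (cod3 A \<Gamma>)) (act3 H0 \<Gamma>) (act3 H1 \<Gamma>)"
  "X \<in> C0 A \<Longrightarrow> unitor S X =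
    PCell (one1 E (a0 X)) (a1 (one1 A X)) (unitor H0 X) (unitor H1 X)"
  "\<lbrakk>f \<in> C1 A; g \<in> C1 A; cod1 A f = dom1 A g\<rbrakk> \<Longrightarrow> compositor S g f =
    PCell (cmp1 E (a1 g) (a1 f)) (a1 (cmp1 A g f)) (compositor H0 g f) (compositor H1 g f)"
  by (simp_all add: pair_pseudo_def composable_def Let_def)

lemmas base_boundaries [simp] =
  boundaries[OF H0.arrow_pseudofunctor_axioms] boundaries[OF H1.arrow_pseudofunctor_axioms]

lemma S_pseudofunctor: "arrow_pseudofunctor A E S"
  apply unfold_locales
  subgoal using a_ext by (simp add: gmap_extensional_def pair_pseudo_def Let_def)
  subgoal by (simp add: pair_pseudo_def)
  subgoal by (simp add: pair_pseudo_def)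
  subgoal by (simp add: a_obj)
  subgoal for f using a_mor[of f] by simp
  subgoal for u using a_two[of u] by (simp add: is2_def)
  subgoal for \<Gamma> using a_three[of \<Gamma>] by (simp add: is3_def)
  subgoal for f g using a_cmp[of f g] by simp
  subgoal for f using H0.map_one2[of f] H1.map_one2[of f] by simp
  subgoal for u using H0.map_one3[of u] H1.map_one3[of u] by simp
  subgoal for u v using H0.map_cmp2[of u v] H1.map_cmp2[of u v] by simp
  subgoal for \<Gamma> \<Delta> using H0.map_vcmp3[of \<Gamma> \<Delta>] H1.map_vcmp3[of \<Gamma> \<Delta>] by simp
  subgoal for \<Gamma> \<Delta>
    using H0.map_hcmp3[of \<Gamma> \<Delta>] H1.map_hcmp3[of \<Gamma> \<Delta>]
      H0.map_cmp2[of "dom3 A \<Gamma>" "dom3 A \<Delta>"] H0.map_cmp2[of "cod3 A \<Gamma>" "cod3 A \<Delta>"]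
      H1.map_cmp2[of "dom3 A \<Gamma>" "dom3 A \<Delta>"] H1.map_cmp2[of "cod3 A \<Gamma>" "cod3 A \<Delta>"] by simp
  subgoal for X using a_unitor[of X] by (simp del: pair_sel)
  subgoal for f g using a_compositor[of f g] by (simp del: pair_sel)
  subgoal for f v using H0.nat2l[of f v] H1.nat2l[of f v] by simp
  subgoal for u g using H0.nat2r[of u g] H1.nat2r[of u g] by simp
  subgoal for f \<Gamma>
    using H0.nat3l[of f \<Gamma>] H1.nat3l[of f \<Gamma>] H0.nat2l[of f "dom3 A \<Gamma>"] H0.nat2l[of f "cod3 A \<Gamma>"]
      H1.nat2l[of f "dom3 A \<Gamma>"] H1.nat2l[of f "cod3 A \<Gamma>"] by simp
  subgoal for \<Gamma> g
    using H0.nat3r[of \<Gamma> g] H1.nat3r[of \<Gamma> g] H0.nat2r[of "dom3 A \<Gamma>" g] H0.nat2r[of "cod3 A \<Gamma>" g]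
      H1.nat2r[of "dom3 A \<Gamma>" g] H1.nat2r[of "cod3 A \<Gamma>" g] by simp
  \<comment> \<open>The two parts of the 3-cell are the equations for \<open>H0\<close> and
    \<open>H1\<close>; the rest compares stored 2-cells.\<close>
  subgoal premises a for u v
    using a H0.nat_ich[OF a] H1.nat_ich[OF a] nat_ich_boundary[OF H0.arrow_pseudofunctor_axioms a]
      nat_ich_boundary[OF H1.arrow_pseudofunctor_axioms a] by simp
  subgoal for f using H0.gamma[of f] H1.gamma[of f] a_one(2)[of f] by simp
  subgoal for f using H0.delta[of f] H1.delta[of f] a_one(1)[of f] by simp
  subgoal for f g h using H0.omega[of f g h] H1.omega[of f g h] a_assoc[of f g h] by simp
  subgoal premises a for f g h k
    using a H0.coherence[OF a] H1.coherence[OF a]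
      coherence_boundary[OF H0.arrow_pseudofunctor_axioms a]
      coherence_boundary[OF H1.arrow_pseudofunctor_axioms a] by simp
  done

lemma S_projections: "after A K0 S = H0" "after A K1 S = H1"
proof -
  interpret S: arrow_pseudofunctor A E S by (rule S_pseudofunctor)
  have m: "X \<in> C0 A \<Longrightarrow> act0 S X \<in> C0 E" "f \<in> C1 A \<Longrightarrow> act1 S f \<in> C1 E" "u \<in> C2 A \<Longrightarrow> act2 S u \<in> C2 E"
    "\<Gamma> \<in> C3 A \<Longrightarrow> act3 S \<Gamma> \<in> C3 E" "X \<in> C0 A \<Longrightarrow> unitor S X \<in> C2 E"
    "\<lbrakk>f \<in> C1 A; g \<in> C1 A; cod1 A f = dom1 A g\<rbrakk> \<Longrightarrow> compositor S g f \<in> C2 E" for X f u \<Gamma> g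
    using S.obj[of X] S.mor[of f] S.two[of u] S.three[of \<Gamma>] S.unitor_iso[of X]
      S.compositor_iso[of f g]
    by (auto simp: is1_def is2_def is3_def iso2_def)
  note e0 = H0.ext[unfolded gmap_extensional_def] and e1 = H1.ext[unfolded gmap_extensional_def]
  have "act0 (after A K0 S) = act0 H0" "act0 (after A K1 S) = act0 H1"
      "act1 (after A K0 S) = act1 H0" "act1 (after A K1 S) = act1 H1"
     "act2 (after A K0 S) = act2 H0" "act2 (after A K1 S) = act2 H1"
     "act3 (after A K0 S) = act3 H0" "act3 (after A K1 S) = act3 H1"
    unfolding after_def using e0(1) e1(1) m
    by (auto intro!: restrict_eqI)
  moreover have "unitor (after A K0 S) = unitor H0" "unitor (after A K1 S) = unitor H1"
    unfolding after_def using restrict_eqI[OF e0(2)] restrict_eqI[OF e1(2)] m(5) by simp_all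
  moreover have "compositor (after A K0 S) = compositor H0"
      "compositor (after A K1 S) = compositor H1"
    unfolding after_def using e0(3) e1(3) m(6) by (auto simp: fun_eq_iff composable_def)
  ultimately show "after A K0 S = H0" "after A K1 S = H1"
    by (auto intro!: pseudo.equality)
qed

end

context pair_path
begin

text \<open>A cell of dimension 2 or 3 consists of its boundary and its two projections. Hence
  \<open>R\<close> can be rebuilt from its projections and its action on objects and
  1-cells.\<close>

lemma determined:
  assumes "gray_category A" "arrow_pseudofunctor A E R" "after A K0 R = H0" "after A K1 R = H1"
  shows "R = pair_pseudo A E (act0 R) (act1 R) H0 H1"
    and "X \<in> C0 A \<Longrightarrow> ob0 (act0 R X) = act0 H0 X \<and> ob1 (act0 R X) = act0 H1 X"
    and "f \<in> C1 A \<Longrightarrow> fa0 (act1 R f) = act1 H0 f \<and> fa1 (act1 R f) = act1 H1 f"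
proof -
  interpret A: gray_category A by fact
  interpret R: arrow_pseudofunctor A E R by fact
  have m: "X \<in> C0 A \<Longrightarrow> act0 R X \<in> C0 E" "f \<in> C1 A \<Longrightarrow> act1 R f \<in> C1 E"
    "u \<in> C2 A \<Longrightarrow> act2 R u \<in> C2 E \<and> pdom (act2 R u) = act1 R (dom2 A u) \<and> pcod (act2 R u)
      = act1 R (cod2 A u)"
    "\<Gamma> \<in> C3 A \<Longrightarrow> act3 R \<Gamma> \<in> C3 E \<and> pdom (act3 R \<Gamma>) = act2 R (dom3 A \<Gamma>) \<and> pcod (act3 R \<Gamma>)
      = act2 R (cod3 A \<Gamma>)"
    "X \<in> C0 A \<Longrightarrow> unitor R X \<in> C2 E \<and> pdom (unitor R X) = one1 E (act0 R X) \<and>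
      pcod (unitor R X) = act1 R (one1 A X)"
    "\<lbrakk>f \<in> C1 A; g \<in> C1 A; cod1 A f = dom1 A g\<rbrakk> \<Longrightarrow> compositor R g f \<in> C2 E \<and>
      pdom (compositor R g f) = cmp1 E (act1 R g) (act1 R f) \<and> pcod (compositor R g f) = act1 R
      (cmp1 A g f)"
    for X f u \<Gamma> g
    using R.obj[of X] R.mor[of f] R.two[of u] R.three[of \<Gamma>] R.unitor_iso[of X]
      R.compositor_iso[of f g]
    by (auto simp: is1_def is2_def is3_def iso2_def)
  show "ob0 (act0 R X) = act0 H0 X \<and> ob1 (act0 R X) = act0 H1 X" if "X \<in> C0 A"
    using that m(1) by (simp add: assms(3,4)[symmetric] after_def)
  show "fa0 (act1 R f) = act1 H0 f \<and> fa1 (act1 R f) = act1 H1 f" if "f \<in> C1 A"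
    using that m(2) by (simp add: assms(3,4)[symmetric] after_def)
  have e: "act2 R \<in> extensional (C2 A)" "act3 R \<in> extensional (C3 A)" using R.ext(1)
    by (auto simp: gmap_extensional_def)
  let ?P = "pair_pseudo A E (act0 R) (act1 R) H0 H1"
  have h: "u \<in> C2 A \<Longrightarrow> act2 H0 u = part0 (act2 R u)" "u \<in> C2 A \<Longrightarrow> act2 H1 u = part1 (act2 R u)"
    "\<Gamma> \<in> C3 A \<Longrightarrow> act3 H0 \<Gamma> = part0 (act3 R \<Gamma>)" "\<Gamma> \<in> C3 A \<Longrightarrow> act3 H1 \<Gamma> = part1 (act3 R \<Gamma>)"
    "X \<in> C0 A \<Longrightarrow> unitor H0 X = part0 (unitor R X)" "X \<in> C0 A \<Longrightarrow> unitor H1 X = part1 (unitor R X)"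
    "composable A g f \<Longrightarrow> compositor H0 g f = part0 (compositor R g f)"
    "composable A g f \<Longrightarrow> compositor H1 g f = part1 (compositor R g f)" for u \<Gamma> X g f
    using m(3)[of u] m(4)[of \<Gamma>] m(5)[of X] m(6)[of f g]
    by (auto simp: assms(3,4)[symmetric] after_def composable_def)
  have 2: "PCell (act1 R (dom2 A u)) (act1 R (cod2 A u)) (act2 H0 u) (act2 H1 u) = act2 R u" if
      "u \<in> C2 A" for u
    using h(1,2) m(3)[OF that] that by (intro pcell.expand) simp
  \<comment> \<open>The boundary 1-cells of \<open>cod3 A \<Gamma>\<close> are written through
    \<open>dom3 A \<Gamma>\<close>, the form in which the simplifier leaves them.\<close>
  have 3: "PCell (act1 R (dom2 A (dom3 A \<Gamma>))) (act1 R (cod2 A (dom3 A \<Gamma>))) (act2 H0 (dom3 A \<Gamma>))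
      (act2 H1 (dom3 A \<Gamma>)) = act2 R (dom3 A \<Gamma>)"
    "PCell (act1 R (dom2 A (dom3 A \<Gamma>))) (act1 R (cod2 A (dom3 A \<Gamma>))) (act2 H0 (cod3 A \<Gamma>)) (act2 H1
      (cod3 A \<Gamma>)) = act2 R (cod3 A \<Gamma>)"
    if "\<Gamma> \<in> C3 A" for \<Gamma>
    using 2[of "dom3 A \<Gamma>"] 2[of "cod3 A \<Gamma>"] that by simp_all
  have "act2 ?P = act2 R"
    unfolding pair_pseudo_def Let_def using 2 by (simp add: restrict_eqI[OF e(1)])
  moreover have "act3 ?P = act3 R"
    unfolding pair_pseudo_def Let_def using m(4) h(3,4) 3
    by (simp, intro restrict_eqI[OF e(2)] pcell.expand) simp
  moreover have "unitor ?P = unitor R"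
    unfolding pair_pseudo_def Let_def using m(5) h(5,6)
    by (auto intro!: restrict_eqI[OF R.ext(2)] pcell.expand)
  moreover have "compositor ?P g f = compositor R g f" for g f
  proof (cases "composable A g f")
    case True
    then show ?thesis
      using m(6) h(7,8) by (auto intro!: pcell.expand simp: composable_def pair_pseudo_def Let_def)
  qed (simp add: pair_pseudo_def Let_def R.ext(3))
  moreover have "act0 ?P = act0 R" "act1 ?P = act1 R"
    using R.ext(1) by (simp_all add: pair_pseudo_def gmap_extensional_def extensional_restrict)
  ultimately show "R = ?P" by (intro pseudo.equality) (auto simp: fun_eq_iff)
qed

end


section \<open>The path object of 2-cells\<close>

lemma path2_sel [simp]:
  "C0 (path2 B) = C2 B" "C1 (path2 B) = p2_mors B" "C2 (path2 B) = p2_twos B"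
  "C3 (path2 B) = p2_threes B"
  "dom1 (path2 B) = m2dom" "cod1 (path2 B) = m2cod" "dom2 (path2 B) = pdom" "cod2 (path2 B) = pcod"
  "dom3 (path2 B) = pdom" "cod3 (path2 B) = pcod"
  "one1 (path2 B) X = P2Mor X X (one1 (path1 B) (dom2 B X)) (one1 (path1 B) (cod2 B X)) (one3 B X)"
  "cmp1 (path2 B) = p2_cmp1 B" "cmp2 (path2 B) = p2_cmp2 B"
  by (simp_all add: path2_def)

lemma p2_cmp1_sel [simp]:
  "m2dom (p2_cmp1 B u' u) = m2dom u" "m2cod (p2_cmp1 B u' u) = m2cod u'"
  "face0 (p2_cmp1 B u' u) = p1_cmp1 B (face0 u') (face0 u)"
  "face1 (p2_cmp1 B u' u) = p1_cmp1 B (face1 u') (face1 u)"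
  by (simp_all add: p2_cmp1_def)

lemma mcell_p2_cmp1: "mcell (p2_cmp1 B u' u) =
    vcmp3 B (rwhisk B (lwh3 B (mor1 (face0 u')) (mcell u)) (rwh2 B (mlft (face0 u')) (mor0 (face0
    u))))
      (lwhisk B (lwh2 B (mor1 (face0 u')) (mlft (face1 u))) (rwh3 B (mcell u') (mor0 (face0 u))))"
  by (simp add: p2_cmp1_def)

lemma pair_path_path2:
  "pair_path (path1 B) (path2 B) (path_s1 B) (path_t1 B) (dom2 B) (cod2 B) face0 face1"
  by unfold_locales (simp_all add: path2_def p2_cmp2_def p2_lwh2_def p2_rwh2_def path_s1_def
    path_t1_def)

context gray_category
begin

section \<open>Cells of the path object of 2-cells, and inverses over identities\<close>

lemma p2_mors_iff: "w \<in> p2_mors A \<longleftrightarrow> m2dom w \<in> C2 A \<and> m2cod w \<in> C2 A \<and>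
    face0 w \<in> p1_mors A \<and> mdom (face0 w) = dom2 A (m2dom w) \<and> mcod (face0 w) = dom2 A (m2cod w) \<and>
    face1 w \<in> p1_mors A \<and> mdom (face1 w) = cod2 A (m2dom w) \<and> mcod (face1 w) = cod2 A (m2cod w) \<and>
    mor0 (face1 w) = mor0 (face0 w) \<and> mor1 (face1 w) = mor1 (face0 w) \<and>
    invertible3 A (mcell w) \<and> mcell w \<in> C3 A \<and>
    dom3 A (mcell w) = mlft (face1 w) \<odot> (m2cod w \<lhd> mor0 (face0 w)) \<and>
    cod3 A (mcell w) = (mor1 (face0 w) \<rhd> m2dom w) \<odot> mlft (face0 w)"
  by (cases w) (auto simp: p2_mors_def is1_def is3_def iso3_iff)

lemma p2_mors_simps [simp]:
  assumes "w \<in> p2_mors A"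
  shows "m2dom w \<in> C2 A" "m2cod w \<in> C2 A"
    "face0 w \<in> p1_mors A" "mdom (face0 w) = dom2 A (m2dom w)" "mcod (face0 w) = dom2 A (m2cod w)"
    "face1 w \<in> p1_mors A" "mdom (face1 w) = cod2 A (m2dom w)" "mcod (face1 w) = cod2 A (m2cod w)"
    "mor0 (face1 w) = mor0 (face0 w)" "mor1 (face1 w) = mor1 (face0 w)"
    "invertible3 A (mcell w)" "mcell w \<in> C3 A"
    "dom3 A (mcell w) = mlft (face1 w) \<odot> (m2cod w \<lhd> mor0 (face0 w))"
    "cod3 A (mcell w) = (mor1 (face0 w) \<rhd> m2dom w) \<odot> mlft (face0 w)"
  using assms by (auto simp: p2_mors_iff)

lemma p2_faces_simps [simp]:
  assumes "w \<in> p2_mors A"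
  shows "mor0 (face0 w) \<in> C1 A" "mor1 (face0 w) \<in> C1 A"
    "dom1 A (mor0 (face0 w)) = dom1 A (dom2 A (m2dom w))"
    "cod1 A (mor0 (face0 w)) = dom1 A (dom2 A (m2cod w))"
    "dom1 A (mor1 (face0 w)) = cod1 A (dom2 A (m2dom w))"
    "cod1 A (mor1 (face0 w)) = cod1 A (dom2 A (m2cod w))"
    "mlft (face0 w) \<in> C2 A" "dom2 A (mlft (face0 w)) = dom2 A (m2cod w) \<bullet> mor0 (face0 w)"
    "cod2 A (mlft (face0 w)) = mor1 (face0 w) \<bullet> dom2 A (m2dom w)"
    "mlft (face1 w) \<in> C2 A" "dom2 A (mlft (face1 w)) = cod2 A (m2cod w) \<bullet> mor0 (face0 w)"
    "cod2 A (mlft (face1 w)) = mor1 (face0 w) \<bullet> cod2 A (m2dom w)"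
  using assms p1_mors_simps[of "face0 w"] p1_mors_simps[of "face1 w"] by simp_all

lemma p2_twos_iff: "\<Phi> \<in> p2_twos A \<longleftrightarrow> pdom \<Phi> \<in> p2_mors A \<and> pcod \<Phi> \<in> p2_mors A \<and>
    m2dom (pcod \<Phi>) = m2dom (pdom \<Phi>) \<and> m2cod (pcod \<Phi>) = m2cod (pdom \<Phi>) \<and>
    part0 \<Phi> \<in> p1_twos A \<and> tdom (part0 \<Phi>) = face0 (pdom \<Phi>) \<and> tcod (part0 \<Phi>) = face0 (pcod \<Phi>) \<and>
    part1 \<Phi> \<in> p1_twos A \<and> tdom (part1 \<Phi>) = face1 (pdom \<Phi>) \<and> tcod (part1 \<Phi>) = face1 (pcod \<Phi>) \<and>
    two0 (part1 \<Phi>) = two0 (part0 \<Phi>) \<and> two1 (part1 \<Phi>) = two1 (part0 \<Phi>) \<and>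
    (ich A (two1 (part0 \<Phi>)) (m2dom (pdom \<Phi>)) \<lhd>\<odot> mlft (face0 (pdom \<Phi>)))
        \<cdot> ((mor1 (face0 (pcod \<Phi>)) \<rhd> m2dom (pdom \<Phi>)) \<odot>\<rhd> tsq (part0 \<Phi>))
        \<cdot> (mcell (pcod \<Phi>) \<lhd>\<odot> (dom2 A (m2cod (pdom \<Phi>)) \<rhd> two0 (part0 \<Phi>)))
      = ((two1 (part0 \<Phi>) \<lhd> cod2 A (m2dom (pdom \<Phi>))) \<odot>\<rhd> mcell (pdom \<Phi>))
        \<cdot> (tsq (part1 \<Phi>) \<lhd>\<odot> (m2cod (pdom \<Phi>) \<lhd> mor0 (face0 (pdom \<Phi>))))
        \<cdot> (mlft (face1 (pcod \<Phi>)) \<odot>\<rhd> inv3 A (ich A (m2cod (pdom \<Phi>)) (two0 (part0 \<Phi>))))"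
  by (cases \<Phi>) (auto simp: p2_twos_def is2_def)

lemma p2_threes_iff: "\<Lambda> \<in> p2_threes A \<longleftrightarrow> pdom \<Lambda> \<in> p2_twos A \<and> pcod \<Lambda> \<in> p2_twos A \<and>
    pdom (pcod \<Lambda>) = pdom (pdom \<Lambda>) \<and> pcod (pcod \<Lambda>) = pcod (pdom \<Lambda>) \<and>
    part0 \<Lambda> \<in> p1_threes A \<and> pdom (part0 \<Lambda>) = part0 (pdom \<Lambda>) \<and> pcod (part0 \<Lambda>) = part0 (pcod \<Lambda>) \<and>
    part1 \<Lambda> \<in> p1_threes A \<and> pdom (part1 \<Lambda>) = part1 (pdom \<Lambda>) \<and> pcod (part1 \<Lambda>) = part1 (pcod \<Lambda>) \<and>
    part0 (part1 \<Lambda>) = part0 (part0 \<Lambda>) \<and> part1 (part1 \<Lambda>) = part1 (part0 \<Lambda>)"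
  by (cases \<Lambda>) (auto simp: p2_threes_def is3_def)

text \<open>For identities \<open>\<phi>\<^sub>0\<close>, \<open>\<phi>\<^sub>1\<close>, both interchangers in the condition on 2-cells are identities.\<close>

lemma p2_twos_identical_iff:
  assumes "u \<in> p2_mors A" "v \<in> p2_mors A" "m2dom v = m2dom u" "m2cod v = m2cod u"
    "\<phi> \<in> p1_twos A" "tdom \<phi> = face0 u" "tcod \<phi> = face0 v"
    "\<psi> \<in> p1_twos A" "tdom \<psi> = face1 u" "tcod \<psi> = face1 v" "p1_identical \<phi>" "p1_identical \<psi>"
  shows "PCell u v \<phi> \<psi> \<in> p2_twos A \<longleftrightarrow>
    ((mor1 (face0 u) \<rhd> m2dom u) \<odot>\<rhd> tsq \<phi>) \<cdot> mcell v = mcell u \<cdot>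
    (tsq \<psi> \<lhd>\<odot> (m2cod u \<lhd> mor0 (face0 u)))"
  using assms p1_identical_simps[OF assms(5,11)] p1_identical_simps[OF assms(8,12)]
  by (subst p2_twos_iff) simp

definition p2_inv :: "('f, 'a, 'g) p2two \<Rightarrow> ('f, 'a, 'g) p2two" where
  "p2_inv \<Phi> = PCell (pcod \<Phi>) (pdom \<Phi>) (p1_inv (part0 \<Phi>)) (p1_inv (part1 \<Phi>))"

text \<open>Over identities, membership is a single equation between invertible 3-cells. Inverting
  it and moving both copies of \<open>mcell\<close> back across yields the same equation for the
  inverse.\<close>

lemma p2_inv:
  assumes "\<Phi> \<in> p2_twos A" "p1_identical (part0 \<Phi>)" "p1_identical (part1 \<Phi>)"
  shows "p2_inv \<Phi> \<in> p2_twos A"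
    "p2_cmp2 A (p2_inv \<Phi>) \<Phi> = one2 (path2 A) (pdom \<Phi>)"
    "p2_cmp2 A \<Phi> (p2_inv \<Phi>) = one2 (path2 A) (pcod \<Phi>)"
proof -
  obtain u v \<phi> \<psi> where P: "\<Phi> = PCell u v \<phi> \<psi>" by (cases \<Phi>)
  have a: "u \<in> p2_mors A" "v \<in> p2_mors A" "m2dom v = m2dom u" "m2cod v = m2cod u"
    "\<phi> \<in> p1_twos A" "tdom \<phi> = face0 u" "tcod \<phi> = face0 v"
    "\<psi> \<in> p1_twos A" "tdom \<psi> = face1 u" "tcod \<psi> = face1 v" "p1_identical \<phi>" "p1_identical \<psi>"
    using assms unfolding P by (auto simp: p2_twos_iff)
  note I = p1_identical_simps[OF a(5,11)] and J = p1_identical_simps[OF a(8,12)]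
  have "((mor1 (face0 u) \<rhd> m2dom u) \<odot>\<rhd> tsq \<phi>) \<cdot> mcell v
      = mcell u \<cdot> (tsq \<psi> \<lhd>\<odot> (m2cod u \<lhd> mor0 (face0 u)))"
    using assms(1) p2_twos_identical_iff[OF a] unfolding P by blast
  \<comment> \<open>This inverts the squares as wanted, but also both \<open>mcell\<close>s;
    \<open>inv3_flip\<close> undoes the latter.\<close>
  from arg_cong[OF this, of "inv3 A"]
  have "inv3 A (mcell v) \<cdot> ((mor1 (face0 u) \<rhd> m2dom u) \<odot>\<rhd> inv3 A (tsq \<phi>))
      = (inv3 A (tsq \<psi>) \<lhd>\<odot> (m2cod u \<lhd> mor0 (face0 u))) \<cdot> inv3 A (mcell u)"
    using a I J by simp
  then have "((mor1 (face0 v) \<rhd> m2dom v) \<odot>\<rhd> tsq (p1_inv \<phi>)) \<cdot> mcell u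
      = mcell v \<cdot> (tsq (p1_inv \<psi>) \<lhd>\<odot> (m2cod v \<lhd> mor0 (face0 v)))"
    using a I J by (subst inv3_flip) (simp_all add: p1_inv_def)
  then show "p2_inv \<Phi> \<in> p2_twos A"
    using a p1_inv[OF a(5,11)] p1_inv[OF a(8,12)] I J unfolding P p2_inv_def pcell.sel
    by (subst p2_twos_identical_iff) (simp_all add: p1_inv_def p1_identical_def)
  show "p2_cmp2 A (p2_inv \<Phi>) \<Phi> = one2 (path2 A) (pdom \<Phi>)"
      "p2_cmp2 A \<Phi> (p2_inv \<Phi>) = one2 (path2 A) (pcod \<Phi>)"
    using p1_inv[OF a(5,11)] p1_inv[OF a(8,12)] a
    by (simp_all add: P p2_cmp2_def path2_def p2_inv_def)
qed

lemma p2_iso2I: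
  assumes "\<Phi> \<in> p2_twos A" "p1_identical (part0 \<Phi>)" "p1_identical (part1 \<Phi>)"
  shows "iso2 (path2 A) \<Phi> (pdom \<Phi>) (pcod \<Phi>)"
  using assms p2_inv[OF assms] by (auto simp: iso2_def is2_def p2_inv_def intro!: exI[of _
    "p2_inv \<Phi>"])

lemma p2_one1_mem: "X \<in> C2 A \<Longrightarrow> one1 (path2 A) X \<in> p2_mors A"
  using p1_one1_mem[of "dom2 A X"] p1_one1_mem[of "cod2 A X"]
  by (subst p2_mors_iff) (simp add: one_adj_def)

lemma p2_cmp1_mem [simp]:
  assumes "u \<in> p2_mors A" "v \<in> p2_mors A" "m2cod u = m2dom v"
  shows "p2_cmp1 A v u \<in> p2_mors A"
  using assms by (subst p2_mors_iff) (simp add: p2_cmp1_def)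

lemma p2_cmp1_assoc:
  assumes "u \<in> p2_mors A" "v \<in> p2_mors A" "w \<in> p2_mors A" "m2cod u = m2dom v" "m2cod v = m2dom w"
  shows "p2_cmp1 A (p2_cmp1 A w v) u = p2_cmp1 A w (p2_cmp1 A v u)"
proof -
  have "p1_cmp1 A (p1_cmp1 A (face0 w) (face0 v)) (face0 u)
      = p1_cmp1 A (face0 w) (p1_cmp1 A (face0 v) (face0 u))"
    "p1_cmp1 A (p1_cmp1 A (face1 w) (face1 v)) (face1 u)
      = p1_cmp1 A (face1 w) (p1_cmp1 A (face1 v) (face1 u))"
    using assms by (auto intro!: p1_cmp1_assoc)
  then show ?thesis using assms by (simp add: p2_cmp1_def)
qed

lemma p2_cmp1_one:
  assumes "u \<in> p2_mors A"
  shows "m2dom u = X \<Longrightarrow> p2_cmp1 A u (one1 (path2 A) X) = u"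
    "m2cod u = X \<Longrightarrow> p2_cmp1 A (one1 (path2 A) X) u = u"
proof -
  { assume "m2dom u = X"
    then have x: "X = m2dom u" by simp
    show "p2_cmp1 A u (one1 (path2 A) X) = u"
      unfolding x using assms p1_cmp1_one(1)[of "face0 u" "dom2 A (m2dom u)"]
        p1_cmp1_one(1)[of "face1 u" "cod2 A (m2dom u)"]
      by (intro p2mor.expand) (simp add: p2_cmp1_def one_adj_def) }
  { assume "m2cod u = X"
    then have x: "X = m2cod u" by simp
    show "p2_cmp1 A (one1 (path2 A) X) u = u"
      unfolding x using assms p1_cmp1_one(2)[of "face0 u" "dom2 A (m2cod u)"]
        p1_cmp1_one(2)[of "face1 u" "cod2 A (m2cod u)"]
      by (intro p2mor.expand) (simp add: p2_cmp1_def one_adj_def) }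
qed

end


section \<open>Trimodifications\<close>

text \<open>The cell of a 1-cell of \<open>path2\<close> starts at the face coming from
  \<open>q\<close>, whereas \<open>md1\<close> ends there; hence the inverse.\<close>

definition p2_mor where
  "p2_mor A B F G p q \<sigma> f = P2Mor (md0 \<sigma> (dom1 A f)) (md0 \<sigma> (cod1 A f))
    (p1_mor A F G p f) (p1_mor A F G q f) (inv3 B (md1 \<sigma> f))"

definition pseudo2 where
  "pseudo2 A B F G p q \<sigma> = pair_pseudo A (path2 B) (md0 \<sigma>) (p2_mor A B F G p q \<sigma>)
    (pseudo1 A B F G p) (pseudo1 A B F G q)"

locale trinat_pair = two_gray_functors A B F G + p: arrow_trinat A B F G p + q: arrow_trinat A B F
G q
  for A and B (structure) and F G p q

locale trimod_data = trinat_pair A B F G p q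
  for A :: "('o, 'f, 'a, 'g) gray" and B :: "('p, 'h, 'b, 'k) gray" (structure)
    and F :: "('o, 'f, 'a, 'g, 'p, 'h, 'b, 'k) gmap"
    and G :: "('o, 'f, 'a, 'g, 'p, 'h, 'b, 'k) gmap"
    and p :: "('o, 'f, 'a, 'h, 'b, 'k) trinat"
    and q :: "('o, 'f, 'a, 'h, 'b, 'k) trinat" +
  fixes \<sigma> :: "('o, 'f, 'b, 'k) trimod"
  assumes ext: "md0 \<sigma> \<in> extensional (C0 A)" "md1 \<sigma> \<in> extensional (C1 A)"
    and component: "X \<in> C0 A \<Longrightarrow> is2 B (md0 \<sigma> X) (tr0 p X) (tr0 q X)"
    and naturality: "f \<in> C1 A \<Longrightarrow> iso3 B (md1 \<sigma> f)
      ((act1 G f \<rhd> md0 \<sigma> (dom1 A f)) \<odot> tr1 p f) (tr1 q f \<odot> (md0 \<sigma> (cod1 A f) \<lhd> act1 F f))"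
begin

lemma md0_simps [simp]:
  assumes "X \<in> C0 A"
  shows "md0 \<sigma> X \<in> C2 B" "dom2 B (md0 \<sigma> X) = tr0 p X" "cod2 B (md0 \<sigma> X) = tr0 q X"
  using component[OF assms] by (auto simp: is2_def)

lemma md1_simps [simp]:
  assumes "f \<in> C1 A"
  shows "invertible3 B (md1 \<sigma> f)" "md1 \<sigma> f \<in> C3 B"
    "dom3 B (md1 \<sigma> f) = (act1 G f \<rhd> md0 \<sigma> (dom1 A f)) \<odot> tr1 p f"
    "cod3 B (md1 \<sigma> f) = tr1 q f \<odot> (md0 \<sigma> (cod1 A f) \<lhd> act1 F f)"
  using naturality[OF assms] by (auto simp: iso3_iff is3_def)

abbreviation "s \<equiv> p2_mor A B F G p q \<sigma>"

lemma p2_mor_sel [simp]: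
  "m2dom (s f) = md0 \<sigma> (dom1 A f)" "m2cod (s f) = md0 \<sigma> (cod1 A f)"
  "face0 (s f) = p.m f" "face1 (s f) = q.m f" "mcell (s f) = inv3 B (md1 \<sigma> f)"
  by (simp_all add: p2_mor_def)

lemma p2_mor_mem [simp]: "f \<in> C1 A \<Longrightarrow> s f \<in> p2_mors B"
  by (subst F.B.p2_mors_iff) simp

text \<open>Both sides of the local modification condition have an outer cell \<open>md1\<close>,
  one at the source and one at the target 1-cell. Flipping them gives the condition on 2-cells with
  its sides exchanged.\<close>

lemma two_iff:
  assumes "u \<in> C2 A"
  shows "PCell (s (dom2 A u)) (s (cod2 A u)) (p.t u) (q.t u) \<in> p2_twos B \<longleftrightarrow>
      (tr2 q u \<lhd>\<odot> (md0 \<sigma> (cod1 A (dom2 A u)) \<lhd> act1 F (dom2 A u)))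
          \<cdot> (tr1 q (cod2 A u) \<odot>\<rhd> inv3 B (ich B (md0 \<sigma> (cod1 A (dom2 A u))) (act2 F u)))
          \<cdot> (md1 \<sigma> (cod2 A u) \<lhd>\<odot> (tr0 p (cod1 A (dom2 A u)) \<rhd> act2 F u))
        = ((act2 G u \<lhd> tr0 q (dom1 A (dom2 A u))) \<odot>\<rhd> md1 \<sigma> (dom2 A u))
          \<cdot> (ich B (act2 G u) (md0 \<sigma> (dom1 A (dom2 A u))) \<lhd>\<odot> tr1 p (dom2 A u))
          \<cdot> ((act1 G (cod2 A u) \<rhd> md0 \<sigma> (dom1 A (dom2 A u))) \<odot>\<rhd> tr2 p u)"
  using assms F.B.inv3_flip[of "md1 \<sigma> (cod2 A u) \<lhd>\<odot> (tr0 p (cod1 A (dom2 A u)) \<rhd> act2 F u)"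
    "(act2 G u \<lhd> tr0 q (dom1 A (dom2 A u))) \<odot>\<rhd> md1 \<sigma> (dom2 A u)"
    "(tr2 q u \<lhd>\<odot> (md0 \<sigma> (cod1 A (dom2 A u)) \<lhd> act1 F (dom2 A u)))
          \<cdot> (tr1 q (cod2 A u) \<odot>\<rhd> inv3 B (ich B (md0 \<sigma> (cod1 A (dom2 A u))) (act2 F u)))"
    "(ich B (act2 G u) (md0 \<sigma> (dom1 A (dom2 A u))) \<lhd>\<odot> tr1 p (dom2 A u))
          \<cdot> ((act1 G (cod2 A u) \<rhd> md0 \<sigma> (dom1 A (dom2 A u))) \<odot>\<rhd> tr2 p u)"]
  by (subst F.B.p2_twos_iff) (simp, rule eq_commute)

lemma unitor_identical: "X \<in> C0 A \<Longrightarrow> F.B.p1_identical (p.\<iota> X)"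
   "X \<in> C0 A \<Longrightarrow> F.B.p1_identical (q.\<iota> X)"
  by (simp_all add: F.B.p1_identical_def)

lemma compositor_identical:
  assumes "f \<in> C1 A" "g \<in> C1 A" "cod1 A f = dom1 A g"
  shows "F.B.p1_identical (p.\<chi> g f)" "F.B.p1_identical (q.\<chi> g f)"
  using assms by (simp_all add: F.B.p1_identical_def)

text \<open>The interchangers disappear over identities, and \<open>mcell\<close> of an identity
  1-cell is an identity. Inverting the remaining equation gives the unit law.\<close>

lemma unitor_iff:
  assumes "X \<in> C0 A"
  shows "PCell (one1 (path2 B) (md0 \<sigma> X)) (s (one1 A X)) (p.\<iota> X) (q.\<iota> X) \<in> p2_twos B \<longleftrightarrow>
    md1 \<sigma> (one1 A X) \<cdot> (md0 \<sigma> X \<odot>\<rhd> trunit p X) = trunit q X \<lhd>\<odot> md0 \<sigma> X"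
proof -
  note m = p.unitor_mem[OF assms] q.unitor_mem[OF assms] unitor_identical[OF assms]
      F.B.p2_one1_mem[of "md0 \<sigma> X"]
  have "PCell (one1 (path2 B) (md0 \<sigma> X)) (s (one1 A X)) (p.\<iota> X) (q.\<iota> X) \<in> p2_twos B \<longleftrightarrow>
     (md0 \<sigma> X \<odot>\<rhd> inv3 B (trunit p X)) \<cdot> inv3 B (md1 \<sigma> (one1 A X)) = inv3 B (trunit q X) \<lhd>\<odot> md0 \<sigma> X"
    using assms m by (subst F.B.p2_twos_identical_iff) (simp_all add: one_adj_def)
  also have "\<dots> \<longleftrightarrow> md1 \<sigma> (one1 A X) \<cdot> (md0 \<sigma> X \<odot>\<rhd> trunit p X) = trunit q X \<lhd>\<odot> md0 \<sigma> X"
    using assms by (subst F.B.inv3_inject[symmetric]) (simp_all)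
  finally show ?thesis .
qed

text \<open>The \<open>mcell\<close> of a composite is the inverse of the pasting of
  \<open>md1\<close> at \<open>g\<close> and at \<open>f\<close>. Inverting the whole condition
  therefore produces the composition law.\<close>

lemma compositor_iff:
  assumes "f \<in> C1 A" "g \<in> C1 A" "cod1 A f = dom1 A g"
  shows "PCell (p2_cmp1 B (s g) (s f)) (s (g \<bullet>\<^bsub>A\<^esub> f)) (p.\<chi> g f) (q.\<chi> g f) \<in> p2_twos B \<longleftrightarrow>
      md1 \<sigma> (g \<bullet>\<^bsub>A\<^esub> f) \<cdot> (((act1 G g \<bullet> act1 G f) \<rhd> md0 \<sigma> (dom1 A f)) \<odot>\<rhd> trcmp p g f)
        = (trcmp q g f \<lhd>\<odot> (md0 \<sigma> (cod1 A g) \<lhd> (act1 F g \<bullet> act1 F f)))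
          \<cdot> ((act1 G g \<rhd> tr1 q f) \<odot>\<rhd> (md1 \<sigma> g \<unlhd> act1 F f))
          \<cdot> ((act1 G g \<unrhd> md1 \<sigma> f) \<lhd>\<odot> (tr1 p g \<lhd> act1 F f))"
proof -
  note m = p.compositor_mem[OF assms] q.compositor_mem[OF assms] compositor_identical[OF assms]
  have "PCell (p2_cmp1 B (s g) (s f)) (s (g \<bullet>\<^bsub>A\<^esub> f)) (p.\<chi> g f) (q.\<chi> g f) \<in> p2_twos B \<longleftrightarrow>
     (((act1 G g \<bullet> act1 G f) \<rhd> md0 \<sigma> (dom1 A f)) \<odot>\<rhd> inv3 B (trcmp p g f)) \<cdot> inv3 B
     (md1 \<sigma> (g \<bullet>\<^bsub>A\<^esub> f))
       = (((act1 G g \<unrhd> inv3 B (md1 \<sigma> f)) \<lhd>\<odot> (tr1 p g \<lhd> act1 F f))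
      \<cdot> ((act1 G g \<rhd> tr1 q f) \<odot>\<rhd> (inv3 B (md1 \<sigma> g) \<unlhd> act1 F f)))
       \<cdot> (inv3 B (trcmp q g f) \<lhd>\<odot> (md0 \<sigma> (cod1 A g) \<lhd> (act1 F g \<bullet> act1 F f)))"
    using assms m by (subst F.B.p2_twos_identical_iff) (simp_all add: mcell_p2_cmp1)
  also have "\<dots> \<longleftrightarrow> md1 \<sigma> (g \<bullet>\<^bsub>A\<^esub> f) \<cdot> (((act1 G g \<bullet> act1 G f) \<rhd> md0 \<sigma> (dom1 A f)) \<odot>\<rhd> trcmp p g f)
        = (trcmp q g f \<lhd>\<odot> (md0 \<sigma> (cod1 A g) \<lhd> (act1 F g \<bullet> act1 F f)))
          \<cdot> ((act1 G g \<rhd> tr1 q f) \<odot>\<rhd> (md1 \<sigma> g \<unlhd> act1 F f))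
          \<cdot> ((act1 G g \<unrhd> md1 \<sigma> f) \<lhd>\<odot> (tr1 p g \<lhd> act1 F f))"
    using assms by (subst F.B.inv3_inject[symmetric]) (simp_all)
  finally show ?thesis .
qed

end

locale arrow_trimod = trimod_data +
  assumes two_mem: "u \<in> C2 A \<Longrightarrow>
      PCell (s (dom2 A u)) (s (cod2 A u)) (p.t u) (q.t u) \<in> p2_twos B"
    and unitor_mem: "X \<in> C0 A \<Longrightarrow> PCell (one1 (path2 B) (md0 \<sigma> X)) (s (one1 A X))
      (p.\<iota> X) (q.\<iota> X) \<in> p2_twos B"
    and compositor_mem: "\<lbrakk>f \<in> C1 A; g \<in> C1 A; cod1 A f = dom1 A g\<rbrakk> \<Longrightarrow>
      PCell (p2_cmp1 B (s g) (s f)) (s (g \<bullet>\<^bsub>A\<^esub> f))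
        (p.\<chi> g f) (q.\<chi> g f) \<in> p2_twos B"
begin

lemma pair_data: "pair_data A (path1 B) (path2 B) (path_s1 B) (path_t1 B) (dom2 B)
  (cod2 B) face0 face1 p.P q.P
    (md0 \<sigma>) s"
proof -
  interpret pair_path "path1 B" "path2 B" "path_s1 B" "path_t1 B" "dom2 B" "cod2 B" face0 face1
    by (rule pair_path_path2)
  interpret P: arrow_pseudofunctor A "path1 B" p.P by (rule p.P_pseudofunctor)
  interpret Q: arrow_pseudofunctor A "path1 B" q.P by (rule q.P_pseudofunctor)
  show ?thesis
    apply unfold_locales
    subgoal by (rule ext)
    subgoal by simp
    subgoal by (simp add: is1_def)
    subgoal by simp
    subgoal by simp
    subgoal by simp
    subgoal by simp
    subgoal for u using two_mem[of u] by simp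
    \<comment> \<open>The 3-cells coming from \<open>p\<close> and \<open>q\<close> have the same
      components, namely those of \<open>F\<close> and \<open>G\<close>, so they form a
      pair.\<close>
    subgoal for \<Gamma>
      using two_mem[of "dom3 A \<Gamma>"] two_mem[of "cod3 A \<Gamma>"] P.three[of \<Gamma>] Q.three[of \<Gamma>]
      by (simp add: F.B.p2_threes_iff is3_def)
    subgoal by (simp add: is1_def)
    subgoal for X using F.B.p2_iso2I[OF unitor_mem, of X] unitor_identical[of X] by simp
    subgoal for f g
      using F.B.p2_iso2I[OF compositor_mem, of f g] compositor_identical[of f g] by simp
    subgoal for f using F.B.p2_cmp1_one(1)[of "s f"] by simp
    subgoal for f using F.B.p2_cmp1_one(2)[of "s f"] by simp
    subgoal by (simp add: F.B.p2_cmp1_assoc)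
    done
qed

lemma pseudo2: "arrow_pseudofunctor A (path2 B) (pseudo2 A B F G p q \<sigma>)"
    "after A (path_s1 B) (pseudo2 A B F G p q \<sigma>) = p.P"
    "after A (path_t1 B) (pseudo2 A B F G p q \<sigma>) = q.P"
  using pair_data.S_pseudofunctor[OF pair_data] pair_data.S_projections[OF pair_data]
  unfolding pseudo2_def .

end

section \<open>Comparison with trimodifications, and the inverse construction\<close>

definition trimod_of where
  "trimod_of A B R = \<lparr>md0 = act0 R, md1 = (\<lambda>f\<in>C1 A. inv3 B (mcell (act1 R f)))\<rparr>"

context trinat_pair
begin

lemma trimodification_iff: "trimodification A B F G p q \<sigma> \<longleftrightarrow> arrow_trimod A B F G p q \<sigma>"
proof
  assume "arrow_trimod A B F G p q \<sigma>"
  then interpret arrow_trimod A B F G p q \<sigma> .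
  note ax = two_iff[THEN iffD1, OF _ two_mem] compositor_iff[THEN iffD1, OF _ _ _ compositor_mem]
  show "trimodification A B F G p q \<sigma>"
    apply (rule trimodification.intro)
         apply (fact ext component)+
    subgoal for f X Y
      using naturality[of f] by (auto simp: is1_def)
    subgoal for \<phi> f g X Y
      using ax(1)[of \<phi>] by (clarsimp simp: is1_def is2_def)
    subgoal for X
      using unitor_iff unitor_mem by blast
    subgoal for f X Y g Z
      using ax(2)[of f g] by (auto simp: is1_def)
    done
next
  assume "trimodification A B F G p q \<sigma>"
  then interpret t: trimodification A B F G p q \<sigma> .
  interpret trimod_data A B F G p q \<sigma>
    apply unfold_locales
       apply (fact t.ext t.component)+
    subgoal for f
      by (intro t.naturality) (simp add: is1_def)
    done
  show "arrow_trimod A B F G p q \<sigma>"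
    apply unfold_locales
    subgoal premises a for u
      by (rule two_iff[OF a, THEN iffD2], rule t.local_modification)
        (use a in \<open>auto simp: is1_def is2_def\<close>)
    subgoal premises a for X
      by (rule unitor_iff[OF a, THEN iffD2], rule t.unit_law[OF a])
    subgoal premises a for f g
      by (rule compositor_iff[OF a, THEN iffD2], rule t.composition_law[where Y = "cod1 A f"])
        (use a in \<open>auto simp: is1_def\<close>)
    done
qed

lemma trimod_of_pseudo2:
  assumes "trimod_data A B F G p q \<sigma>"
  shows "trimod_of A B (pseudo2 A B F G p q \<sigma>) = \<sigma>"
proof -
  interpret trimod_data A B F G p q \<sigma> by fact
  have "(\<lambda>f\<in>C1 A. inv3 B (mcell (act1 (pseudo2 A B F G p q \<sigma>) f))) = md1 \<sigma>"
    by (rule restrict_eqI[OF ext(2)]) (simp add: pseudo2_def pair_pseudo_def)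
  then show ?thesis by (simp add: trimod_of_def pseudo2_def pair_pseudo_def)
qed

text \<open>The typed data alone suffice to rebuild \<open>R\<close>. Only afterwards are the three
  axioms obtained, since they assert membership of cells that are now known to be values of
  \<open>R\<close>.\<close>

lemma pseudo2_trimod_of:
  assumes "arrow_pseudofunctor A (path2 B) R"
    and st: "after A (path_s1 B) R = p.P" "after A (path_t1 B) R = q.P"
  shows "arrow_trimod A B F G p q (trimod_of A B R)" "pseudo2 A B F G p q (trimod_of A B R) = R"
proof -
  interpret R: arrow_pseudofunctor A "path2 B" R by fact
  interpret pair_path "path1 B" "path2 B" "path_s1 B" "path_t1 B" "dom2 B" "cod2 B" face0 face1
    by (rule pair_path_path2)
  note d = determined[OF F.A.gray_category_axioms assms]
  let ?\<sigma> = "trimod_of A B R"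
  have C0 [simp]: "act0 R X \<in> C2 B" "dom2 B (act0 R X) = tr0 p X" "cod2 B (act0 R X) = tr0 q X" if
      "X \<in> C0 A" for X
    using R.obj[OF that] d(2)[OF that] that by auto
  have C1 [simp]: "act1 R f \<in> p2_mors B" "m2dom (act1 R f) = act0 R (dom1 A f)"
      "m2cod (act1 R f) = act0 R (cod1 A f)"
    "face0 (act1 R f) = p.m f" "face1 (act1 R f) = q.m f"
    if "f \<in> C1 A" for f
    using R.mor[OF that] d(3)[OF that] that by (auto simp: is1_def)
  have C2: "act2 R u \<in> p2_twos B" if "u \<in> C2 A" for u
    using R.two[OF that] by (auto simp: is2_def)
  have U: "unitor R X \<in> p2_twos B" if "X \<in> C0 A" for X
    using R.unitor_iso[OF that] by (auto simp: iso2_def is2_def)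
  have K: "compositor R g f \<in> p2_twos B" if "f \<in> C1 A" "g \<in> C1 A" "cod1 A f = dom1 A g" for f g
    using R.compositor_iso[OF that] by (auto simp: iso2_def is2_def)
  have q [simp]: "md0 ?\<sigma> = act0 R" "f \<in> C1 A \<Longrightarrow> md1 ?\<sigma> f = inv3 B (mcell (act1 R f))" for f
    by (simp_all add: trimod_of_def)
  have e: "act0 R \<in> extensional (C0 A)" "act1 R \<in> extensional (C1 A)"
    using R.ext(1) by (auto simp: gmap_extensional_def)
  interpret trimod_data A B F G p q ?\<sigma>
  proof unfold_locales
    show "md0 ?\<sigma> \<in> extensional (C0 A)" "md1 ?\<sigma> \<in> extensional (C1 A)" using e
      by (auto simp: trimod_of_def)
  qed (auto simp: is2_def is3_def iso3_iff)
  have s: "s f = act1 R f" if "f \<in> C1 A" for f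
    using that by (intro p2mor.expand) simp
  have "pair_pseudo A (path2 B) (act0 R) s p.P q.P
      = pair_pseudo A (path2 B) (act0 R) (act1 R) p.P q.P"
    by (rule F.A.pair_pseudo_cong) (rule s)
  then show R: "pseudo2 A B F G p q ?\<sigma> = R"
    by (simp only: pseudo2_def q d(1)[symmetric])
  let ?S = "pseudo2 A B F G p q ?\<sigma>"
  have S: "u \<in> C2 A \<Longrightarrow> act2 ?S u = PCell (s (dom2 A u)) (s (cod2 A u)) (p.t u) (q.t u)"
    "X \<in> C0 A \<Longrightarrow> unitor ?S X =
      PCell (one1 (path2 B) (md0 ?\<sigma> X)) (s (one1 A X)) (p.\<iota> X) (q.\<iota> X)"
    "\<lbrakk>f \<in> C1 A; g \<in> C1 A; cod1 A f = dom1 A g\<rbrakk> \<Longrightarrow> compositor ?S g f =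
      PCell (p2_cmp1 B (s g) (s f)) (s (g \<bullet>\<^bsub>A\<^esub> f)) (p.\<chi> g f) (q.\<chi> g f)"
    for u X f g
    unfolding pseudo2_def by (simp_all add: pair_pseudo_def Let_def composable_def)
  \<comment> \<open>Folding the pairs back into values of the rebuilt pseudofunctor, which equals
    \<open>R\<close>, turns all three goals into typing of \<open>R\<close>.\<close>
  show "arrow_trimod A B F G p q ?\<sigma>"
    using C2 U K by unfold_locales (simp_all only: S[symmetric] R)
qed

theorem bij_pseudo2:
  "bij_betw (pseudo2 A B F G p q) {\<sigma>. trimodification A B F G p q \<sigma>}
    {S. three_pseudofunctor A (path2 B) S \<and>
      after A (path_s1 B) S = pseudo1 A B F G p \<and> after A (path_t1 B) S = pseudo1 A B F G q}"
proof (rule bij_betw_byWitness[where f' = "trimod_of A B"], goal_cases)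
  case 1
  show ?case using trimod_of_pseudo2 by (auto simp: trimodification_iff arrow_trimod_def)
next
  case 2
  show ?case using pseudo2_trimod_of(2) by (auto simp: F.A.three_pseudofunctor_iff)
next
  case 3
  show ?case using arrow_trimod.pseudo2
    by (auto simp: trimodification_iff F.A.three_pseudofunctor_iff)
next
  case 4
  show ?case using pseudo2_trimod_of(1) by
      (auto simp: trimodification_iff F.A.three_pseudofunctor_iff)
qed

end


section \<open>The path object of 3-cells and perturbations\<close>

lemma path3_sel [simp]:
  "C0 (path3 B) = C3 B" "C1 (path3 B) = p3_mors B" "C2 (path3 B) = p3_twos B"
  "C3 (path3 B) = p3_threes B"
  "dom1 (path3 B) = pdom" "cod1 (path3 B) = pcod" "dom2 (path3 B) = pdom" "cod2 (path3 B) = pcod"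
  "dom3 (path3 B) = pdom" "cod3 (path3 B) = pcod"
  "one1 (path3 B) x = PCell x x (one1 (path2 B) (dom3 B x)) (one1 (path2 B) (cod3 B x))"
  "cmp1 (path3 B) = p3_cmp1 B" "cmp2 (path3 B) = p3_cmp2 B"
  by (simp_all add: path3_def)

lemma p3_cmp1_sel [simp]:
  "pdom (p3_cmp1 B m' m) = pdom m" "pcod (p3_cmp1 B m' m) = pcod m'"
  "part0 (p3_cmp1 B m' m) = p2_cmp1 B (part0 m') (part0 m)"
  "part1 (p3_cmp1 B m' m) = p2_cmp1 B (part1 m') (part1 m)"
  by (simp_all add: p3_cmp1_def)

lemma pair_path_path3:
  "pair_path (path2 B) (path3 B) (path_s2 B) (path_t2 B) (dom3 B) (cod3 B) part0 part1"
  by unfold_locales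
    (simp_all add: path2_def path3_def p3_cmp2_def p3_lwh2_def p3_rwh2_def path_s2_def path_t2_def
    p3_cmp1_def)

context gray_category
begin

section \<open>Cells of the path object of 3-cells\<close>

lemma p3_mors_iff: "m \<in> p3_mors A \<longleftrightarrow> pdom m \<in> C3 A \<and> pcod m \<in> C3 A \<and>
    part0 m \<in> p2_mors A \<and> m2dom (part0 m) = dom3 A (pdom m) \<and> m2cod (part0 m) = dom3 A (pcod m) \<and>
    part1 m \<in> p2_mors A \<and> m2dom (part1 m) = cod3 A (pdom m) \<and> m2cod (part1 m) = cod3 A (pcod m) \<and>
    face0 (part1 m) = face0 (part0 m) \<and> face1 (part1 m) = face1 (part0 m) \<and>
    mcell (part1 m) \<cdot> (mlft (face1 (part0 m)) \<odot>\<rhd> (pcod m \<unlhd> mor0 (face0 (part0 m))))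
      = ((mor1 (face0 (part0 m)) \<unrhd> pdom m) \<lhd>\<odot> mlft (face0 (part0 m))) \<cdot> mcell (part0 m)"
  by (cases m) (auto simp: p3_mors_def is1_def)

lemma p3_mors_simps [simp]:
  assumes "m \<in> p3_mors A"
  shows "pdom m \<in> C3 A" "pcod m \<in> C3 A" "part0 m \<in> p2_mors A" "part1 m \<in> p2_mors A"
    "m2dom (part0 m) = dom3 A (pdom m)" "m2cod (part0 m) = dom3 A (pcod m)"
    "m2dom (part1 m) = cod3 A (pdom m)" "m2cod (part1 m) = cod3 A (pcod m)"
    "face0 (part1 m) = face0 (part0 m)" "face1 (part1 m) = face1 (part0 m)"
  using assms by (auto simp: p3_mors_iff)

lemma p3_twos_iff: "\<Phi> \<in> p3_twos A \<longleftrightarrow> pdom \<Phi> \<in> p3_mors A \<and> pcod \<Phi> \<in> p3_mors A \<and>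
    pdom (pcod \<Phi>) = pdom (pdom \<Phi>) \<and> pcod (pcod \<Phi>) = pcod (pdom \<Phi>) \<and>
    part0 \<Phi> \<in> p2_twos A \<and> pdom (part0 \<Phi>) = part0 (pdom \<Phi>) \<and> pcod (part0 \<Phi>) = part0 (pcod \<Phi>) \<and>
    part1 \<Phi> \<in> p2_twos A \<and> pdom (part1 \<Phi>) = part1 (pdom \<Phi>) \<and> pcod (part1 \<Phi>) = part1 (pcod \<Phi>) \<and>
    part0 (part1 \<Phi>) = part0 (part0 \<Phi>) \<and> part1 (part1 \<Phi>) = part1 (part0 \<Phi>)"
  by (cases \<Phi>) (auto simp: p3_twos_def is2_def)

lemma p3_threes_iff: "\<Lambda> \<in> p3_threes A \<longleftrightarrow> pdom \<Lambda> \<in> p3_twos A \<and> pcod \<Lambda> \<in> p3_twos A \<and>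
    pdom (pcod \<Lambda>) = pdom (pdom \<Lambda>) \<and> pcod (pcod \<Lambda>) = pcod (pdom \<Lambda>) \<and>
    part0 \<Lambda> \<in> p2_threes A \<and> pdom (part0 \<Lambda>) = part0 (pdom \<Lambda>) \<and> pcod (part0 \<Lambda>) = part0 (pcod \<Lambda>) \<and>
    part1 \<Lambda> \<in> p2_threes A \<and> pdom (part1 \<Lambda>) = part1 (pdom \<Lambda>) \<and> pcod (part1 \<Lambda>) = part1 (pcod \<Lambda>) \<and>
    part0 (part1 \<Lambda>) = part0 (part0 \<Lambda>) \<and> part1 (part1 \<Lambda>) = part1 (part0 \<Lambda>)"
  by (cases \<Lambda>) (auto simp: p3_threes_def is3_def)

text \<open>Both parts of a 2-cell have the same faces, so identity components of the first part
  give those of the second, and the inverses of the parts are again a pair.\<close>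

lemma p3_iso2I:
  assumes "\<Phi> \<in> p3_twos A" "p1_identical (part0 (part0 \<Phi>))" "p1_identical (part1 (part0 \<Phi>))"
  shows "iso2 (path3 A) \<Phi> (pdom \<Phi>) (pcod \<Phi>)"
proof -
  let ?\<Psi> = "PCell (pcod \<Phi>) (pdom \<Phi>) (p2_inv (part0 \<Phi>)) (p2_inv (part1 \<Phi>))"
  note a = assms(1)[unfolded p3_twos_iff]
  have i: "p1_identical (part0 (part1 \<Phi>))" "p1_identical (part1 (part1 \<Phi>))"
    "part0 \<Phi> \<in> p2_twos A" "part1 \<Phi> \<in> p2_twos A"
    using a assms(2,3) by simp_all
  note I = p2_inv[OF i(3) assms(2,3)] p2_inv[OF i(4) i(1,2)]
  have "?\<Psi> \<in> p3_twos A"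
    using a I by (subst p3_twos_iff) (simp add: p2_inv_def)
  moreover have "p3_cmp2 A ?\<Psi> \<Phi> = one2 (path3 A) (pdom \<Phi>)"
      "p3_cmp2 A \<Phi> ?\<Psi> = one2 (path3 A) (pcod \<Phi>)"
    using a I by (simp_all add: p3_cmp2_def path3_def)
  ultimately show ?thesis
    using assms(1) by (auto simp: iso2_def is2_def intro!: exI[of _ ?\<Psi>])
qed

lemma p3_one1_mem:
  assumes "x \<in> C3 A"
  shows "one1 (path3 A) x \<in> p3_mors A"
  using assms p2_one1_mem[of "dom3 A x"] p2_one1_mem[of "cod3 A x"]
  by (subst p3_mors_iff) (simp add: one_adj_def)

text \<open>Paste the compatibility squares of \<open>m'\<close> and \<open>m\<close>, whiskered into the composite.\<close>

lemma p3_cmp1_mem [simp]: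
  assumes "m \<in> p3_mors A" "m' \<in> p3_mors A" "pcod m = pdom m'"
  shows "p3_cmp1 A m' m \<in> p3_mors A"
proof -
  let ?x = "pdom m" and ?y = "pdom m'" and ?z = "pcod m'"
  let ?M0 = "mcell (part0 m)" and ?M1 = "mcell (part1 m)" and ?N0 = "mcell (part0 m')" and ?N1 =
  "mcell (part1 m')"
  let ?f0 = "mor0 (face0 (part0 m))" and ?f1 = "mor1 (face0 (part0 m))"
  let ?h0 = "mor0 (face0 (part0 m'))" and ?h1 = "mor1 (face0 (part0 m'))"
  let ?l0 = "mlft (face0 (part0 m))" and ?l1 = "mlft (face1 (part0 m))"
  let ?k0 = "mlft (face0 (part0 m'))" and ?k1 = "mlft (face1 (part0 m'))"
  note [simp] = assms p2_mors_simps[of "part0 m"] p2_mors_simps[of "part1 m"]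
      p2_faces_simps[of "part0 m"]
  have e: "?M1 \<cdot> (?l1 \<odot>\<rhd> (?y \<unlhd> ?f0)) = ((?f1 \<unrhd> ?x) \<lhd>\<odot> ?l0) \<cdot> ?M0"
    "?N1 \<cdot> (?k1 \<odot>\<rhd> (?z \<unlhd> ?h0)) = ((?h1 \<unrhd> ?y) \<lhd>\<odot> ?k0) \<cdot> ?N0"
    using assms(1,2)[unfolded p3_mors_iff] assms(3) by simp_all
  have 1: "((?h1 \<unrhd> ?M1) \<lhd>\<odot> (?k0 \<lhd> ?f0)) \<cdot> ((?h1 \<rhd> ?l1) \<odot>\<rhd> ((?h1 \<unrhd> ?y) \<unlhd> ?f0) \<lhd>\<odot> (?k0 \<lhd> ?f0))
      = (((?h1 \<bullet> ?f1) \<unrhd> ?x) \<lhd>\<odot> ((?h1 \<rhd> ?l0) \<odot> (?k0 \<lhd> ?f0))) \<cdot> ((?h1 \<unrhd> ?M0) \<lhd>\<odot> (?k0 \<lhd> ?f0))"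
    using arg_cong[OF e(1), of "\<lambda>\<Gamma>. (?h1 \<unrhd> \<Gamma>) \<lhd>\<odot> (?k0 \<lhd> ?f0)"] by simp
  have 2: "((?h1 \<rhd> ?l1) \<odot>\<rhd> (?N1 \<unlhd> ?f0)) \<cdot> (((?h1 \<rhd> ?l1) \<odot> (?k1 \<lhd> ?f0)) \<odot>\<rhd> (?z \<unlhd> (?h0 \<bullet> ?f0)))
      = ((?h1 \<rhd> ?l1) \<odot>\<rhd> ((?h1 \<unrhd> ?y) \<unlhd> ?f0) \<lhd>\<odot> (?k0 \<lhd> ?f0)) \<cdot> ((?h1 \<rhd> ?l1) \<odot>\<rhd> (?N0 \<unlhd> ?f0))"
    using arg_cong[OF e(2), of "\<lambda>\<Gamma>. (?h1 \<rhd> ?l1) \<odot>\<rhd> (\<Gamma> \<unlhd> ?f0)"] by simp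
  have "((?h1 \<unrhd> ?M1) \<lhd>\<odot> (?k0 \<lhd> ?f0)) \<cdot> (((?h1 \<rhd> ?l1) \<odot>\<rhd> (?N1 \<unlhd> ?f0))
      \<cdot> (((?h1 \<rhd> ?l1) \<odot> (?k1 \<lhd> ?f0)) \<odot>\<rhd> (?z \<unlhd> (?h0 \<bullet> ?f0))))
     = (((?h1 \<unrhd> ?M1) \<lhd>\<odot> (?k0 \<lhd> ?f0)) \<cdot> ((?h1 \<rhd> ?l1) \<odot>\<rhd> ((?h1 \<unrhd> ?y) \<unlhd> ?f0) \<lhd>\<odot> (?k0 \<lhd> ?f0))) \<cdot>
     ((?h1 \<rhd> ?l1) \<odot>\<rhd> (?N0 \<unlhd> ?f0))"
    unfolding 2 by simp
  also have "\<dots> = (((?h1 \<bullet> ?f1) \<unrhd> ?x) \<lhd>\<odot> ((?h1 \<rhd> ?l0) \<odot> (?k0 \<lhd> ?f0)))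
      \<cdot> (((?h1 \<unrhd> ?M0) \<lhd>\<odot> (?k0 \<lhd> ?f0)) \<cdot> ((?h1 \<rhd> ?l1) \<odot>\<rhd> (?N0 \<unlhd> ?f0)))"
    unfolding 1 by simp
  finally show ?thesis
    by (subst p3_mors_iff) (simp add: mcell_p2_cmp1)
qed

lemma p3_cmp1_assoc:
  assumes "u \<in> p3_mors A" "v \<in> p3_mors A" "w \<in> p3_mors A" "pcod u = pdom v" "pcod v = pdom w"
  shows "p3_cmp1 A (p3_cmp1 A w v) u = p3_cmp1 A w (p3_cmp1 A v u)"
  using assms by (simp add: p3_cmp1_def p2_cmp1_assoc)

lemma p3_cmp1_one:
  assumes "u \<in> p3_mors A"
  shows "pdom u = x \<Longrightarrow> p3_cmp1 A u (one1 (path3 A) x) = u"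
    "pcod u = x \<Longrightarrow> p3_cmp1 A (one1 (path3 A) x) u = u"
  using assms p2_cmp1_one[of "part0 u"] p2_cmp1_one[of "part1 u"]
  \<comment> \<open>Identities of \<open>path2\<close> stay folded so that its unit laws apply to
    both parts.\<close>
  by (auto intro!: pcell.expand simp: p3_cmp1_def simp del: path2_sel(11))

end

section \<open>Perturbations\<close>

definition p3_mor where
  "p3_mor A B F G p q \<sigma> \<tau> \<Omega> f = PCell (\<Omega> (dom1 A f)) (\<Omega> (cod1 A f)) (p2_mor A B F G p q \<sigma> f)
    (p2_mor A B F G p q \<tau> f)"

definition pseudo3 where
  "pseudo3 A B F G p q \<sigma> \<tau> \<Omega> = pair_pseudo A (path3 B) \<Omega> (p3_mor A B F G p q \<sigma> \<tau> \<Omega>)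
    (pseudo2 A B F G p q \<sigma>) (pseudo2 A B F G p q \<tau>)"

context arrow_trimod
begin

abbreviation "S \<equiv> pseudo2 A B F G p q \<sigma>"

lemma S_sel [simp]:
  "X \<in> C0 A \<Longrightarrow> act0 S X = md0 \<sigma> X" "f \<in> C1 A \<Longrightarrow> act1 S f = s f"
  "u \<in> C2 A \<Longrightarrow> act2 S u = PCell (s (dom2 A u)) (s (cod2 A u)) (p.t u) (q.t u)"
  "\<Gamma> \<in> C3 A \<Longrightarrow> act3 S \<Gamma> = PCell (act2 S (dom3 A \<Gamma>)) (act2 S (cod3 A \<Gamma>)) (act3 p.P \<Gamma>) (act3 q.P \<Gamma>)"
  "X \<in> C0 A \<Longrightarrow> unitor S X = PCell (one1 (path2 B) (md0 \<sigma> X)) (s (one1 A X)) (p.\<iota> X) (q.\<iota> X)"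
  "\<lbrakk>f \<in> C1 A; g \<in> C1 A; cod1 A f = dom1 A g\<rbrakk> \<Longrightarrow> compositor S g f =
    PCell (p2_cmp1 B (s g) (s f)) (s (g \<bullet>\<^bsub>A\<^esub> f)) (p.\<chi> g f) (q.\<chi> g f)"
  by (simp_all add: pseudo2_def pair_pseudo_def Let_def composable_def)

lemma S_mem:
  "u \<in> C2 A \<Longrightarrow> act2 S u \<in> p2_twos B" "\<Gamma> \<in> C3 A \<Longrightarrow> act3 S \<Gamma> \<in> p2_threes B"
  "X \<in> C0 A \<Longrightarrow> unitor S X \<in> p2_twos B"
  "\<lbrakk>f \<in> C1 A; g \<in> C1 A; cod1 A f = dom1 A g\<rbrakk> \<Longrightarrow> compositor S g f \<in> p2_twos B"
  using arrow_pseudofunctor.two[OF pseudo2(1), of u] arrow_pseudofunctor.three[OF pseudo2(1), of \<Gamma>]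
    arrow_pseudofunctor.unitor_iso[OF pseudo2(1), of X]
    arrow_pseudofunctor.compositor_iso[OF pseudo2(1), of f g]
  by (simp_all only: is2_def is3_def iso2_def path2_sel)

end

locale trimod_pair = trinat_pair A B F G p q + \<sigma>: arrow_trimod A B F G p q \<sigma> + \<tau>: arrow_trimod A B
F G p q \<tau>
  for A and B (structure) and F G p q \<sigma> \<tau>
begin

text \<open>The compatibility square of a 1-cell has the inverses of \<open>md1 \<sigma> f\<close>
  and \<open>md1 \<tau> f\<close> as two opposite sides; moving them across gives the perturbation
  axiom.\<close>

lemma p3_mor_iff:
  assumes "f \<in> C1 A" "\<And>X. X \<in> C0 A \<Longrightarrow> is3 B (\<Omega> X) (md0 \<sigma> X) (md0 \<tau> X)"
  shows "p3_mor A B F G p q \<sigma> \<tau> \<Omega> f \<in> p3_mors B \<longleftrightarrow>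
    md1 \<tau> f \<cdot> ((act1 G f \<unrhd> \<Omega> (dom1 A f)) \<lhd>\<odot> tr1 p f)
      = (tr1 q f \<odot>\<rhd> (\<Omega> (cod1 A f) \<unlhd> act1 F f)) \<cdot> md1 \<sigma> f"
proof -
  have [simp]: "\<Omega> X \<in> C3 B" "dom3 B (\<Omega> X) = md0 \<sigma> X" "cod3 B (\<Omega> X) = md0 \<tau> X" if "X \<in> C0 A" for X
    using assms(2)[OF that] by (auto simp: is3_def)
  have "p3_mor A B F G p q \<sigma> \<tau> \<Omega> f \<in> p3_mors B \<longleftrightarrow>
      inv3 B (md1 \<tau> f) \<cdot> (tr1 q f \<odot>\<rhd> (\<Omega> (cod1 A f) \<unlhd> act1 F f))
      = ((act1 G f \<unrhd> \<Omega> (dom1 A f)) \<lhd>\<odot> tr1 p f) \<cdot> inv3 B (md1 \<sigma> f)"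
    using assms(1) by (subst F.B.p3_mors_iff) (simp add: p3_mor_def)
  also have "\<dots> \<longleftrightarrow> (tr1 q f \<odot>\<rhd> (\<Omega> (cod1 A f) \<unlhd> act1 F f)) \<cdot> md1 \<sigma> f
      = md1 \<tau> f \<cdot> ((act1 G f \<unrhd> \<Omega> (dom1 A f)) \<lhd>\<odot> tr1 p f)"
    using assms(1) by (subst F.B.inv3_flip[symmetric]) simp_all
  finally show ?thesis by (simp only: eq_commute)
qed

text \<open>Apart from its 1-cells, a pair over \<sigma> and \<tau> only has to agree on faces. It
  does so because both pseudofunctors have those of \<open>p\<close> and \<open>q\<close> as
  faces.\<close>

lemma pair_data3:
  assumes "\<Omega> \<in> extensional (C0 A)" and c: "\<And>X. X \<in> C0 A \<Longrightarrow> is3 B (\<Omega> X) (md0 \<sigma> X) (md0 \<tau> X)"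
    and m: "\<And>f. f \<in> C1 A \<Longrightarrow> p3_mor A B F G p q \<sigma> \<tau> \<Omega> f \<in> p3_mors B"
  shows "pair_data A (path2 B) (path3 B) (path_s2 B) (path_t2 B) (dom3 B)
    (cod3 B) part0 part1 \<sigma>.S \<tau>.S
    \<Omega> (p3_mor A B F G p q \<sigma> \<tau> \<Omega>)"
proof -
  interpret pair_path "path2 B" "path3 B" "path_s2 B" "path_t2 B" "dom3 B" "cod3 B" part0 part1
    by (rule pair_path_path3)
  interpret S: arrow_pseudofunctor A "path2 B" \<sigma>.S by (rule \<sigma>.pseudo2)
  interpret T: arrow_pseudofunctor A "path2 B" \<tau>.S by (rule \<tau>.pseudo2)
  let ?w = "p3_mor A B F G p q \<sigma> \<tau> \<Omega>"
  have [simp]: "pdom (?w f) = \<Omega> (dom1 A f)" "pcod (?w f) = \<Omega> (cod1 A f)" "part0 (?w f) = \<sigma>.s f"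
      "part1 (?w f) = \<tau>.s f" for f
    by (simp_all add: p3_mor_def)
  have [simp]: "\<Omega> X \<in> C3 B" "dom3 B (\<Omega> X) = md0 \<sigma> X" "cod3 B (\<Omega> X) = md0 \<tau> X" if "X \<in> C0 A" for X
    using c[OF that] by (auto simp: is3_def)
  have two: "PCell (?w (dom2 A u)) (?w (cod2 A u)) (act2 \<sigma>.S u) (act2 \<tau>.S u) \<in> p3_twos B" if
      "u \<in> C2 A" for u
    using \<sigma>.S_mem(1)[OF that] \<tau>.S_mem(1)[OF that] that m by (subst F.B.p3_twos_iff) simp
  have unitor: "PCell (one1 (path3 B) (\<Omega> X)) (?w (one1 A X)) (unitor \<sigma>.S X)
      (unitor \<tau>.S X) \<in> p3_twos B"
    if "X \<in> C0 A" for X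
    using \<sigma>.S_mem(3)[OF that] \<tau>.S_mem(3)[OF that] that m F.B.p3_one1_mem[of "\<Omega> X"]
    by (subst F.B.p3_twos_iff) simp
  have compositor: "PCell (p3_cmp1 B (?w g) (?w f)) (?w (g \<bullet>\<^bsub>A\<^esub> f)) (compositor \<sigma>.S g f)
      (compositor \<tau>.S g f) \<in> p3_twos B"
    if "f \<in> C1 A" "g \<in> C1 A" "cod1 A f = dom1 A g" for f g
    using \<sigma>.S_mem(4)[OF that] \<tau>.S_mem(4)[OF that] that m by (subst F.B.p3_twos_iff) simp
  show ?thesis
    apply unfold_locales
    subgoal by fact
    subgoal by simp
    subgoal by (simp add: is1_def m)
    subgoal by simp
    subgoal by simp
    subgoal by simp
    subgoal by simp
    subgoal for u using two[of u] by simp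
    subgoal for \<Gamma>
      using two[of "dom3 A \<Gamma>"] two[of "cod3 A \<Gamma>"] \<sigma>.S_mem(2)[of \<Gamma>] \<tau>.S_mem(2)[of \<Gamma>]
      by (simp add: F.B.p3_threes_iff)
    subgoal by (simp add: is1_def m)
    subgoal for X using F.B.p3_iso2I[OF unitor, of X] \<sigma>.unitor_identical[of X] by simp
    subgoal for f g
      using F.B.p3_iso2I[OF compositor, of f g] \<sigma>.compositor_identical[of f g] by simp
    subgoal for f using F.B.p3_cmp1_one(1)[of "?w f"] m by simp
    subgoal for f using F.B.p3_cmp1_one(2)[of "?w f"] m by simp
    subgoal by (simp add: F.B.p3_cmp1_assoc m)
    done
qed

lemma perturbation_iff: "perturbation A B F G p q \<sigma> \<tau> \<Omega> \<longleftrightarrow>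
    \<Omega> \<in> extensional (C0 A) \<and> (\<forall>X\<in>C0 A. is3 B (\<Omega> X) (md0 \<sigma> X) (md0 \<tau> X)) \<and>
    (\<forall>f\<in>C1 A. p3_mor A B F G p q \<sigma> \<tau> \<Omega> f \<in> p3_mors B)"
proof
  assume "perturbation A B F G p q \<sigma> \<tau> \<Omega>"
  then interpret t: perturbation A B F G p q \<sigma> \<tau> \<Omega> .
  show "\<Omega> \<in> extensional (C0 A) \<and> (\<forall>X\<in>C0 A. is3 B (\<Omega> X) (md0 \<sigma> X) (md0 \<tau> X)) \<and>
    (\<forall>f\<in>C1 A. p3_mor A B F G p q \<sigma> \<tau> \<Omega> f \<in> p3_mors B)"
    using t.ext t.component t.axiom[OF F.A.is1_self] by (auto simp: p3_mor_iff)
next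
  assume a: "\<Omega> \<in> extensional (C0 A) \<and> (\<forall>X\<in>C0 A. is3 B (\<Omega> X) (md0 \<sigma> X) (md0 \<tau> X)) \<and>
    (\<forall>f\<in>C1 A. p3_mor A B F G p q \<sigma> \<tau> \<Omega> f \<in> p3_mors B)"
  show "perturbation A B F G p q \<sigma> \<tau> \<Omega>"
  proof
    show "md1 \<tau> f \<cdot> ((act1 G f \<unrhd> \<Omega> X) \<lhd>\<odot> tr1 p f) = (tr1 q f \<odot>\<rhd> (\<Omega> Y \<unlhd> act1 F f)) \<cdot> md1 \<sigma> f"
      if "is1 A f X Y" for f X Y
      using p3_mor_iff[of f \<Omega>] a that by (auto simp: is1_def)
  qed (use a in auto)
qed

theorem bij_pseudo3:
  "bij_betw (pseudo3 A B F G p q \<sigma> \<tau>) {\<Omega>. perturbation A B F G p q \<sigma> \<tau> \<Omega>}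
    {W. three_pseudofunctor A (path3 B) W \<and>
      after A (path_s2 B) W = pseudo2 A B F G p q \<sigma> \<and> after A (path_t2 B) W = pseudo2 A B F G p q
      \<tau>}"
proof -
  interpret pair_path "path2 B" "path3 B" "path_s2 B" "path_t2 B" "dom3 B" "cod3 B" part0 part1
    by (rule pair_path_path3)
  \<comment> \<open>The action of \<open>R\<close> on 1-cells is forced: its boundary is given by
    \<open>act0 R\<close> and its parts are the projections. Its membership in
    \<open>p3_mors\<close> is the perturbation axiom for \<open>act0 R\<close>.\<close>
  have recover: "perturbation A B F G p q \<sigma> \<tau> (act0 R) \<and> pseudo3 A B F G p q \<sigma> \<tau> (act0 R) = R"
    if R: "arrow_pseudofunctor A (path3 B) R" "after A (path_s2 B) R = \<sigma>.S"
    "after A (path_t2 B) R = \<tau>.S" for R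
  proof -
    interpret R: arrow_pseudofunctor A "path3 B" R by fact
    note d = determined[OF F.A.gray_category_axioms R]
    have e: "act0 R \<in> extensional (C0 A)" "act1 R \<in> extensional (C1 A)"
      using R.ext(1) by (auto simp: gmap_extensional_def)
    have w: "p3_mor A B F G p q \<sigma> \<tau> (act0 R) f = act1 R f" and wm: "act1 R f \<in> p3_mors B" if
        "f \<in> C1 A" for f
      using R.mor[OF that] d(3)[OF that] that
      by (auto simp: is1_def p3_mor_def intro!: pcell.expand)
    have "pseudo3 A B F G p q \<sigma> \<tau> (act0 R) = pair_pseudo A (path3 B) (act0 R) (act1 R) \<sigma>.S \<tau>.S"
      unfolding pseudo3_def by (rule F.A.pair_pseudo_cong) (rule w)
    then have "pseudo3 A B F G p q \<sigma> \<tau> (act0 R) = R"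
      by (simp only: d(1)[symmetric])
    moreover have "perturbation A B F G p q \<sigma> \<tau> (act0 R)"
      using e(1) R.obj d(2) w wm by (auto simp: perturbation_iff is3_def)
    ultimately show ?thesis by blast
  qed
  show ?thesis
  \<comment> \<open>A perturbation is its family of 3-cells, which is the action on objects of the
    associated pseudofunctor; so \<open>act0\<close> is the inverse map.\<close>
  proof (rule bij_betw_byWitness[where f' = act0], goal_cases)
    case 1
    show ?case by (simp add: pseudo3_def pair_pseudo_def)
  next
    case 2
    show ?case using recover by (auto simp: F.A.three_pseudofunctor_iff)
  next
    case 3
    show ?case
    proof clarify
      fix \<Omega> assume "perturbation A B F G p q \<sigma> \<tau> \<Omega>"
      then have d: "pair_data A (path2 B) (path3 B) (path_s2 B) (path_t2 B) (dom3 B)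
          (cod3 B) part0 part1 \<sigma>.S \<tau>.S
        \<Omega> (p3_mor A B F G p q \<sigma> \<tau> \<Omega>)"
        by (intro pair_data3) (auto simp: perturbation_iff)
      show "three_pseudofunctor A (path3 B) (pseudo3 A B F G p q \<sigma> \<tau> \<Omega>) \<and>
        after A (path_s2 B) (pseudo3 A B F G p q \<sigma> \<tau> \<Omega>) = \<sigma>.S \<and> after A (path_t2 B)
        (pseudo3 A B F G p q \<sigma> \<tau> \<Omega>) = \<tau>.S"
        using pair_data.S_pseudofunctor[OF d] pair_data.S_projections[OF d]
        by (simp add: pseudo3_def F.A.three_pseudofunctor_iff)
    qed
  next
    case 4
    show ?case using recover by (auto simp: F.A.three_pseudofunctor_iff)
  qed
qed

end

theorem theorem4p2p6:
  fixes A :: "('o, 'f, 'a, 'g) gray"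
    and B :: "('p, 'h, 'b, 'k) gray"
    and F G :: "('o, 'f, 'a, 'g, 'p, 'h, 'b, 'k) gmap"
  assumes "gray_category A" and "gray_category B"
    and "gray_functor A B F" and "gray_functor A B G"
  shows
    "\<exists>\<P>. bij_betw \<P> {p. trinatural_transformation A B F G p}
        {P. three_pseudofunctor A (path1 B) P \<and>
          after A (path_s0 B) P = of_gray_functor A B F \<and>
          after A (path_t0 B) P = of_gray_functor A B G} \<and>
      (\<forall>p q. trinatural_transformation A B F G p \<and> trinatural_transformation A B F G q \<longrightarrow>
        (\<exists>\<S>. bij_betw \<S> {\<sigma>. trimodification A B F G p q \<sigma>}
            {S. three_pseudofunctor A (path2 B) S \<and>
              after A (path_s1 B) S = \<P> p \<and> after A (path_t1 B) S = \<P> q} \<and>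
          (\<forall>\<sigma> \<tau>. trimodification A B F G p q \<sigma> \<and> trimodification A B F G p q \<tau> \<longrightarrow>
            (\<exists>\<W>. bij_betw \<W> {\<Omega>. perturbation A B F G p q \<sigma> \<tau> \<Omega>}
              {W. three_pseudofunctor A (path3 B) W \<and>
                after A (path_s2 B) W = \<S> \<sigma> \<and> after A (path_t2 B) W = \<S> \<tau>}))))"
proof -
  interpret two_gray_functors A B F G
    using assms by (intro two_gray_functors.intro gray_functor_between.intro)
  show ?thesis
  \<comment> \<open>The witness is fixed before the next level because the faces there are
    prescribed as values of this very map; the same applies to \<open>pseudo2\<close> one level
    further up.\<close>
  proof (rule exI[of _ "pseudo1 A B F G"], intro conjI allI impI)
    show "bij_betw (pseudo1 A B F G) {p. trinatural_transformation A B F G p}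
        {P. three_pseudofunctor A (path1 B) P \<and>
          after A (path_s0 B) P = of_gray_functor A B F \<and> after A (path_t0 B) P = of_gray_functor A B G}"
      by (rule bij_pseudo1)
  next
    fix p q assume "trinatural_transformation A B F G p \<and> trinatural_transformation A B F G q"
    then interpret trinat_pair A B F G p q
      by (intro trinat_pair.intro two_gray_functors_axioms) (simp_all add: trinatural_iff)
    show "\<exists>\<S>. bij_betw \<S> {\<sigma>. trimodification A B F G p q \<sigma>}
            {S. three_pseudofunctor A (path2 B) S \<and>
              after A (path_s1 B) S = pseudo1 A B F G p \<and> after A (path_t1 B) S = pseudo1 A B F G q} \<and>
          (\<forall>\<sigma> \<tau>. trimodification A B F G p q \<sigma> \<and> trimodification A B F G p q \<tau> \<longrightarrow>
            (\<exists>\<W>. bij_betw \<W> {\<Omega>. perturbation A B F G p q \<sigma> \<tau> \<Omega>}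
              {W. three_pseudofunctor A (path3 B) W \<and>
                after A (path_s2 B) W = \<S> \<sigma> \<and> after A (path_t2 B) W = \<S> \<tau>}))"
    proof (rule exI[of _ "pseudo2 A B F G p q"], intro conjI allI impI)
      fix \<sigma> \<tau> assume "trimodification A B F G p q \<sigma> \<and> trimodification A B F G p q \<tau>"
      then interpret trimod_pair A B F G p q \<sigma> \<tau>
        by (intro trimod_pair.intro trinat_pair_axioms) (simp_all add: trimodification_iff)
      show "\<exists>\<W>. bij_betw \<W> {\<Omega>. perturbation A B F G p q \<sigma> \<tau> \<Omega>}
              {W. three_pseudofunctor A (path3 B) W \<and>
                after A (path_s2 B) W = pseudo2 A B F G p q \<sigma> \<and> after A (path_t2 B) W = pseudo2 A B F G p q \<tau>}"
        using bij_pseudo3 by blast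
    qed (rule bij_pseudo2)
  qed
qed

end
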